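(* Let $n=2r+1$ be odd ($r\ge1$) and let $\ell\in\{1,r+1,n\}$. There exists a thin (integrable) representation of the quantum toroidal algebra $\mathcal U_q(sl_{n+1}^{tor})$ whose $q$-character is the sum of all monomials occurring in the monomial crystal $\mathcal M(e^{\varpi_\ell}Y_{\ell,0}Y_{0,d_\ell}^{-1})$, each with multiplicity one.
   Context: Root data. Let $n=2r+1$, $r\ge1$, $I=\{0,\dots,n\}$ identified with $\mathbb Z/(n+1)\mathbb Z$, $C=(C_{i,j})_{i,j\in I}$ the Cartan matrix of type $A_n^{(1)}$ ($C_{i,i}=2$, $C_{i,i\pm1}=-1$, other entries $0$), $\mathfrak h=\bigoplus_{i\in I}\mathbb Q h_i\oplus\mathbb Q d$; $\alpha_i(h_j)=C_{j,i}$, $\alpha_i(d)=\delta_{0,i}$, $\Lambda_i(h_j)=\delta_{i,j}$, $\Lambda_i(d)=0$; $P=\{\lambda\in\mathfrak h^*:\lambda(h_i)\in\mathbb Z\ \forall i\}$, $\varpi_\ell=\Lambda_\ell-\Lambda_0$, $d_\ell=\min(\ell,n+1-\ell)$. Fix $q=e^t\in\mathbb C^*$ not a root of unity, $q^x=e^{tx}$ for $x\in\mathbb Q$, $[l]_q=\frac{q^l-q^{-l}}{q-q^{-1}}$. Monomial crystal. Consider monomials $m=e^{\omega(m)}\prod_{i\in I,l\in\mathbb Z}Y_{i,l}^{u_{i,l}(m)}$ with $u_{i,l}(m)\in\mathbb Z$ (finitely many non-zero), $\omega(m)\in P$, $\sum_l u_{i,l}(m)=\omega(m)(h_i)$. Put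 $A_{i,l}=e^{\alpha_i}Y_{i,l-1}Y_{i,l+1}Y_{i-1,l}^{-1}Y_{i+1,l}^{-1}$. Fix $s:I\to\{0,1\}$ with $s_i+s_j=1$ whenever $C_{i,j}=-1$ (chosen so that the monomials considered lie in $\mathcal M$); $\mathcal M$ is the group of monomials with $u_{i,l}(m)=0$ whenever $l\equiv s_i+1\bmod 2$. Set $\mathrm{wt}(m)=\omega(m)$, $\varphi_{i,L}(m)=\sum_{l\le L}u_{i,l}(m)$, $\varphi_i(m)=\max_L\varphi_{i,L}(m)$, $\varepsilon_{i,L}(m)=-\sum_{l\ge L}u_{i,l}(m)$, $\varepsilon_i(m)=\max_L\varepsilon_{i,L}(m)$, $p_i(m)=\max\{L:\varepsilon_{i,L}(m)=\varepsilon_i(m)\}$, $q_i(m)=\min\{L:\varphi_{i,L}(m)=\varphi_i(m)\}$; $\tilde e_i\cdot m=0$ if $\varepsilon_i(m)=0$, else $\tilde e_i\cdot m=mA_{i,p_i(m)-1}$; $\tilde f_i\cdot m=0$ if $\varphi_i(m)=0$, else $\tilde f_i\cdot m=mA_{i,q_i(m)+1}^{-1}$. $\mathcal M(m)$ is the connected subcrystal generated by $m$. Quantum toroidal algebra. $\mathcal U_q(sl_{n+1}^{tor})$ is the $\mathbb C$-algebra with generators $x_{i,r}^\pm$ ($i\in I,r\in\mathbb Z$), $k_h$ ($h\in\mathfrak h$), $h_{i,m}$ ($i\in I,m\in\mathbb Z\setminus\{0\}$) and relations: $k_hk_{h'}=k_{h+h'}$, $k_0=1$, $[k_h,h_{j,m}]=0$,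 $[h_{i,m},h_{j,m'}]=0$; $k_hx_{j,r}^\pm k_{-h}=q^{\pm\alpha_j(h)}x_{j,r}^\pm$; $[h_{i,m},x_{j,r}^\pm]=\pm\frac1m[mC_{i,j}]_qx_{j,m+r}^\pm$; $[x_{i,r}^+,x_{j,r'}^-]=\delta_{ij}\frac{\phi^+_{i,r+r'}-\phi^-_{i,r+r'}}{q-q^{-1}}$; $x_{i,r+1}^\pm x_{j,r'}^\pm-q^{\pm C_{ij}}x_{j,r'}^\pm x_{i,r+1}^\pm=q^{\pm C_{ij}}x_{i,r}^\pm x_{j,r'+1}^\pm-x_{j,r'+1}^\pm x_{i,r}^\pm$; for $j=i+1$ and $j=i-1$ the expression $x_{i,r_1}^\pm x_{i,r_2}^\pm x_{j,r'}^\pm-(q+q^{-1})x_{i,r_1}^\pm x_{j,r'}^\pm x_{i,r_2}^\pm+x_{j,r'}^\pm x_{i,r_1}^\pm x_{i,r_2}^\pm$ plus the same expression with $r_1,r_2$ exchanged is $0$; $[x_{i,r_1}^\pm,x_{j,r_2}^\pm]=0$ if $i\ne j,j\pm1$. Here $\phi_i^\pm(z)=\sum_{m\ge0}\phi^\pm_{i,\pm m}z^{\pm m}=k_{h_i}^{\pm1}\exp\big(\pm(q-q^{-1})\sum_{m'\ge1}h_{i,\pm m'}z^{\pm m'}\big)$ and $\phi^+_{i,m}=0$ for $m<0$, $\phi^-_{i,m}=0$ for $m>0$. $\mathcal U_q(\hat{\mathfrak h})$ is the commutative subalgebra generated by all $k_h$, $h_{i,m}$. Representations. For $\nu\in P$,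 $V_\nu=\{v:k_hv=q^{\nu(h)}v\ \forall h\in\mathfrak h\}$. $V$ is integrable if $V=\bigoplus_{\nu\in P}V_\nu$ and all $x_{i,0}^\pm$ ($i\in I$) are locally nilpotent. $V$ is weighted if $\mathcal U_q(\hat{\mathfrak h})$ acts by diagonalizable operators, and thin if it is weighted and its joint spectrum is simple (joint eigenspaces of $\mathcal U_q(\hat{\mathfrak h})$ are one-dimensional). For a monomial $m$, $V_m$ is the subspace of $V_{\omega(m)}$ on which, for every $i$, $\phi_i^\pm(z)$ has generalized eigenvalue the expansion in $z^{\pm1}$ of $\prod_l\big(q\frac{1-zq^{l-1}}{1-zq^{l+1}}\big)^{u_{i,l}(m)}$ ($m$ is then called an $\ell$-weight). When $V$ is the direct sum of the $V_m$ with each $V_m$ finite-dimensional, the $q$-character is $\chi_q(V)=\sum_m\dim(V_m)\,m$. *)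

theory Defs
  imports
    Complex_Main
    "HOL-Library.Poly_Mapping"
    "HOL-Library.Product_Plus"
    "HOL-Computational_Algebra.Formal_Power_Series"
    "HOL-Algebra.QuotRing"
    "HOL-Algebra.Generated_Rings"
begin

section \<open>Root data of type \<open>A\<^sub>n\<^sup>(\<^sup>1\<^sup>)\<close>\<close>

text \<open>The index set \<open>I = {0..n}\<close> is identified with the integers modulo \<open>n + 1\<close>;
  \<open>nxt\<close> and \<open>prv\<close> are \<open>i + 1\<close> and \<open>i - 1\<close> in it.\<close>

definition nxt :: "nat \<Rightarrow> nat \<Rightarrow> nat" where
  "nxt n i = (i + 1) mod (n + 1)"

definition prv :: "nat \<Rightarrow> nat \<Rightarrow> nat" where
  "prv n i = (i + n) mod (n + 1)"

definition cartan_mat :: "nat \<Rightarrow> nat \<Rightarrow> nat \<Rightarrow> int" where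
  "cartan_mat n i j = (if i = j then 2 else if j = nxt n i \<or> j = prv n i then - 1 else 0)"

text \<open>An element of the Cartan algebra is given by its rational coordinates on the basis
  \<open>h\<^sub>0, \<dots>, h\<^sub>n, d\<close>. An element of its dual is given by its values on that basis, i.e.\ by its
  coordinates on the dual basis; thus \<open>single (HB i) 1\<close> is \<open>h\<^sub>i\<close> as an element of the Cartan
  algebra, and the fundamental weight \<open>\<Lambda>\<^sub>i\<close> as a weight.\<close>

datatype cbasis = HB nat | DB

type_synonym cartan = "cbasis \<Rightarrow>\<^sub>0 rat"
type_synonym weight = "cbasis \<Rightarrow>\<^sub>0 rat"

definition cartan_space :: "nat \<Rightarrow> cartan set" where
  "cartan_space n = {h. Poly_Mapping.keys h \<subseteq> HB ` {0..n} \<union> {DB}}"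

definition hvec :: "nat \<Rightarrow> cartan" where
  "hvec i = Poly_Mapping.single (HB i) 1"

definition Lam :: "nat \<Rightarrow> weight" where
  "Lam i = Poly_Mapping.single (HB i) 1"

definition pairing :: "weight \<Rightarrow> cartan \<Rightarrow> rat" where
  "pairing \<nu> h = (\<Sum>b\<in>Poly_Mapping.keys h. Poly_Mapping.lookup \<nu> b * Poly_Mapping.lookup h b)"

definition weight_lattice :: "nat \<Rightarrow> weight set" where
  "weight_lattice n =
     {\<nu>. Poly_Mapping.keys \<nu> \<subseteq> HB ` {0..n} \<union> {DB} \<and> (\<forall>i\<in>{0..n}. pairing \<nu> (hvec i) \<in> \<int>)}"

definition alpha :: "nat \<Rightarrow> nat \<Rightarrow> weight" where
  "alpha n i = (\<Sum>j\<in>{0..n}. Poly_Mapping.single (HB j) (of_int (cartan_mat n j i)))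
     + Poly_Mapping.single DB (if i = 0 then 1 else 0)"

definition varpi :: "nat \<Rightarrow> weight" where
  "varpi l = Lam l - Lam 0"


section \<open>The monomial crystal\<close>

text \<open>The monomial \<open>e\<^sup>\<omega> \<Prod> Y\<^sub>i\<^sub>,\<^sub>l\<^sup>u\<^sup>(\<^sup>i\<^sup>,\<^sup>l\<^sup>)\<close> is the pair \<open>(\<omega>, u)\<close>. The group of monomials is
  written additively: \<open>+\<close> is the product of monomials and \<open>-\<close> the quotient.\<close>

type_synonym monom = "weight \<times> (nat \<times> int \<Rightarrow>\<^sub>0 int)"

definition wgt :: "monom \<Rightarrow> weight" where
  "wgt m = fst m"

definition uexp :: "monom \<Rightarrow> nat \<Rightarrow> int \<Rightarrow> int" where
  "uexp m i l = Poly_Mapping.lookup (snd m) (i, l)"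

definition usupp :: "monom \<Rightarrow> nat \<Rightarrow> int set" where
  "usupp m i = {l. uexp m i l \<noteq> 0}"

definition Yvar :: "nat \<Rightarrow> int \<Rightarrow> nat \<times> int \<Rightarrow>\<^sub>0 int" where
  "Yvar i l = Poly_Mapping.single (i, l) 1"

definition Amon :: "nat \<Rightarrow> nat \<Rightarrow> int \<Rightarrow> monom" where
  "Amon n i l =
     (alpha n i, Yvar i (l - 1) + Yvar i (l + 1) - Yvar (prv n i) l - Yvar (nxt n i) l)"

definition monomials :: "nat \<Rightarrow> monom set" where
  "monomials n = {m. Poly_Mapping.keys (snd m) \<subseteq> {0..n} \<times> UNIV \<and> wgt m \<in> weight_lattice n \<and>
     (\<forall>i\<in>{0..n}. of_int (\<Sum>l\<in>usupp m i. uexp m i l) = pairing (wgt m) (hvec i))}"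

definition parity_function :: "nat \<Rightarrow> (nat \<Rightarrow> nat) \<Rightarrow> bool" where
  "parity_function n s \<longleftrightarrow> (\<forall>i\<in>{0..n}. s i \<in> {0, 1}) \<and>
     (\<forall>i\<in>{0..n}. \<forall>j\<in>{0..n}. cartan_mat n i j = - 1 \<longrightarrow> s i + s j = 1)"

definition crystal_monomials :: "nat \<Rightarrow> (nat \<Rightarrow> nat) \<Rightarrow> monom set" where
  "crystal_monomials n s = {m \<in> monomials n.
     \<forall>i\<in>{0..n}. \<forall>l. l mod 2 = (int (s i) + 1) mod 2 \<longrightarrow> uexp m i l = 0}"

definition phi_part :: "monom \<Rightarrow> nat \<Rightarrow> int \<Rightarrow> int" where
  "phi_part m i L = (\<Sum>l | l \<in> usupp m i \<and> l \<le> L. uexp m i l)"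

definition phi_max :: "monom \<Rightarrow> nat \<Rightarrow> int" where
  "phi_max m i = Max (range (phi_part m i))"

definition eps_part :: "monom \<Rightarrow> nat \<Rightarrow> int \<Rightarrow> int" where
  "eps_part m i L = - (\<Sum>l | l \<in> usupp m i \<and> l \<ge> L. uexp m i l)"

definition eps_max :: "monom \<Rightarrow> nat \<Rightarrow> int" where
  "eps_max m i = Max (range (eps_part m i))"

text \<open>The sets of maximising \<open>L\<close> below may be infinite in one direction, hence \<open>GREATEST\<close> and
  \<open>LEAST\<close> instead of \<open>Max\<close> and \<open>Min\<close>. They have a greatest (least) element whenever
  \<open>eps_max m i\<close> (\<open>phi_max m i\<close>) is positive, which is the only case in which they are used.\<close>

definition p_pos :: "monom \<Rightarrow> nat \<Rightarrow> int" where
  "p_pos m i = (GREATEST L. eps_part m i L = eps_max m i)"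

definition q_pos :: "monom \<Rightarrow> nat \<Rightarrow> int" where
  "q_pos m i = (LEAST L. phi_part m i L = phi_max m i)"

definition e_op :: "nat \<Rightarrow> nat \<Rightarrow> monom \<Rightarrow> monom option" where
  "e_op n i m = (if eps_max m i = 0 then None else Some (m + Amon n i (p_pos m i - 1)))"

definition f_op :: "nat \<Rightarrow> nat \<Rightarrow> monom \<Rightarrow> monom option" where
  "f_op n i m = (if phi_max m i = 0 then None else Some (m - Amon n i (q_pos m i + 1)))"

definition crystal_edges :: "nat \<Rightarrow> (nat \<Rightarrow> nat) \<Rightarrow> (monom \<times> monom) set" where
  "crystal_edges n s = {(m, m'). m \<in> crystal_monomials n s \<and> m' \<in> crystal_monomials n s \<and>
     (\<exists>i\<in>{0..n}. e_op n i m = Some m' \<or> f_op n i m = Some m')}"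

definition monomial_crystal :: "nat \<Rightarrow> (nat \<Rightarrow> nat) \<Rightarrow> monom \<Rightarrow> monom set" where
  "monomial_crystal n s m = {m'. (m, m') \<in> (crystal_edges n s)\<^sup>*}"

definition d_index :: "nat \<Rightarrow> nat \<Rightarrow> nat" where
  "d_index n l = min l (n + 1 - l)"

definition extremal_monomial :: "nat \<Rightarrow> nat \<Rightarrow> monom" where
  "extremal_monomial n l = (varpi l, Yvar l 0 - Yvar 0 (int (d_index n l)))"


section \<open>The quantum toroidal algebra\<close>

text \<open>\<open>qpow t x\<close> is \<open>q\<^sup>x = e\<^sup>t\<^sup>x\<close>, where \<open>q = e\<^sup>t\<close>.\<close>

definition qpow :: "complex \<Rightarrow> rat \<Rightarrow> complex" where
  "qpow t x = exp (t * of_rat x)"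

definition qint :: "complex \<Rightarrow> int \<Rightarrow> complex" where
  "qint t l = (qpow t (of_int l) - qpow t (- of_int l)) / (qpow t 1 - qpow t (- 1))"

text \<open>Lists under concatenation are the free monoid, so \<^typ>\<open>'g list \<Rightarrow>\<^sub>0 complex\<close> is, with the
  convolution product of finitely supported functions, the free associative unital algebra.\<close>

instantiation list :: (type) monoid_add
begin
definition zero_list :: "'a list" where "zero_list = []"
definition plus_list :: "'a list \<Rightarrow> 'a list \<Rightarrow> 'a list" where "plus_list = (@)"
instance by standard (simp_all add: zero_list_def plus_list_def)
end

definition free_algebra :: "'g set \<Rightarrow> ('g list \<Rightarrow>\<^sub>0 complex) ring" where
  "free_algebra G = \<lparr>carrier = {p. \<forall>w\<in>Poly_Mapping.keys p. set w \<subseteq> G},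
     mult = (*), one = 1, zero = 0, add = (+)\<rparr>"

text \<open>\<open>XG \<epsilon> i r\<close> with \<open>\<epsilon> = \<plusminus>1\<close> stands for the generator \<open>x\<^sup>\<plusminus>\<close> with indices \<open>i, r\<close>.\<close>

datatype gen = XG int nat int | KG cartan | HG nat int

definition gens :: "nat \<Rightarrow> gen set" where
  "gens n = {XG \<epsilon> i r | \<epsilon> i r. \<epsilon> \<in> {1, - 1} \<and> i \<in> {0..n}} \<union>
     {KG h | h. h \<in> cartan_space n} \<union> {HG i m | i m. i \<in> {0..n} \<and> m \<noteq> 0}"

type_synonym falg = "gen list \<Rightarrow>\<^sub>0 complex"

definition cst :: "complex \<Rightarrow> falg" where
  "cst c = Poly_Mapping.single 0 c"

definition gx :: "int \<Rightarrow> nat \<Rightarrow> int \<Rightarrow> falg" where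
  "gx \<epsilon> i r = Poly_Mapping.single [XG \<epsilon> i r] 1"

definition gk :: "cartan \<Rightarrow> falg" where
  "gk h = Poly_Mapping.single [KG h] 1"

definition gh :: "nat \<Rightarrow> int \<Rightarrow> falg" where
  "gh i m = Poly_Mapping.single [HG i m] 1"

definition commutator :: "falg \<Rightarrow> falg \<Rightarrow> falg" where
  "commutator a b = a * b - b * a"

definition exp_series :: "falg fps \<Rightarrow> falg fps" where
  "exp_series F = fps_compose (Abs_fps (\<lambda>k. cst (1 / fact k))) F"

text \<open>\<open>phi_elt t \<epsilon> i m\<close> is \<open>\<phi>\<^sup>\<plusminus>\<close> with indices \<open>i, m\<close>, where \<open>\<epsilon> = \<plusminus>1\<close>: the coefficient of \<open>z\<^sup>m\<close> in
  \<open>k \<cdot> exp (\<plusminus>(q - q\<^sup>-\<^sup>1) \<Sum> h z\<^sup>\<plusminus>\<^sup>m\<^sup>')\<close>, computed as a power series in \<open>z\<^sup>\<epsilon>\<close>.\<close>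

definition phi_elt :: "complex \<Rightarrow> int \<Rightarrow> nat \<Rightarrow> int \<Rightarrow> falg" where
  "phi_elt t \<epsilon> i m = (if \<epsilon> * m < 0 then 0 else
     gk (if \<epsilon> = 1 then hvec i else - hvec i) *
     fps_nth (exp_series (Abs_fps (\<lambda>m'. if m' = 0 then 0 else
         cst (of_int \<epsilon> * (qpow t 1 - qpow t (- 1))) * gh i (\<epsilon> * int m'))))
       (nat (\<epsilon> * m)))"

definition serre_elt :: "complex \<Rightarrow> int \<Rightarrow> nat \<Rightarrow> nat \<Rightarrow> int \<Rightarrow> int \<Rightarrow> int \<Rightarrow> falg" where
  "serre_elt t \<epsilon> i j r\<^sub>1 r\<^sub>2 r' =
     gx \<epsilon> i r\<^sub>1 * gx \<epsilon> i r\<^sub>2 * gx \<epsilon> j r'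
     - cst (qpow t 1 + qpow t (- 1)) * (gx \<epsilon> i r\<^sub>1 * gx \<epsilon> j r' * gx \<epsilon> i r\<^sub>2)
     + gx \<epsilon> j r' * gx \<epsilon> i r\<^sub>1 * gx \<epsilon> i r\<^sub>2"

text \<open>Each relation \<open>a = b\<close> is recorded as the element \<open>a - b\<close> of the free algebra.\<close>

definition relations_k :: "nat \<Rightarrow> falg set" where
  "relations_k n =
     {gk h * gk h' - gk (h + h') | h h'. h \<in> cartan_space n \<and> h' \<in> cartan_space n} \<union>
     {gk 0 - 1}"

definition relations_kh :: "nat \<Rightarrow> falg set" where
  "relations_kh n =
     {commutator (gk h) (gh j m) | h j m. h \<in> cartan_space n \<and> j \<in> {0..n} \<and> m \<noteq> 0} \<union>
     {commutator (gh i m) (gh j m') | i m j m'.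
        i \<in> {0..n} \<and> j \<in> {0..n} \<and> m \<noteq> 0 \<and> m' \<noteq> 0}"

definition relations_kx :: "nat \<Rightarrow> complex \<Rightarrow> falg set" where
  "relations_kx n t =
     {gk h * gx \<epsilon> j r * gk (- h) - cst (qpow t (of_int \<epsilon> * pairing (alpha n j) h)) * gx \<epsilon> j r
      | h \<epsilon> j r. h \<in> cartan_space n \<and> \<epsilon> \<in> {1, - 1} \<and> j \<in> {0..n}}"

definition relations_hx :: "nat \<Rightarrow> complex \<Rightarrow> falg set" where
  "relations_hx n t =
     {commutator (gh i m) (gx \<epsilon> j r)
        - cst (of_int \<epsilon> * (1 / of_int m) * qint t (m * cartan_mat n i j)) * gx \<epsilon> j (m + r)
      | i m \<epsilon> j r. i \<in> {0..n} \<and> m \<noteq> 0 \<and> \<epsilon> \<in> {1, - 1} \<and> j \<in> {0..n}}"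

definition relations_xx_opposite :: "nat \<Rightarrow> complex \<Rightarrow> falg set" where
  "relations_xx_opposite n t =
     {commutator (gx 1 i r) (gx (- 1) j r')
        - (if i = j then cst (1 / (qpow t 1 - qpow t (- 1))) *
             (phi_elt t 1 i (r + r') - phi_elt t (- 1) i (r + r')) else 0)
      | i j r r'. i \<in> {0..n} \<and> j \<in> {0..n}}"

definition relations_xx :: "nat \<Rightarrow> complex \<Rightarrow> falg set" where
  "relations_xx n t =
     {(gx \<epsilon> i (r + 1) * gx \<epsilon> j r' - cst c * (gx \<epsilon> j r' * gx \<epsilon> i (r + 1)))
        - (cst c * (gx \<epsilon> i r * gx \<epsilon> j (r' + 1)) - gx \<epsilon> j (r' + 1) * gx \<epsilon> i r)
      | \<epsilon> i j r r' c. \<epsilon> \<in> {1, - 1} \<and> i \<in> {0..n} \<and> j \<in> {0..n} \<and>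
          c = qpow t (of_int (\<epsilon> * cartan_mat n i j))}"

definition relations_serre :: "nat \<Rightarrow> complex \<Rightarrow> falg set" where
  "relations_serre n t =
     {serre_elt t \<epsilon> i j r\<^sub>1 r\<^sub>2 r' + serre_elt t \<epsilon> i j r\<^sub>2 r\<^sub>1 r'
      | \<epsilon> i j r\<^sub>1 r\<^sub>2 r'. \<epsilon> \<in> {1, - 1} \<and> i \<in> {0..n} \<and> (j = nxt n i \<or> j = prv n i)}"

definition relations_commute :: "nat \<Rightarrow> falg set" where
  "relations_commute n =
     {commutator (gx \<epsilon> i r\<^sub>1) (gx \<epsilon> j r\<^sub>2)
      | \<epsilon> i j r\<^sub>1 r\<^sub>2. \<epsilon> \<in> {1, - 1} \<and> i \<in> {0..n} \<and> j \<in> {0..n} \<and>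
          i \<noteq> j \<and> i \<noteq> nxt n j \<and> i \<noteq> prv n j}"

definition toroidal_relations :: "nat \<Rightarrow> complex \<Rightarrow> falg set" where
  "toroidal_relations n t =
     relations_k n \<union> relations_kh n \<union> relations_kx n t \<union> relations_hx n t \<union>
     relations_xx_opposite n t \<union> relations_xx n t \<union> relations_serre n t \<union> relations_commute n"

definition toroidal_ideal :: "nat \<Rightarrow> complex \<Rightarrow> falg set" where
  "toroidal_ideal n t = genideal (free_algebra (gens n)) (toroidal_relations n t)"

definition toroidal_algebra :: "nat \<Rightarrow> complex \<Rightarrow> falg set ring" where
  "toroidal_algebra n t = free_algebra (gens n) Quot toroidal_ideal n t"

definition cls :: "nat \<Rightarrow> complex \<Rightarrow> falg \<Rightarrow> falg set" where
  "cls n t a = toroidal_ideal n t +>\<^bsub>free_algebra (gens n)\<^esub> a"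

text \<open>The scalars are included in the generating set in order to obtain the generated subalgebra,
  not just the generated subring.\<close>

definition cartan_subalgebra :: "nat \<Rightarrow> complex \<Rightarrow> falg set set" where
  "cartan_subalgebra n t = generate_ring (toroidal_algebra n t)
     (cls n t ` ({cst c | c. True} \<union> {gk h | h. h \<in> cartan_space n} \<union>
        {gh i m | i m. i \<in> {0..n} \<and> m \<noteq> 0}))"


section \<open>Representations\<close>

text \<open>The eigenvalue of the series \<open>\<phi>\<^sup>\<plusminus>\<close> attached to a single variable with second index \<open>l\<close>,
  namely \<open>q (1 - z q\<^sup>l\<^sup>-\<^sup>1) / (1 - z q\<^sup>l\<^sup>+\<^sup>1)\<close>, as a power series in \<open>z\<^sup>\<epsilon>\<close>.
  For \<open>\<epsilon> = -1\<close> the fraction is first rewritten as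
  \<open>q (z\<^sup>-\<^sup>1 - q\<^sup>l\<^sup>-\<^sup>1) / (z\<^sup>-\<^sup>1 - q\<^sup>l\<^sup>+\<^sup>1)\<close>.\<close>

definition Y_series :: "complex \<Rightarrow> int \<Rightarrow> int \<Rightarrow> complex fps" where
  "Y_series t \<epsilon> l =
     (if \<epsilon> = 1 then
        fps_const (qpow t 1) * (1 - fps_const (qpow t (of_int (l - 1))) * fps_X)
          * inverse (1 - fps_const (qpow t (of_int (l + 1))) * fps_X)
      else
        fps_const (qpow t 1) * (fps_X - fps_const (qpow t (of_int (l - 1))))
          * inverse (fps_X - fps_const (qpow t (of_int (l + 1)))))"

definition l_weight_series :: "complex \<Rightarrow> int \<Rightarrow> nat \<Rightarrow> monom \<Rightarrow> complex fps" where
  "l_weight_series t \<epsilon> i m = (\<Prod>l\<in>usupp m i. Y_series t \<epsilon> l powi uexp m i l)"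

text \<open>A representation: a subspace \<open>V\<close> of an ambient complex vector space, with a unital left
  action of the quotient algebra in which scalars act by scalar multiplication.\<close>

locale toroidal_module = vector_space scale
  for scale :: "complex \<Rightarrow> 'v::ab_group_add \<Rightarrow> 'v" +
  fixes n :: nat and t :: complex and V :: "'v set" and act :: "falg set \<Rightarrow> 'v \<Rightarrow> 'v"
  assumes V_subspace: "subspace V"
    and act_closed: "a \<in> carrier (toroidal_algebra n t) \<Longrightarrow> v \<in> V \<Longrightarrow> act a v \<in> V"
    and act_add_right: "a \<in> carrier (toroidal_algebra n t) \<Longrightarrow> v \<in> V \<Longrightarrow> w \<in> V \<Longrightarrow>
          act a (v + w) = act a v + act a w"
    and act_add_left: "a \<in> carrier (toroidal_algebra n t) \<Longrightarrow> b \<in> carrier (toroidal_algebra n t) \<Longrightarrow>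
          v \<in> V \<Longrightarrow> act (a \<oplus>\<^bsub>toroidal_algebra n t\<^esub> b) v = act a v + act b v"
    and act_mult: "a \<in> carrier (toroidal_algebra n t) \<Longrightarrow> b \<in> carrier (toroidal_algebra n t) \<Longrightarrow>
          v \<in> V \<Longrightarrow> act (a \<otimes>\<^bsub>toroidal_algebra n t\<^esub> b) v = act a (act b v)"
    and act_one: "v \<in> V \<Longrightarrow> act \<one>\<^bsub>toroidal_algebra n t\<^esub> v = v"
    and act_scalar: "v \<in> V \<Longrightarrow> act (cls n t (cst c)) v = scale c v"
begin

definition direct_sum_of :: "'i set \<Rightarrow> ('i \<Rightarrow> 'v set) \<Rightarrow> bool" where
  "direct_sum_of J W \<longleftrightarrow> (\<forall>j\<in>J. subspace (W j)) \<and> span (\<Union>j\<in>J. W j) = V \<and>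
     (\<forall>F w. finite F \<and> F \<subseteq> J \<and> (\<forall>j\<in>F. w j \<in> W j) \<and> (\<Sum>j\<in>F. w j) = 0 \<longrightarrow> (\<forall>j\<in>F. w j = 0))"

definition weight_space :: "weight \<Rightarrow> 'v set" where
  "weight_space \<nu> = {v \<in> V. \<forall>h\<in>cartan_space n.
     act (cls n t (gk h)) v = scale (qpow t (pairing \<nu> h)) v}"

definition integrable :: bool where
  "integrable \<longleftrightarrow> direct_sum_of (weight_lattice n) weight_space \<and>
     (\<forall>\<epsilon>\<in>{1, - 1}. \<forall>i\<in>{0..n}. \<forall>v\<in>V. \<exists>N::nat. (act (cls n t (gx \<epsilon> i 0)) ^^ N) v = 0)"

definition weighted :: bool where
  "weighted \<longleftrightarrow> (\<forall>a\<in>cartan_subalgebra n t. span {v \<in> V. \<exists>c. act a v = scale c v} = V)"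

definition joint_eigenspace :: "(falg set \<Rightarrow> complex) \<Rightarrow> 'v set" where
  "joint_eigenspace \<chi> = {v \<in> V. \<forall>a\<in>cartan_subalgebra n t. act a v = scale (\<chi> a) v}"

definition thin :: bool where
  "thin \<longleftrightarrow> weighted \<and> (\<forall>\<chi>. joint_eigenspace \<chi> \<noteq> {0} \<longrightarrow> dim (joint_eigenspace \<chi>) = 1)"

definition l_weight_space :: "monom \<Rightarrow> 'v set" where
  "l_weight_space m = {v \<in> weight_space (wgt m). \<forall>i\<in>{0..n}. \<forall>\<epsilon>\<in>{1, - 1}. \<forall>k::nat. \<exists>N::nat.
     ((\<lambda>w. act (cls n t (phi_elt t \<epsilon> i (\<epsilon> * int k))) w
           - scale (fps_nth (l_weight_series t \<epsilon> i m) k) w) ^^ N) v = 0}"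

text \<open>The formal sum \<open>\<Sum> c\<^sub>m m\<close> is represented by its coefficient function.\<close>

definition has_q_character :: "(monom \<Rightarrow> nat) \<Rightarrow> bool" where
  "has_q_character \<chi> \<longleftrightarrow> direct_sum_of (monomials n) l_weight_space \<and>
     (\<forall>m\<in>monomials n. (\<exists>B. finite B \<and> l_weight_space m \<subseteq> span B)) \<and>
     (\<forall>m. \<chi> m = (if m \<in> monomials n then dim (l_weight_space m) else 0))"

end

end

theory Submission
  imports Defs "HOL-Computational_Algebra.Polynomial"
begin

text \<open>
  The representation has the monomials of the crystal as a basis, and every operator of the
  presentation is given by a formula that looks at one node of the Dynkin diagram only.

  The decisive property of these three crystals is that for every monomial \<open>m\<close> and every node \<open>i\<close>
  the part of \<open>m\<close> at \<open>i\<close> is \<open>1\<close>, a single variable \<open>Y\<^sub>i\<^sub>,\<^sub>l\<close> or the inverse of one; call a set of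
  monomials with this property minuscule if it is also stable under the moves that replace \<open>m\<close> by
  \<open>m / A\<^sub>i\<^sub>,\<^sub>l\<^sub>+\<^sub>1\<close> in the second case and by \<open>m A\<^sub>i\<^sub>,\<^sub>l\<^sub>-\<^sub>1\<close> in the third. On minuscule monomials these moves
  are the Kashiwara operators. The operators with indices \<open>i, r\<close> are defined to perform the move at
  \<open>i\<close>, if there is one, with the coefficient \<open>q\<^sup>r\<^sup>a\<close>, where \<open>A\<^sub>i\<^sub>,\<^sub>a\<close> is the monomial that the move
  involves; the commuting currents act diagonally, with the eigenvalues that the monomial prescribes.

  Every relation then concerns one node or two. For one node it is the computation in a
  two-dimensional evaluation module of quantum affine \<open>sl\<^sub>2\<close>. For two neighbours everything follows
  from \<open>adjacent_cases\<close>: a move at \<open>j\<close> changes the part at a neighbour \<open>i\<close> by one variable, and since the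
  parts before and after are both of the restricted shape, either a trivial part becomes a single
  variable or a single variable is cancelled. So the Serre relations hold term by term, and the quadratic
  relation compares two paths that differ in one power of \<open>q\<close>. Nodes that are not neighbours do not
  interact.

  Integrability and the \<open>q\<close>-character can be read off the basis. Simplicity of the joint
  spectrum, and the absence of further \<open>l\<close>-weights, come from \<open>uexp_eqI\<close>: as \<open>q\<close> is not a root of
  unity, the sequences \<open>k \<mapsto> q\<^sup>k\<^sup>l\<close> for different \<open>l\<close> are linearly independent, so the eigenvalues
  determine all exponents.

  It remains to see that the crystals are minuscule, for which it suffices to find an explicit shape
  that the extremal monomial has, that all moves preserve, and that forces the parts to be
  restricted. For the first and the last fundamental weight the shape is \<open>Y\<^sub>i\<^sub>,\<^sub>a / Y\<^sub>j\<^sub>,\<^sub>a\<^sub>+\<^sub>1\<close> with \<open>j\<close> next to \<open>i\<close> on a fixed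
  side. For the middle one it is a closed path \<open>g\<close> around the cyclic diagram with steps \<open>\<plusminus>1\<close>: the
  monomial has \<open>Y\<^sub>i\<^sub>,\<^sub>g\<^sub>(\<^sub>i\<^sub>)\<close> at the local minima of \<open>g\<close> and the inverse at the local maxima, and a move
  flips one local extremum.
\<close>

section \<open>Finitely supported functions as a vector space\<close>

definition vscale :: "complex \<Rightarrow> ('b \<Rightarrow>\<^sub>0 complex) \<Rightarrow> ('b \<Rightarrow>\<^sub>0 complex)" where
  "vscale c p = Poly_Mapping.map ((*) c) p"

lemma lookup_vscale [simp]: "Poly_Mapping.lookup (vscale c p) b = c * Poly_Mapping.lookup p b"
  by (simp add: vscale_def map.rep_eq when_def)

interpretation vs: vector_space vscale
  by unfold_locales (auto intro!: poly_mapping_eqI simp: lookup_add algebra_simps)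

lemma vscale_single [simp]: "vscale c (Poly_Mapping.single b d) = Poly_Mapping.single b (c * d)"
  by (intro poly_mapping_eqI) (simp add: lookup_single when_def)

lemma keys_vscale_subset: "Poly_Mapping.keys (vscale c p) \<subseteq> Poly_Mapping.keys p"
  by (auto simp: in_keys_iff)

definition lin_ext :: "('a \<Rightarrow> ('b \<Rightarrow>\<^sub>0 complex)) \<Rightarrow> ('a \<Rightarrow>\<^sub>0 complex) \<Rightarrow> ('b \<Rightarrow>\<^sub>0 complex)" where
  "lin_ext T p = (\<Sum>a\<in>Poly_Mapping.keys p. vscale (Poly_Mapping.lookup p a) (T a))"

lemma lin_ext_eq_sum:
  assumes "finite A" "Poly_Mapping.keys p \<subseteq> A"
  shows "lin_ext T p = (\<Sum>a\<in>A. vscale (Poly_Mapping.lookup p a) (T a))"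
  unfolding lin_ext_def
  by (rule sum.mono_neutral_left[OF assms]) (simp add: not_in_keys_iff_lookup_eq_zero)

lemma lin_ext_zero [simp]: "lin_ext T 0 = 0"
  by (simp add: lin_ext_def)

lemma lin_ext_single [simp]: "lin_ext T (Poly_Mapping.single a c) = vscale c (T a)"
  by (subst lin_ext_eq_sum[of "{a}"]) auto

lemma lin_ext_add: "lin_ext T (p + q) = lin_ext T p + lin_ext T q"
proof -
  let ?A = "Poly_Mapping.keys p \<union> Poly_Mapping.keys q"
  have "lin_ext T (p + q) = (\<Sum>a\<in>?A. vscale (Poly_Mapping.lookup (p + q) a) (T a))"
    by (rule lin_ext_eq_sum) (auto dest: set_mp[OF Poly_Mapping.keys_add])
  also have "\<dots> = lin_ext T p + lin_ext T q"
    by (simp add: lin_ext_eq_sum[of ?A] lookup_add vs.scale_left_distrib sum.distrib)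
  finally show ?thesis .
qed

lemma lin_ext_vscale: "lin_ext T (vscale c p) = vscale c (lin_ext T p)"
  by (subst lin_ext_eq_sum[of "Poly_Mapping.keys p"])
     (simp_all add: keys_vscale_subset lin_ext_def vs.scale_sum_right)

lemma lin_ext_uminus: "lin_ext T (- p) = - lin_ext T p"
  using lin_ext_add[of T p "- p"] by (simp add: add_eq_0_iff)

lemma lin_ext_diff: "lin_ext T (p - q) = lin_ext T p - lin_ext T q"
  using lin_ext_add[of T p "- q"] by (simp add: lin_ext_uminus)

lemma poly_mapping_additive_induct [case_names single add]:
  assumes "\<And>k c. P (Poly_Mapping.single k c)" "\<And>p q. P p \<Longrightarrow> P q \<Longrightarrow> P (p + q)"
  shows "P (p :: 'a \<Rightarrow>\<^sub>0 'b::comm_monoid_add)"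
proof -
  have p: "p = (\<Sum>k\<in>Poly_Mapping.keys p. Poly_Mapping.single k (Poly_Mapping.lookup p k))"
    by (intro poly_mapping_eqI)
       (auto simp: lookup_sum lookup_single when_def in_keys_iff sum.delta)
  have "P (\<Sum>k\<in>F. Poly_Mapping.single k (c k))" if "finite F" for F and c :: "'a \<Rightarrow> 'b"
    using that
  proof (induction F)
    case empty
    then show ?case using assms(1)[of _ 0] by simp
  qed (simp add: assms)
  then show ?thesis using p finite_keys by metis
qed

lemma lin_ext_cong:
  "(\<And>a. a \<in> Poly_Mapping.keys p \<Longrightarrow> T a = S a) \<Longrightarrow> lin_ext T p = lin_ext S p"
  by (simp add: lin_ext_def)

lemma lin_ext_id: "lin_ext (\<lambda>a. Poly_Mapping.single a 1) p = p"
  by (induction p rule: poly_mapping_additive_induct) (simp_all add: lin_ext_add)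

lemma lookup_lin_ext_diagonal:
  "Poly_Mapping.lookup (lin_ext (\<lambda>a. Poly_Mapping.single a (c a)) p) b = c b * Poly_Mapping.lookup p b"
  by (induction p rule: poly_mapping_additive_induct)
     (auto simp: lin_ext_add lookup_add lookup_single when_def algebra_simps)

lemma keys_lin_ext:
  "Poly_Mapping.keys (lin_ext T p) \<subseteq> (\<Union>a\<in>Poly_Mapping.keys p. Poly_Mapping.keys (T a))"
  unfolding lin_ext_def
  by (rule order.trans[OF keys_sum]) (use keys_vscale_subset in fast)

definition supported_on :: "'b set \<Rightarrow> ('b \<Rightarrow>\<^sub>0 complex) set" where
  "supported_on M = {v. Poly_Mapping.keys v \<subseteq> M}"

lemma subspace_supported_on: "vs.subspace (supported_on M)"
  unfolding vs.subspace_def supported_on_def mem_Collect_eq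
proof (intro conjI allI ballI impI)
  fix c :: complex and v w :: "'a \<Rightarrow>\<^sub>0 complex"
  assume v: "v \<in> {v. Poly_Mapping.keys v \<subseteq> M}"
  show "Poly_Mapping.keys (vscale c v) \<subseteq> M"
    using v keys_vscale_subset[of c v] by blast
  assume "w \<in> {v. Poly_Mapping.keys v \<subseteq> M}"
  with v show "Poly_Mapping.keys (v + w) \<subseteq> M"
    using Poly_Mapping.keys_add[of v w] by blast
qed simp

lemma single_in_supported_on: "m \<in> M \<Longrightarrow> Poly_Mapping.single m c \<in> supported_on M"
  by (auto simp: supported_on_def)

lemma lin_ext_in_supported_on:
  "v \<in> supported_on M \<Longrightarrow> (\<And>m. m \<in> M \<Longrightarrow> T m \<in> supported_on M') \<Longrightarrow>
   lin_ext T v \<in> supported_on M'"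
  using keys_lin_ext[of T v] by (fastforce simp: supported_on_def)

lemma span_single_eq_supported_on: 
  "vs.span ((\<lambda>m. Poly_Mapping.single m 1) ` M) = supported_on M"
proof
  show "vs.span ((\<lambda>m. Poly_Mapping.single m 1) ` M) \<subseteq> supported_on M"
    by (rule vs.span_minimal) (auto simp: subspace_supported_on single_in_supported_on)
  show "supported_on M \<subseteq> vs.span ((\<lambda>m. Poly_Mapping.single m 1) ` M)"
  proof
    fix v assume v: "v \<in> supported_on M"
    have "v = (\<Sum>m\<in>Poly_Mapping.keys v.
                vscale (Poly_Mapping.lookup v m) (Poly_Mapping.single m 1))"
      using lin_ext_id[of v] by (simp add: lin_ext_def)
    also have "\<dots> \<in> vs.span ((\<lambda>m. Poly_Mapping.single m 1) ` M)"
      by (intro vs.span_sum vs.span_scale vs.span_base) (use v in \<open>auto simp: supported_on_def\<close>)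
    finally show "v \<in> vs.span ((\<lambda>m. Poly_Mapping.single m 1) ` M)" .
  qed
qed

section \<open>Actions of free algebras\<close>

primrec word_act :: "('g \<Rightarrow> 'b \<Rightarrow> ('b \<Rightarrow>\<^sub>0 complex)) \<Rightarrow> 'g list \<Rightarrow> ('b \<Rightarrow>\<^sub>0 complex) \<Rightarrow> ('b \<Rightarrow>\<^sub>0 complex)"
where
  "word_act G [] v = v"
| "word_act G (g # w) v = lin_ext (G g) (word_act G w v)"

definition free_act ::
  "('g \<Rightarrow> 'b \<Rightarrow> ('b \<Rightarrow>\<^sub>0 complex)) \<Rightarrow> ('g list \<Rightarrow>\<^sub>0 complex) \<Rightarrow> ('b \<Rightarrow>\<^sub>0 complex) \<Rightarrow> ('b \<Rightarrow>\<^sub>0 complex)" where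
  "free_act G p v = lin_ext (\<lambda>w. word_act G w v) p"

lemma word_act_append: "word_act G (w @ w') v = word_act G w (word_act G w' v)"
  by (induction w) simp_all

lemma word_act_add: "word_act G w (u + v) = word_act G w u + word_act G w v"
  by (induction w) (simp_all add: lin_ext_add)

lemma word_act_vscale: "word_act G w (vscale c v) = vscale c (word_act G w v)"
  by (induction w) (simp_all add: lin_ext_vscale)

lemma free_act_zero [simp]: "free_act G 0 v = 0"
  and free_act_add: "free_act G (a + b) v = free_act G a v + free_act G b v"
  and free_act_uminus: "free_act G (- a) v = - free_act G a v"
  and free_act_diff: "free_act G (a - b) v = free_act G a v - free_act G b v"
  by (simp_all add: free_act_def lin_ext_add lin_ext_uminus lin_ext_diff)

lemma free_act_single: "free_act G (Poly_Mapping.single w c) v = vscale c (word_act G w v)"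
  by (simp add: free_act_def)

lemma free_act_one [simp]: "free_act G 1 v = v"
  unfolding single_one[symmetric] by (simp add: free_act_single zero_list_def)

lemma free_act_add_right: "free_act G a (u + v) = free_act G a u + free_act G a v"
  by (induction a rule: poly_mapping_additive_induct)
     (simp_all add: free_act_single free_act_add word_act_add vs.scale_right_distrib)

lemma free_act_vscale: "free_act G a (vscale c v) = vscale c (free_act G a v)"
  by (induction a rule: poly_mapping_additive_induct)
     (simp_all add: free_act_single free_act_add word_act_vscale vs.scale_right_distrib mult.commute)

lemma free_act_zero_right [simp]: "free_act G a 0 = 0"
  using free_act_vscale[of G a 0 0] by simp

lemma free_act_mult: "free_act G (a * b) v = free_act G a (free_act G b v)"
proof (induction a rule: poly_mapping_additive_induct)
  case (single w c)
  show ?case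
  proof (induction b rule: poly_mapping_additive_induct)
    case (single w' c')
    show ?case
      by (simp add: mult_single free_act_single plus_list_def word_act_append word_act_vscale)
  next
    case (add p q)
    then show ?case by (simp add: distrib_left free_act_add free_act_add_right)
  qed
next
  case (add p q)
  then show ?case by (simp add: distrib_right free_act_add)
qed

text \<open>All elements act linearly, so it suffices to test relations on basis vectors.\<close>

lemma free_act_eq_lin_ext: "free_act G a v = lin_ext (\<lambda>m. free_act G a (Poly_Mapping.single m 1)) v"
proof (induction v rule: poly_mapping_additive_induct)
  case (single m c)
  then show ?case
    using free_act_vscale[of G a c "Poly_Mapping.single m 1"] by simp
next
  case (add p q)
  then show ?case by (simp add: free_act_add_right lin_ext_add)
qed

lemma free_act_in_supported_on:
  assumes G: "\<And>g m. g \<in> S \<Longrightarrow> m \<in> M \<Longrightarrow> G g m \<in> supported_on M"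
    and a: "a \<in> carrier (free_algebra S)" and v: "v \<in> supported_on M"
  shows "free_act G a v \<in> supported_on M"
proof -
  have w: "word_act G w v \<in> supported_on M" if "set w \<subseteq> S" for w
    using that by (induction w) (auto intro!: lin_ext_in_supported_on G v)
  have "vs.subspace (supported_on M)"
    by (rule subspace_supported_on)
  then show ?thesis
    unfolding free_act_def lin_ext_def using a w
    by (intro vs.subspace_sum vs.subspace_scale) (auto simp: free_algebra_def)
qed

section \<open>Modules over the quantum toroidal algebra from operators for the generators\<close>

lemma carrier_free_algebra_iff:
  "p \<in> carrier (free_algebra S) \<longleftrightarrow> (\<forall>w\<in>Poly_Mapping.keys p. set w \<subseteq> S)"
  by (simp add: free_algebra_def)

lemma free_algebra_simps [simp]:
  "p \<oplus>\<^bsub>free_algebra S\<^esub> p' = p + p'"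
  "p \<otimes>\<^bsub>free_algebra S\<^esub> p' = p * p'"
  "\<zero>\<^bsub>free_algebra S\<^esub> = 0"
  "\<one>\<^bsub>free_algebra S\<^esub> = 1"
  by (simp_all add: free_algebra_def)

lemma free_algebra_closed:
  shows free_algebra_add_closed:
      "p \<in> carrier (free_algebra S) \<Longrightarrow> p' \<in> carrier (free_algebra S) \<Longrightarrow>
       p + p' \<in> carrier (free_algebra S)"
    and free_algebra_uminus_closed:
      "p \<in> carrier (free_algebra S) \<Longrightarrow> - p \<in> carrier (free_algebra S)"
    and free_algebra_diff_closed:
      "p \<in> carrier (free_algebra S) \<Longrightarrow> p' \<in> carrier (free_algebra S) \<Longrightarrow>
       p - p' \<in> carrier (free_algebra S)"
    and free_algebra_mult_closed:
      "p \<in> carrier (free_algebra S) \<Longrightarrow> p' \<in> carrier (free_algebra S) \<Longrightarrow>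
       p * p' \<in> carrier (free_algebra S)"
    and free_algebra_zero_closed: "0 \<in> carrier (free_algebra S)"
    and free_algebra_one_closed: "1 \<in> carrier (free_algebra S)"
proof -
  show add: "p + p' \<in> carrier (free_algebra S)"
    if "p \<in> carrier (free_algebra S)" "p' \<in> carrier (free_algebra S)" for p p'
    using that Poly_Mapping.keys_add[of p p'] by (auto simp: carrier_free_algebra_iff)
  show um: "- p \<in> carrier (free_algebra S)" if "p \<in> carrier (free_algebra S)" for p
    using that by (auto simp: carrier_free_algebra_iff in_keys_iff)
  show "p - p' \<in> carrier (free_algebra S)"
    if "p \<in> carrier (free_algebra S)" "p' \<in> carrier (free_algebra S)" for p p'
    using add[OF that(1) um[OF that(2)]] by simp
  show "p * p' \<in> carrier (free_algebra S)"
    if p: "p \<in> carrier (free_algebra S)" "p' \<in> carrier (free_algebra S)" for p p'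
    unfolding carrier_free_algebra_iff
  proof
    fix w assume "w \<in> Poly_Mapping.keys (p * p')"
    then obtain u u' where "u \<in> Poly_Mapping.keys p" "u' \<in> Poly_Mapping.keys p'" "w = u + u'"
      using keys_mult[of p p'] by blast
    with p show "set w \<subseteq> S"
      by (simp add: carrier_free_algebra_iff plus_list_def)
  qed
qed (simp_all add: carrier_free_algebra_iff zero_list_def)

lemma ring_free_algebra: "ring (free_algebra S)"
proof (rule ringI)
  show "abelian_group (free_algebra S)"
  proof (rule abelian_groupI)
    show "\<exists>p'\<in>carrier (free_algebra S). p' \<oplus>\<^bsub>free_algebra S\<^esub> p = \<zero>\<^bsub>free_algebra S\<^esub>"
      if "p \<in> carrier (free_algebra S)" for p
      by (rule bexI[of _ "- p"]) (simp_all add: free_algebra_uminus_closed[OF that])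
  qed (simp_all add: add_ac free_algebra_add_closed free_algebra_zero_closed)
  show "Group.monoid (free_algebra S)"
    by (rule monoidI)
       (simp_all add: free_algebra_mult_closed free_algebra_one_closed mult.assoc)
qed (simp_all add: distrib_left distrib_right)

definition annihilator :: "(gen \<Rightarrow> 'b \<Rightarrow> ('b \<Rightarrow>\<^sub>0 complex)) \<Rightarrow> gen set \<Rightarrow> 'b set \<Rightarrow> falg set" where
  "annihilator G S M = {a \<in> carrier (free_algebra S). \<forall>v\<in>supported_on M. free_act G a v = 0}"

lemma annihilatorI:
  assumes "a \<in> carrier (free_algebra S)"
    and "\<And>m. m \<in> M \<Longrightarrow> free_act G a (Poly_Mapping.single m 1) = 0"
  shows "a \<in> annihilator G S M"
proof -
  have "free_act G a v = 0" if "v \<in> supported_on M" for v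
    unfolding free_act_eq_lin_ext[of G a v] lin_ext_def
    by (rule sum.neutral) (use that assms(2) in \<open>auto simp: supported_on_def\<close>)
  with assms(1) show ?thesis
    by (simp add: annihilator_def)
qed

text \<open>The annihilator is a left ideal by construction; it is also a right ideal because the generators,
  and with them all elements, map the space into itself.\<close>

lemma ideal_annihilator:
  assumes "\<And>g m. g \<in> S \<Longrightarrow> m \<in> M \<Longrightarrow> G g m \<in> supported_on M"
  shows "ideal (annihilator G S M) (free_algebra S)"
proof (rule idealI[OF ring_free_algebra])
  interpret ring "free_algebra S" by (rule ring_free_algebra)
  have inv: "\<ominus>\<^bsub>free_algebra S\<^esub> a = - a" if "a \<in> carrier (free_algebra S)" for a
    by (rule minus_equality) (use that free_algebra_uminus_closed[OF that] in simp_all)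
  show "subgroup (annihilator G S M) (add_monoid (free_algebra S))"
  proof (rule add.subgroupI)
    show "annihilator G S M \<subseteq> carrier (free_algebra S)"
      by (auto simp: annihilator_def)
    show "annihilator G S M \<noteq> {}"
      using free_algebra_zero_closed[of S] by (auto simp: annihilator_def)
    show "\<ominus>\<^bsub>free_algebra S\<^esub> a \<in> annihilator G S M" if "a \<in> annihilator G S M" for a
      using that free_algebra_uminus_closed[of a S]
      by (auto simp: annihilator_def inv free_act_uminus)
    show "a \<oplus>\<^bsub>free_algebra S\<^esub> b \<in> annihilator G S M"
      if "a \<in> annihilator G S M" "b \<in> annihilator G S M" for a b
      using that free_algebra_add_closed[of a S b]
      by (auto simp: annihilator_def free_act_add)
  qed
  show "x \<otimes>\<^bsub>free_algebra S\<^esub> a \<in> annihilator G S M"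
    if "a \<in> annihilator G S M" "x \<in> carrier (free_algebra S)" for a x
    using that free_algebra_mult_closed[of x S a]
    by (auto simp: annihilator_def free_act_mult)
  show "a \<otimes>\<^bsub>free_algebra S\<^esub> x \<in> annihilator G S M"
    if "a \<in> annihilator G S M" "x \<in> carrier (free_algebra S)" for a x
    using that free_algebra_mult_closed[of a S x] free_act_in_supported_on[OF assms, of S]
    by (auto simp: annihilator_def free_act_mult)
qed

lemma single_word_closed: "set w \<subseteq> S \<Longrightarrow> Poly_Mapping.single w c \<in> carrier (free_algebra S)"
  by (simp add: carrier_free_algebra_iff)

lemma nxt_le: "nxt n i \<le> n" and prv_le: "prv n i \<le> n"
  using mod_less_divisor[of "n + 1" "i + 1"] mod_less_divisor[of "n + 1" "i + n"]
  by (simp_all add: nxt_def prv_def)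

lemma hvec_in_cartan_space: "i \<le> n \<Longrightarrow> hvec i \<in> cartan_space n"
  by (simp add: cartan_space_def hvec_def)

lemma cartan_space_closed:
  "h \<in> cartan_space n \<Longrightarrow> - h \<in> cartan_space n"
  "h \<in> cartan_space n \<Longrightarrow> h' \<in> cartan_space n \<Longrightarrow> h + h' \<in> cartan_space n"
  "0 \<in> cartan_space n"
  using Poly_Mapping.keys_add[of h h'] by (auto simp: cartan_space_def)

abbreviation "toroidal_free n \<equiv> carrier (free_algebra (gens n))"

lemma generators_closed:
  shows gx_closed: "\<epsilon> \<in> {1, - 1} \<Longrightarrow> i \<le> n \<Longrightarrow> gx \<epsilon> i r \<in> toroidal_free n"
    and gk_closed: "h \<in> cartan_space n \<Longrightarrow> gk h \<in> toroidal_free n"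
    and gh_closed: "i \<le> n \<Longrightarrow> k \<noteq> 0 \<Longrightarrow> gh i k \<in> toroidal_free n"
    and cst_closed: "cst c \<in> toroidal_free n"
  unfolding gx_def gk_def gh_def cst_def
  by (rule single_word_closed; auto simp: gens_def zero_list_def)+

lemmas toroidal_free_closed = free_algebra_closed[where S = "gens n" for n] generators_closed

lemma sum_closed:
  "(\<And>i. i \<in> F \<Longrightarrow> p i \<in> carrier (free_algebra S)) \<Longrightarrow> (\<Sum>i\<in>F. p i) \<in> carrier (free_algebra S)"
  by (induction F rule: infinite_finite_induct)
     (auto intro: free_algebra_closed)

lemma phi_elt_closed:
  assumes "\<epsilon> \<in> {1, - 1}" "i \<le> n"
  shows "phi_elt t \<epsilon> i m \<in> toroidal_free n"
proof -
  define F :: "falg fps" where "F = Abs_fps (\<lambda>m'. if m' = 0 then 0 else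
         cst (of_int \<epsilon> * (qpow t 1 - qpow t (- 1))) * gh i (\<epsilon> * int m'))"
  have F: "fps_nth F k \<in> toroidal_free n" for k
    unfolding F_def using assms
    by (auto intro!: toroidal_free_closed)
  have P: "fps_nth (F ^ j) k \<in> toroidal_free n" for j k
  proof (induction j arbitrary: k)
    case (Suc j)
    then show ?case
      by (auto simp: fps_mult_nth intro!: sum_closed free_algebra_mult_closed F
         )
  qed (auto intro: toroidal_free_closed)
  show ?thesis
    unfolding phi_elt_def exp_series_def F_def[symmetric] using assms
    by (auto simp: fps_compose_nth intro!: sum_closed toroidal_free_closed P cartan_space_closed
        hvec_in_cartan_space)
qed

text \<open>The ideal generated by a set is only under control when the set lies in the ring, so each relation has to be
  recognised as a combination of admissible generators.\<close>

lemma toroidal_relations_closed: "toroidal_relations n t \<subseteq> toroidal_free n"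
proof -
  note cl = toroidal_free_closed phi_elt_closed cartan_space_closed nxt_le prv_le
  have "relations_k n \<subseteq> toroidal_free n" "relations_kh n \<subseteq> toroidal_free n"
    "relations_kx n t \<subseteq> toroidal_free n" "relations_hx n t \<subseteq> toroidal_free n"
    "relations_xx n t \<subseteq> toroidal_free n" "relations_commute n \<subseteq> toroidal_free n"
    unfolding relations_k_def relations_kh_def relations_kx_def relations_hx_def
      relations_xx_def relations_commute_def commutator_def
    by (auto intro!: cl)
  moreover have "relations_xx_opposite n t \<subseteq> toroidal_free n"
    unfolding relations_xx_opposite_def commutator_def
    by (auto intro!: cl)
  moreover have "relations_serre n t \<subseteq> toroidal_free n"
    unfolding relations_serre_def serre_elt_def
    by (auto intro!: cl)
  ultimately show ?thesis
    by (simp add: toroidal_relations_def)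
qed

text \<open>A coset acts through an arbitrary representative; on a space that the ideal annihilates the choice
  does not matter.\<close>

definition quot_act ::
  "(gen \<Rightarrow> 'b \<Rightarrow> ('b \<Rightarrow>\<^sub>0 complex)) \<Rightarrow> falg set \<Rightarrow> ('b \<Rightarrow>\<^sub>0 complex) \<Rightarrow> ('b \<Rightarrow>\<^sub>0 complex)" where
  "quot_act G A v = free_act G (SOME a. a \<in> A) v"

text \<open>The universal property of the presentation: operators for the generators that satisfy the relations
  on a basis make the space a module.\<close>

locale generator_action =
  fixes n :: nat and t :: complex and M :: "'b set" and G :: "gen \<Rightarrow> 'b \<Rightarrow> ('b \<Rightarrow>\<^sub>0 complex)"
  assumes preserves: "g \<in> gens n \<Longrightarrow> m \<in> M \<Longrightarrow> G g m \<in> supported_on M"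
    and relations: "a \<in> toroidal_relations n t \<Longrightarrow> m \<in> M \<Longrightarrow>
          free_act G a (Poly_Mapping.single m 1) = 0"
begin

lemma ideal_toroidal: "ideal (toroidal_ideal n t) (free_algebra (gens n))"
  unfolding toroidal_ideal_def
  by (rule ring.genideal_ideal[OF ring_free_algebra toroidal_relations_closed])

lemma toroidal_ideal_annihilates: "toroidal_ideal n t \<subseteq> annihilator G (gens n) M"
  unfolding toroidal_ideal_def
proof (rule ring.genideal_minimal[OF ring_free_algebra ideal_annihilator])
  show "toroidal_relations n t \<subseteq> annihilator G (gens n) M"
    using toroidal_relations_closed[of n t] relations by (blast intro: annihilatorI)
qed (rule preserves)

lemma quot_act_cls:
  assumes a: "a \<in> toroidal_free n" and v: "v \<in> supported_on M"
  shows "quot_act G (cls n t a) v = free_act G a v"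
proof -
  interpret ideal "toroidal_ideal n t" "free_algebra (gens n)"
    by (rule ideal_toroidal)
  have "a \<in> cls n t a"
    unfolding cls_def by (rule a_rcos_self[OF a])
  then have "(SOME b. b \<in> cls n t a) \<in> cls n t a"
    by (rule someI)
  then obtain b where "b \<in> toroidal_ideal n t" "(SOME b. b \<in> cls n t a) = b + a"
    by (auto simp: cls_def a_r_coset_def')
  moreover from this have "free_act G b v = 0"
    using toroidal_ideal_annihilates v by (auto simp: annihilator_def)
  ultimately show ?thesis
    by (simp add: quot_act_def free_act_add)
qed

lemma toroidal_carrier_cases:
  assumes "A \<in> carrier (toroidal_algebra n t)"
  obtains a where "a \<in> toroidal_free n" "A = cls n t a"
  using assms unfolding toroidal_algebra_def cls_def FactRing_def A_RCOSETS_def' by auto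

lemma toroidal_algebra_cls:
  shows cls_in_carrier: "a \<in> toroidal_free n \<Longrightarrow> cls n t a \<in> carrier (toroidal_algebra n t)"
    and cls_add: "a \<in> toroidal_free n \<Longrightarrow> b \<in> toroidal_free n \<Longrightarrow>
      cls n t a \<oplus>\<^bsub>toroidal_algebra n t\<^esub> cls n t b = cls n t (a + b)"
    and cls_mult: "a \<in> toroidal_free n \<Longrightarrow> b \<in> toroidal_free n \<Longrightarrow>
      cls n t a \<otimes>\<^bsub>toroidal_algebra n t\<^esub> cls n t b = cls n t (a * b)"
    and cls_one: "\<one>\<^bsub>toroidal_algebra n t\<^esub> = cls n t 1"
    and cls_uminus: "a \<in> toroidal_free n \<Longrightarrow> \<ominus>\<^bsub>toroidal_algebra n t\<^esub> cls n t a = cls n t (- a)"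
proof -
  interpret ideal "toroidal_ideal n t" "free_algebra (gens n)"
    by (rule ideal_toroidal)
  interpret h: ring_hom_ring "free_algebra (gens n)" "toroidal_algebra n t" "cls n t"
    using rcos_ring_hom_ring by (simp add: toroidal_algebra_def cls_def[abs_def])
  show "cls n t a \<in> carrier (toroidal_algebra n t)" if "a \<in> toroidal_free n" for a
    using that by (rule h.hom_closed)
  show "cls n t a \<oplus>\<^bsub>toroidal_algebra n t\<^esub> cls n t b = cls n t (a + b)"
    if "a \<in> toroidal_free n" "b \<in> toroidal_free n" for a b
    using h.hom_add[OF that] by simp
  show "cls n t a \<otimes>\<^bsub>toroidal_algebra n t\<^esub> cls n t b = cls n t (a * b)"
    if "a \<in> toroidal_free n" "b \<in> toroidal_free n" for a b
    using h.hom_mult[OF that] by simp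
  show "\<one>\<^bsub>toroidal_algebra n t\<^esub> = cls n t 1"
    using h.hom_one by simp
  show "\<ominus>\<^bsub>toroidal_algebra n t\<^esub> cls n t a = cls n t (- a)" if a: "a \<in> toroidal_free n" for a
  proof -
    have "\<ominus>\<^bsub>free_algebra (gens n)\<^esub> a = - a"
      by (rule minus_equality) (use a free_algebra_uminus_closed[OF a] in simp_all)
    then show ?thesis
      using h.hom_a_inv[OF a] by simp
  qed
qed

sublocale toroidal_module vscale n t "supported_on M" "quot_act G"
proof
  show "vs.subspace (supported_on M)"
    by (rule subspace_supported_on)
  fix A B :: "falg set" and u v :: "'b \<Rightarrow>\<^sub>0 complex" and c :: complex
  assume u: "u \<in> supported_on M"
  show "quot_act G \<one>\<^bsub>toroidal_algebra n t\<^esub> u = u"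
    by (simp add: cls_one quot_act_cls free_algebra_one_closed u)
  show "quot_act G (cls n t (cst c)) u = vscale c u"
    using u by (simp add: quot_act_cls cst_closed) (simp add: cst_def free_act_single zero_list_def)
  assume A: "A \<in> carrier (toroidal_algebra n t)"
  then obtain a where a: "a \<in> toroidal_free n" "A = cls n t a"
    by (rule toroidal_carrier_cases)
  have au: "free_act G b w \<in> supported_on M" if "b \<in> toroidal_free n" "w \<in> supported_on M" for b w
    using free_act_in_supported_on[OF preserves that] .
  show "quot_act G A u \<in> supported_on M"
    using a u by (simp add: quot_act_cls au)
  show "quot_act G A (u + v) = quot_act G A u + quot_act G A v" if v: "v \<in> supported_on M"
    using a u v vs.subspace_add[OF subspace_supported_on u v]
    by (simp add: quot_act_cls free_act_add_right)
  assume "B \<in> carrier (toroidal_algebra n t)"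
  then obtain b where b: "b \<in> toroidal_free n" "B = cls n t b"
    by (rule toroidal_carrier_cases)
  show "quot_act G (A \<oplus>\<^bsub>toroidal_algebra n t\<^esub> B) u = quot_act G A u + quot_act G B u"
    using a b u by (simp add: cls_add quot_act_cls free_algebra_add_closed free_act_add)
  show "quot_act G (A \<otimes>\<^bsub>toroidal_algebra n t\<^esub> B) u = quot_act G A (quot_act G B u)"
    using a b u by (simp add: cls_mult quot_act_cls free_algebra_mult_closed free_act_mult au)
qed

end

section \<open>Powers of \<open>q\<close>\<close>

definition qz :: "complex \<Rightarrow> int \<Rightarrow> complex" where
  "qz t k = qpow t (of_int k)"

lemma qpow_add: "qpow t (x + y) = qpow t x * qpow t y"
  by (simp add: qpow_def of_rat_add distrib_left exp_add)

lemma qpow_0 [simp]: "qpow t 0 = 1"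
  by (simp add: qpow_def)

lemma qpow_nonzero [simp]: "qpow t x \<noteq> 0"
  by (simp add: qpow_def)

lemma qpow_minus: "qpow t (- x) = inverse (qpow t x)"
  by (simp add: qpow_def of_rat_minus exp_minus)

lemma qz_0 [simp]: "qz t 0 = 1"
  and qz_nonzero [simp]: "qz t k \<noteq> 0"
  and qz_add: "qz t (j + k) = qz t j * qz t k"
  and qz_minus: "qz t (- k) = inverse (qz t k)"
  by (simp_all add: qz_def qpow_add qpow_minus)

lemma qz_power: "qz t k ^ j = qz t (k * int j)"
  by (induction j) (simp_all add: qz_add[symmetric] algebra_simps)

lemma qz_powi: "qz t k powi j = qz t (k * j)"
  by (simp add: power_int_def qz_power qz_minus[symmetric])

lemma qpow_of_int:
  "qpow t (of_int k) = qz t k" "qpow t (- of_int k) = qz t (- k)"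
  "qpow t 1 = qz t 1" "qpow t (- 1) = qz t (- 1)"
  by (simp_all add: qz_def)

lemma qint_qz: "qint t k = (qz t k - qz t (- k)) / (qz t 1 - qz t (- 1))"
  by (simp add: qint_def qpow_of_int)

locale generic_q =
  fixes t :: complex
  assumes not_root_of_unity: "\<forall>k::nat. k > 0 \<longrightarrow> exp t ^ k \<noteq> 1"
begin

lemma qz_eq_1_iff [simp]: "qz t k = 1 \<longleftrightarrow> k = 0"
proof
  assume k: "qz t k = 1"
  have "exp t ^ nat \<bar>k\<bar> = qz t \<bar>k\<bar>"
    using of_rat_of_int_eq[of "\<bar>k\<bar>", where 'a = complex]
    by (simp add: qz_def qpow_def exp_of_nat_mult[symmetric] mult.commute del: of_rat_of_int_eq of_int_abs)
  also have "\<dots> = 1"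
    using k by (simp add: abs_if qz_minus)
  finally show "k = 0"
    using not_root_of_unity by (metis zero_less_abs_iff zero_less_nat_eq)
qed simp

text \<open>Rational exponents are reduced to integral ones: if \<open>x - y = a / b\<close>, then equality of the two
  powers implies \<open>q\<^sup>a = 1\<close>.\<close>

lemma qpow_eq_iff [simp]: "qpow t x = qpow t y \<longleftrightarrow> x = y"
proof
  assume xy: "qpow t x = qpow t y"
  obtain a b where ab: "quotient_of (x - y) = (a, b)"
    by fastforce
  have b: "b > 0" and d: "x - y = of_int a / of_int b"
    using quotient_of_denom_pos[OF ab] quotient_of_div[OF ab] by simp_all
  have "qpow t (x - y) = 1"
    using xy qpow_add[of t x "- y"] by (simp add: qpow_minus)
  then have "qpow t (x - y) ^ nat b = 1"
    by simp
  moreover have "qpow t (x - y) ^ nat b = qz t a"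
  proof -
    have "of_nat (nat b) * (t * of_rat (x - y)) = t * of_rat (of_int a)"
      using b by (simp add: d of_rat_divide)
    from this[unfolded of_rat_of_int_eq] show ?thesis
      unfolding qz_def qpow_def exp_of_nat_mult[symmetric] of_rat_of_int_eq
      by (simp only:)
  qed
  ultimately have "a = 0" by simp
  with d show "x = y" by simp
qed simp

lemma qz_eq_iff [simp]: "qz t j = qz t k \<longleftrightarrow> j = k"
  by (simp add: qz_def)

lemma q_minus_inverse_nonzero: "qz t 1 - qz t (- 1) \<noteq> 0"
  by simp

end

section \<open>Monomials and weights\<close>

lemma uexp_add: "uexp (m + m') i l = uexp m i l + uexp m' i l"
  and uexp_diff: "uexp (m - m') i l = uexp m i l - uexp m' i l"
  and uexp_uminus: "uexp (- m) i l = - uexp m i l"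
  by (simp_all add: uexp_def lookup_add lookup_minus)

lemma finite_usupp [simp]: "finite (usupp m i)"
proof (rule finite_subset)
  show "usupp m i \<subseteq> snd ` Poly_Mapping.keys (snd m)"
    by (force simp: usupp_def uexp_def in_keys_iff)
qed simp

lemma usupp_iff: "l \<in> usupp m i \<longleftrightarrow> uexp m i l \<noteq> 0"
  by (simp add: usupp_def)

text \<open>The additive specialisation of the variables at the node \<open>i\<close>. For \<open>f = 1\<close> it gives the value of
  the weight on the coroot, and for \<open>f l = q\<^sup>k\<^sup>l\<close> the eigenvalue of the generator with indices \<open>i, k\<close> up to
  the factor \<open>[k]/k\<close>.\<close>

definition uexp_sum :: "(int \<Rightarrow> 'a::comm_ring_1) \<Rightarrow> monom \<Rightarrow> nat \<Rightarrow> 'a" where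
  "uexp_sum f m i = (\<Sum>l\<in>usupp m i. of_int (uexp m i l) * f l)"

lemma uexp_sum_eq_sum:
  assumes "finite A" "\<And>l. l \<notin> A \<Longrightarrow> uexp m i l = 0"
  shows "uexp_sum f m i = (\<Sum>l\<in>A. of_int (uexp m i l) * f l)"
  unfolding uexp_sum_def
  by (rule sum.mono_neutral_left) (use assms in \<open>auto simp: usupp_def\<close>)

lemma uexp_sum_add: "uexp_sum f (m + m') i = uexp_sum f m i + uexp_sum f m' i"
proof -
  let ?A = "usupp m i \<union> usupp m' i"
  have "uexp_sum f x i = (\<Sum>l\<in>?A. of_int (uexp x i l) * f l)" if "x \<in> {m, m', m + m'}" for x
    by (rule uexp_sum_eq_sum) (use that in \<open>auto simp: uexp_add usupp_iff\<close>)
  then show ?thesis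
    by (simp add: uexp_add distrib_right sum.distrib)
qed

lemma uexp_sum_uminus: "uexp_sum f (- m) i = - uexp_sum f m i"
  by (simp add: uexp_sum_def usupp_def uexp_uminus sum_negf)

lemma uexp_sum_diff: "uexp_sum f (m - m') i = uexp_sum f m i - uexp_sum f m' i"
  using uexp_sum_add[of f m "- m'" i] by (simp add: uexp_sum_uminus)

lemma wgt_simps:
  "wgt (m + m') = wgt m + wgt m'" "wgt (m - m') = wgt m - wgt m'" "wgt (- m) = - wgt m"
  by (simp_all add: wgt_def)

lemma monomials_eqI:
  assumes "m \<in> monomials n" "m' \<in> monomials n" "wgt m = wgt m'"
    and u: "\<And>i l. i \<le> n \<Longrightarrow> uexp m i l = uexp m' i l"
  shows "m = m'"
proof -
  have "Poly_Mapping.lookup (snd m) x = Poly_Mapping.lookup (snd m') x" for x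
  proof (cases "fst x \<le> n")
    case True
    then show ?thesis
      using u[of "fst x" "snd x"] by (simp add: uexp_def)
  next
    case False
    then have "x \<notin> Poly_Mapping.keys (snd m)" "x \<notin> Poly_Mapping.keys (snd m')"
      using assms(1,2) by (auto simp: monomials_def)
    then show ?thesis
      by (simp add: in_keys_iff)
  qed
  then show ?thesis
    using assms(3) by (intro prod_eqI poly_mapping_eqI) (simp_all add: wgt_def)
qed

lemma pairing_eq_sum:
  assumes "finite B" "Poly_Mapping.keys h \<subseteq> B"
  shows "pairing \<nu> h = (\<Sum>b\<in>B. Poly_Mapping.lookup \<nu> b * Poly_Mapping.lookup h b)"
  unfolding pairing_def
  by (rule sum.mono_neutral_left[OF assms]) (simp add: in_keys_iff)

lemma pairing_add_left: "pairing (\<nu> + \<mu>) h = pairing \<nu> h + pairing \<mu> h"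
  and pairing_uminus_left: "pairing (- \<nu>) h = - pairing \<nu> h"
  by (simp_all add: pairing_def lookup_add distrib_right sum.distrib sum_negf)

lemma pairing_diff_left: "pairing (\<nu> - \<mu>) h = pairing \<nu> h - pairing \<mu> h"
  using pairing_add_left[of \<nu> "- \<mu>" h] by (simp add: pairing_uminus_left)

lemma pairing_add_right: "pairing \<nu> (h + h') = pairing \<nu> h + pairing \<nu> h'"
proof -
  let ?B = "Poly_Mapping.keys h \<union> Poly_Mapping.keys h'"
  have "pairing \<nu> x = (\<Sum>b\<in>?B. Poly_Mapping.lookup \<nu> b * Poly_Mapping.lookup x b)"
    if "x \<in> {h, h', h + h'}" for x
    by (rule pairing_eq_sum) (use that Poly_Mapping.keys_add[of h h'] in auto)
  then show ?thesis
    by (simp add: lookup_add distrib_left sum.distrib)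
qed

lemma pairing_zero_right [simp]: "pairing \<nu> 0 = 0"
  by (simp add: pairing_def)

lemma pairing_uminus_right: "pairing \<nu> (- h) = - pairing \<nu> h"
  using pairing_add_right[of \<nu> h "- h"] by simp

lemma pairing_single: "pairing \<nu> (Poly_Mapping.single b 1) = Poly_Mapping.lookup \<nu> b"
  by (subst pairing_eq_sum[of "{b}"]) auto

lemma weight_lattice_eqI:
  assumes "\<nu> \<in> weight_lattice n" "\<mu> \<in> weight_lattice n"
    and p: "\<And>h. h \<in> cartan_space n \<Longrightarrow> pairing \<nu> h = pairing \<mu> h"
  shows "\<nu> = \<mu>"
proof (rule poly_mapping_eqI)
  fix b
  show "Poly_Mapping.lookup \<nu> b = Poly_Mapping.lookup \<mu> b"
  proof (cases "b \<in> HB ` {0..n} \<union> {DB}")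
    case True
    then have "Poly_Mapping.single b 1 \<in> cartan_space n"
      by (simp add: cartan_space_def)
    from p[OF this] show ?thesis
      by (simp add: pairing_single)
  next
    case False
    then have "b \<notin> Poly_Mapping.keys \<nu>" "b \<notin> Poly_Mapping.keys \<mu>"
      using assms(1,2) by (auto simp: weight_lattice_def)
    then show ?thesis
      by (simp add: in_keys_iff)
  qed
qed

lemma monomials_uexp_sum_one:
  "m \<in> monomials n \<Longrightarrow> i \<le> n \<Longrightarrow> of_int (uexp_sum (\<lambda>_. 1) m i) = pairing (wgt m) (hvec i)"
  by (simp add: monomials_def uexp_sum_def)

section \<open>Neighbours in the Dynkin diagram\<close>

lemma nxt_eq: "i \<le> n \<Longrightarrow> nxt n i = (if i = n then 0 else i + 1)"
  and prv_eq: "i \<le> n \<Longrightarrow> prv n i = (if i = 0 then n else i - 1)"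
  by (auto simp: nxt_def prv_def mod_if)

lemma nxt_prv [simp]: "i \<le> n \<Longrightarrow> nxt n (prv n i) = i"
  and prv_nxt [simp]: "i \<le> n \<Longrightarrow> prv n (nxt n i) = i"
  by (auto simp: nxt_eq prv_eq nxt_le prv_le)

lemma neighbours_distinct:
  "n \<ge> 2 \<Longrightarrow> i \<le> n \<Longrightarrow> nxt n i \<noteq> i \<and> prv n i \<noteq> i \<and> nxt n i \<noteq> prv n i"
  by (cases i) (auto simp: nxt_eq prv_eq)

definition adjacent :: "nat \<Rightarrow> nat \<Rightarrow> nat \<Rightarrow> bool" where
  "adjacent n i j \<longleftrightarrow> j = nxt n i \<or> j = prv n i"

lemma adjacent_sym: "i \<le> n \<Longrightarrow> adjacent n i j \<Longrightarrow> adjacent n j i"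
  by (auto simp: adjacent_def)

lemma adjacent_le: "adjacent n i j \<Longrightarrow> j \<le> n"
  by (auto simp: adjacent_def nxt_le prv_le)

lemma not_adjacent_refl: "n \<ge> 1 \<Longrightarrow> i \<le> n \<Longrightarrow> \<not> adjacent n i i"
  by (auto simp: adjacent_def nxt_eq prv_eq)

lemma cartan_mat_eq:
  "cartan_mat n i j = (if i = j then 2 else if adjacent n i j then - 1 else 0)"
  by (simp add: cartan_mat_def adjacent_def)

context
  fixes n :: nat
  assumes n: "n \<ge> 2"
begin

lemma uexp_Amon_same: "i \<le> n \<Longrightarrow> uexp (Amon n i a) i l = (if l = a - 1 \<or> l = a + 1 then 1 else 0)"
  using n
  by (simp add: uexp_def Amon_def Yvar_def lookup_add lookup_minus lookup_single when_def
      nxt_eq prv_eq)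

lemma uexp_Amon_adjacent:
  "i \<le> n \<Longrightarrow> j \<le> n \<Longrightarrow> adjacent n i j \<Longrightarrow> uexp (Amon n j a) i l = (if l = a then - 1 else 0)"
  using neighbours_distinct[OF n, of j]
  by (auto simp: uexp_def Amon_def Yvar_def lookup_add lookup_minus lookup_single when_def
      adjacent_def)

lemma uexp_Amon_far:
  "i \<le> n \<Longrightarrow> j \<le> n \<Longrightarrow> i \<noteq> j \<Longrightarrow> \<not> adjacent n i j \<Longrightarrow> uexp (Amon n j a) i l = 0"
  unfolding adjacent_def
  by (simp add: uexp_def Amon_def Yvar_def lookup_add lookup_minus lookup_single when_def)
     (metis nxt_prv prv_nxt)

lemma uexp_sum_Amon:
  assumes "i \<le> n" "j \<le> n"
  shows "uexp_sum f (Amon n j a) i =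
    (if i = j then f (a - 1) + f (a + 1) else if adjacent n i j then - f a else 0)"
proof -
  have "uexp (Amon n j a) i l = 0" if "l \<notin> {a - 1, a, a + 1}" for l
    using that assms
    by (cases "i = j"; cases "adjacent n i j")
       (simp_all add: uexp_Amon_same uexp_Amon_adjacent uexp_Amon_far)
  then have "uexp_sum f (Amon n j a) i =
      (\<Sum>l\<in>{a - 1, a, a + 1}. of_int (uexp (Amon n j a) i l) * f l)"
    by (intro uexp_sum_eq_sum) simp_all
  then show ?thesis
    using assms n not_adjacent_refl[of n i]
    by (cases "i = j"; cases "adjacent n i j")
       (simp_all add: uexp_Amon_same uexp_Amon_adjacent uexp_Amon_far)
qed

lemma pairing_alpha: 
  assumes "i \<le> n"
  shows "pairing (alpha n j) (hvec i) = of_int (cartan_mat n i j)"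
  unfolding hvec_def pairing_single alpha_def
  using assms by (simp add: lookup_add lookup_sum lookup_single when_def)

end

lemma wgt_Amon [simp]: "wgt (Amon n i a) = alpha n i"
  by (simp add: wgt_def Amon_def)

lemma alpha_in_weight_lattice: 
  assumes "n \<ge> 2"
  shows "alpha n j \<in> weight_lattice n"
proof -
  have "Poly_Mapping.keys (alpha n j) \<subseteq> HB ` {0..n} \<union> {DB}"
  proof
    fix b assume "b \<in> Poly_Mapping.keys (alpha n j)"
    then have "Poly_Mapping.lookup (alpha n j) b \<noteq> 0"
      by (simp add: in_keys_iff)
    then show "b \<in> HB ` {0..n} \<union> {DB}"
      by (cases b) (auto simp: alpha_def lookup_add lookup_sum lookup_single when_def
          split: if_splits)
  qed
  then show ?thesis
    by (simp add: weight_lattice_def pairing_alpha[OF assms])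
qed

lemma Amon_in_monomials:
  assumes "n \<ge> 2" "j \<le> n"
  shows "Amon n j a \<in> monomials n"
proof -
  have "Poly_Mapping.keys (snd (Amon n j a)) \<subseteq> {0..n} \<times> UNIV"
    using assms(2) by (auto simp: Amon_def Yvar_def in_keys_iff lookup_add lookup_minus lookup_single
        when_def nxt_le prv_le split: if_splits)
  moreover have "(\<Sum>l\<in>usupp (Amon n j a) i. uexp (Amon n j a) i l) = cartan_mat n i j" if "i \<le> n" for i
    using uexp_sum_Amon[OF assms(1) that assms(2), of "\<lambda>_. 1 :: int" a]
    by (simp add: uexp_sum_def cartan_mat_eq)
  ultimately show ?thesis
    using alpha_in_weight_lattice[OF assms(1), of j]
    by (simp add: monomials_def pairing_alpha[OF assms(1)] del: of_int_sum)
qed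

lemma weight_lattice_add: "\<nu> \<in> weight_lattice n \<Longrightarrow> \<mu> \<in> weight_lattice n \<Longrightarrow> \<nu> + \<mu> \<in> weight_lattice n"
  and weight_lattice_uminus: "\<nu> \<in> weight_lattice n \<Longrightarrow> - \<nu> \<in> weight_lattice n"
  using Poly_Mapping.keys_add[of \<nu> \<mu>]
  by (auto simp: weight_lattice_def pairing_add_left pairing_uminus_left in_keys_iff)

lemma monomials_add:
  assumes "m \<in> monomials n" "m' \<in> monomials n"
  shows "m + m' \<in> monomials n"
proof -
  have "of_int (uexp_sum (\<lambda>_. 1) (m + m') i) = pairing (wgt (m + m')) (hvec i)" if "i \<le> n" for i
    using assms that
    by (simp add: uexp_sum_add wgt_simps pairing_add_left monomials_uexp_sum_one)
  then show ?thesis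
    using assms Poly_Mapping.keys_add[of "snd m" "snd m'"]
    by (auto simp: monomials_def wgt_simps weight_lattice_add uexp_sum_def)
qed

lemma monomials_uminus:
  assumes "m \<in> monomials n"
  shows "- m \<in> monomials n"
proof -
  have "of_int (uexp_sum (\<lambda>_. 1) (- m) i) = pairing (wgt (- m)) (hvec i)" if "i \<le> n" for i
    using assms that
    by (simp add: uexp_sum_uminus wgt_simps pairing_uminus_left monomials_uexp_sum_one)
  then show ?thesis
    using assms
    by (auto simp: monomials_def wgt_simps weight_lattice_uminus uexp_sum_def in_keys_iff)
qed

text \<open>Multiplication by \<open>A\<^sub>j\<^sub>,\<^sub>a\<close> changes the eigenvalue of the diagonal generator with indices \<open>i, k\<close> by
  \<open>[k C\<^sub>i\<^sub>j] q\<^sup>k\<^sup>a / k\<close>. This is the whole content of the relation between the diagonal and the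
  raising or lowering generators.\<close>

lemma qint_uexp_sum_Amon:
  assumes "n \<ge> 2" "i \<le> n" "j \<le> n"
  shows "qint t k * uexp_sum (\<lambda>l. qz t (k * l)) (Amon n j a) i
    = qint t (k * cartan_mat n i j) * qz t (k * a)"
  using assms
  by (simp add: uexp_sum_Amon cartan_mat_eq qint_qz not_adjacent_refl field_simps)
     (simp add: qz_add[symmetric] algebra_simps)

section \<open>Logarithmic derivatives of \<open>l\<close>-weights\<close>

text \<open>This is \<open>F'/F = D\<close> for an invertible series \<open>F\<close>. The eigenvalue of a current arises as an exponential
  on one side and as a product of fractions on the other; both are determined by their constant terms and
  their logarithmic derivatives, which are easy to compute.\<close>

definition log_deriv :: "complex fps \<Rightarrow> complex fps \<Rightarrow> bool" where
  "log_deriv F D \<longleftrightarrow> fps_nth F 0 \<noteq> 0 \<and> fps_deriv F = F * D"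

lemma log_deriv_1: "log_deriv 1 0"
  by (simp add: log_deriv_def)

lemma log_deriv_const: "c \<noteq> 0 \<Longrightarrow> log_deriv (fps_const c) 0"
  by (simp add: log_deriv_def)

lemma log_deriv_mult: "log_deriv F D \<Longrightarrow> log_deriv H E \<Longrightarrow> log_deriv (F * H) (D + E)"
  by (simp add: log_deriv_def algebra_simps)

lemma log_deriv_inverse:
  assumes "log_deriv F D"
  shows "log_deriv (inverse F) (- D)"
proof -
  have F: "fps_nth F 0 \<noteq> 0" and D: "fps_deriv F = F * D"
    using assms by (simp_all add: log_deriv_def)
  have "fps_deriv (inverse F) = - (inverse F * F) * inverse F * D"
    using fps_inverse_deriv[OF F] by (simp add: D power2_eq_square algebra_simps)
  then show ?thesis
    using F by (simp add: log_deriv_def inverse_mult_eq_1[OF F])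
qed

lemma log_deriv_power: "log_deriv F D \<Longrightarrow> log_deriv (F ^ k) (of_nat k * D)"
proof (induction k)
  case 0
  then show ?case using log_deriv_1 by simp
next
  case (Suc k)
  then show ?case
    using log_deriv_mult[of F D "F ^ k" "of_nat k * D"] by (simp add: algebra_simps)
qed

lemma log_deriv_powi: "log_deriv F D \<Longrightarrow> log_deriv (F powi k) (of_int k * D)"
  using log_deriv_power[of F D "nat k"] log_deriv_power[OF log_deriv_inverse, of F D "nat (- k)"]
  by (cases "k \<ge> 0") (simp_all add: power_int_def)

lemma log_deriv_prod:
  "(\<And>l. l \<in> A \<Longrightarrow> log_deriv (F l) (D l)) \<Longrightarrow> log_deriv (\<Prod>l\<in>A. F l) (\<Sum>l\<in>A. D l)"
  by (induction A rule: infinite_finite_induct) (simp_all add: log_deriv_1 log_deriv_mult)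

lemma log_deriv_unique:
  assumes "log_deriv F D" "log_deriv H D" "fps_nth F 0 = fps_nth H 0"
  shows "F = H"
proof -
  have H: "fps_nth H 0 \<noteq> 0"
    using assms(2) by (simp add: log_deriv_def)
  have "log_deriv (F * inverse H) 0"
    using log_deriv_mult[OF assms(1) log_deriv_inverse[OF assms(2)]] by simp
  then have "fps_deriv (F * inverse H) = 0"
    unfolding log_deriv_def by simp
  then have "F * inverse H = fps_const (fps_nth (F * inverse H) 0)"
    by (simp only: fps_deriv_eq_0_iff)
  also have "\<dots> = 1"
    using assms(3) H by simp
  finally have "F * (inverse H * H) = H"
    by (metis mult.assoc mult_1)
  then show ?thesis
    using inverse_mult_eq_1[OF H] by simp
qed

lemma log_deriv_eq: "log_deriv F D \<Longrightarrow> log_deriv F E \<Longrightarrow> D = E"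
  by (auto simp: log_deriv_def)

lemma log_deriv_exp:
  assumes "fps_nth G 0 = 0"
  shows "log_deriv (fps_exp 1 oo G) (fps_deriv G)"
  using assms by (simp add: log_deriv_def fps_compose_deriv)

lemma log_deriv_one_minus:
  "log_deriv (1 - fps_const c * fps_X) (Abs_fps (\<lambda>k. - (c ^ (k + 1))))"
proof -
  have "fps_deriv (1 - fps_const c * fps_X)
      = (1 - fps_const c * fps_X) * Abs_fps (\<lambda>k. - (c ^ (k + 1)))"
  proof (rule fps_ext)
    fix k
    show "fps_nth (fps_deriv (1 - fps_const c * fps_X)) k
        = fps_nth ((1 - fps_const c * fps_X) * Abs_fps (\<lambda>k. - (c ^ (k + 1)))) k"
      by (cases k) (simp_all add: left_diff_distrib mult.assoc)
  qed
  then show ?thesis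
    by (simp add: log_deriv_def)
qed

text \<open>A common form for the expansions at \<open>z = 0\<close> and at \<open>z = \<infinity>\<close>: the sign only rescales the
  exponents of \<open>q\<close>, so that the two need not be distinguished any more.\<close>

lemma Y_series_eq:
  assumes "\<epsilon> \<in> {1, - 1}"
  shows "Y_series t \<epsilon> l = fps_const (qz t \<epsilon>)
    * (1 - fps_const (qz t (\<epsilon> * (l - 1))) * fps_X) * inverse (1 - fps_const (qz t (\<epsilon> * (l + 1))) * fps_X)"
proof (cases "\<epsilon> = 1")
  case True
  then show ?thesis
    unfolding Y_series_def qpow_of_int by simp
next
  case False
  with assms have \<epsilon>: "\<epsilon> = - 1" by simp
  have X: "fps_X - fps_const (qz t k) = fps_const (- qz t k) * (1 - fps_const (qz t (- k)) * fps_X)" for k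
    by (intro fps_ext) (simp add: right_diff_distrib mult.assoc[symmetric] qz_minus)
  have "Y_series t \<epsilon> l = fps_const (qz t 1) * (fps_X - fps_const (qz t (l - 1)))
       * inverse (fps_X - fps_const (qz t (l + 1)))"
    unfolding Y_series_def qpow_of_int \<epsilon> by simp
  also have "\<dots> = (fps_const (qz t 1) * fps_const (- qz t (l - 1)) * inverse (fps_const (- qz t (l + 1))))
       * (1 - fps_const (qz t (- (l - 1))) * fps_X) * inverse (1 - fps_const (qz t (- (l + 1))) * fps_X)"
    unfolding X fps_inverse_mult by (simp only: mult_ac)
  also have "fps_const (qz t 1) * fps_const (- qz t (l - 1)) * inverse (fps_const (- qz t (l + 1)))
      = fps_const (qz t (1 + (l - 1) + - (l + 1)))"
    unfolding qz_add[of t _ "- (l + 1)"] qz_minus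
    unfolding qz_add[of t 1]
    by (simp add: fps_const_inverse)
  finally show ?thesis
    by (simp add: \<epsilon>)
qed

lemma Y_series_nth_0: "\<epsilon> \<in> {1, - 1} \<Longrightarrow> fps_nth (Y_series t \<epsilon> l) 0 = qz t \<epsilon>"
  by (simp add: Y_series_eq)

lemma qz_diff_mult:
  "(qz t a - qz t (- a)) * qz t (a * l) = qz t ((l + 1) * a) - qz t ((l - 1) * a)"
  unfolding left_diff_distrib qz_add[symmetric] by (simp add: algebra_simps)

lemma log_deriv_Y_series:
  assumes "\<epsilon> \<in> {1, - 1}"
  shows "log_deriv (Y_series t \<epsilon> l) (Abs_fps (\<lambda>k.
    of_int \<epsilon> * (qz t (int k + 1) - qz t (- (int k + 1))) * qz t (\<epsilon> * (int k + 1) * l)))"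
    (is "log_deriv _ ?D")
proof -
  have D: "?D = (0 + Abs_fps (\<lambda>k. - (qz t (\<epsilon> * (l - 1)) ^ (k + 1))))
      + - Abs_fps (\<lambda>k. - (qz t (\<epsilon> * (l + 1)) ^ (k + 1)))"
  proof (rule fps_ext)
    fix k
    show "fps_nth ?D k = fps_nth ((0 + Abs_fps (\<lambda>k. - (qz t (\<epsilon> * (l - 1)) ^ (k + 1))))
        + - Abs_fps (\<lambda>k. - (qz t (\<epsilon> * (l + 1)) ^ (k + 1)))) k"
      using assms qz_diff_mult[of t "\<epsilon> * (int k + 1)" l]
      by (auto simp: qz_power algebra_simps simp del: power_Suc)
  qed
  show ?thesis
    unfolding D Y_series_eq[OF assms]
    by (intro log_deriv_mult log_deriv_inverse log_deriv_const log_deriv_one_minus qz_nonzero)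
qed

lemma geometric_fraction_nth:
  fixes a b c :: complex
  shows "fps_nth (fps_const c * (1 - fps_const a * fps_X) * inverse (1 - fps_const b * fps_X)) k
    = (if k = 0 then c else c * (b - a) * b ^ (k - 1))"
proof -
  let ?Z = "Abs_fps (\<lambda>k. if k = 0 then c else c * (b - a) * b ^ (k - 1))"
  have "fps_const c * (1 - fps_const a * fps_X) = (1 - fps_const b * fps_X) * ?Z"
  proof (rule fps_ext)
    fix k
    show "fps_nth (fps_const c * (1 - fps_const a * fps_X)) k
        = fps_nth ((1 - fps_const b * fps_X) * ?Z) k"
    proof (cases k)
      case (Suc j)
      then show ?thesis
        by (cases j) (simp_all add: left_diff_distrib right_diff_distrib mult.assoc)
    qed simp
  qed
  then have "fps_const c * (1 - fps_const a * fps_X) * inverse (1 - fps_const b * fps_X)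
      = ?Z * ((1 - fps_const b * fps_X) * inverse (1 - fps_const b * fps_X))"
    by (simp only: mult_ac)
  also have "(1 - fps_const b * fps_X) * inverse (1 - fps_const b * fps_X) = 1"
    by (rule inverse_mult_eq_1') simp
  finally show ?thesis by simp
qed

text \<open>The logarithmic derivative is linear in the exponents, so an \<open>l\<close>-weight carries the same
  information as the sums \<open>\<Sum> u\<^sub>i\<^sub>,\<^sub>l q\<^sup>k\<^sup>l\<close>.\<close>

lemma log_deriv_l_weight_series:
  assumes "\<epsilon> \<in> {1, - 1}"
  shows "log_deriv (l_weight_series t \<epsilon> i m) (Abs_fps (\<lambda>k.
    of_int \<epsilon> * (qz t (int k + 1) - qz t (- (int k + 1)))
      * uexp_sum (\<lambda>l. qz t (\<epsilon> * (int k + 1) * l)) m i))" (is "log_deriv _ ?D")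
proof -
  have "?D = (\<Sum>l\<in>usupp m i. of_int (uexp m i l) * Abs_fps (\<lambda>k.
    of_int \<epsilon> * (qz t (int k + 1) - qz t (- (int k + 1))) * qz t (\<epsilon> * (int k + 1) * l)))"
    by (rule fps_ext)
       (simp add: fps_sum_nth uexp_sum_def sum_distrib_left mult_ac flip: fps_of_int)
  then show ?thesis
    unfolding l_weight_series_def
    by (simp only:) (intro log_deriv_prod log_deriv_powi log_deriv_Y_series assms)
qed

lemma fps_powi_nth_0: "fps_nth (F powi k) 0 = fps_nth F 0 powi k" for F :: "complex fps"
  by (simp add: power_int_def fps_power_zeroth)

lemma l_weight_series_nth_0:
  assumes "\<epsilon> \<in> {1, - 1}"
  shows "fps_nth (l_weight_series t \<epsilon> i m) 0 = qz t (\<epsilon> * uexp_sum (\<lambda>_. 1) m i)"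
proof -
  have *: "fps_nth (\<Prod>l\<in>A. F l) 0 = (\<Prod>l\<in>A. fps_nth (F l) 0)" for A :: "int set" and F :: "int \<Rightarrow> complex fps"
    by (induction A rule: infinite_finite_induct) simp_all
  have **: "(\<Prod>l\<in>A. qz t (f l)) = qz t (\<Sum>l\<in>A. f l)" if "finite A" for A :: "int set" and f
    using that by (induction A) (simp_all add: qz_add)
  show ?thesis
    by (simp add: l_weight_series_def * fps_powi_nth_0 Y_series_nth_0[OF assms] qz_powi **
        uexp_sum_def sum_distrib_left)
qed

section \<open>Eigenvalues separate monomials\<close>

text \<open>The relations say that a linear functional vanishes on all polynomials without constant term. Applied to a
  polynomial that vanishes at \<open>0\<close> and at all the numbers \<open>x b\<close> but one, it isolates a single
  coefficient.\<close>

lemma geometric_sequences_independent: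
  fixes c x :: "'a \<Rightarrow> complex"
  assumes A: "finite A" and x: "inj_on x A" "\<And>a. a \<in> A \<Longrightarrow> x a \<noteq> 0"
    and s: "\<And>k::nat. k \<ge> 1 \<Longrightarrow> (\<Sum>a\<in>A. c a * x a ^ k) = 0"
    and a: "a \<in> A"
  shows "c a = 0"
proof -
  \<comment> \<open>the factor \<open>[:0, 1:]\<close> removes the constant term, about which nothing is assumed\<close>
  define p :: "complex poly" where "p = [:0, 1:] * (\<Prod>b\<in>A - {a}. [:- x b, 1:])"
  have p: "poly p z = z * (\<Prod>b\<in>A - {a}. z - x b)" for z
    by (simp add: p_def poly_prod)
  have "(\<Sum>b\<in>A. c b * poly p (x b)) = (\<Sum>k\<le>degree p. coeff p k * (\<Sum>b\<in>A. c b * x b ^ k))"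
    unfolding poly_altdef sum_distrib_left by (subst sum.swap) (simp add: mult_ac)
  also have "\<dots> = 0"
  proof (rule sum.neutral, rule ballI)
    fix k
    show "coeff p k * (\<Sum>b\<in>A. c b * x b ^ k) = 0"
      using s[of k] by (cases k) (simp_all add: p_def coeff_mult_0)
  qed
  also have "(\<Sum>b\<in>A. c b * poly p (x b)) = c a * poly p (x a)"
    using A a by (subst sum.remove[of _ a]) (auto simp: p intro!: sum.neutral prod_zero)
  finally have "c a * poly p (x a) = 0" .
  moreover have "poly p (x a) \<noteq> 0"
    using A a x by (auto simp: p dest: inj_onD)
  ultimately show ?thesis by simp
qed

context generic_q
begin

lemma uexp_eqI:
  assumes "\<And>k::nat. k \<ge> 1 \<Longrightarrow>
    uexp_sum (\<lambda>l. qz t (int k * l)) m i = uexp_sum (\<lambda>l. qz t (int k * l)) m' i"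
  shows "uexp m i l = uexp m' i l"
proof (cases "l \<in> usupp m i \<union> usupp m' i")
  case True
  have "of_int (uexp (m - m') i l) = (0 :: complex)"
  proof (rule geometric_sequences_independent[OF _ _ _ _ True])
    show "inj_on (qz t) (usupp m i \<union> usupp m' i)"
      by (auto intro: inj_onI)
    fix k :: nat assume "k \<ge> 1"
    then have "uexp_sum (\<lambda>l. qz t (int k * l)) (m - m') i = 0"
      by (simp add: uexp_sum_diff assms)
    also have "uexp_sum (\<lambda>l. qz t (int k * l)) (m - m') i
      = (\<Sum>l\<in>usupp m i \<union> usupp m' i. of_int (uexp (m - m') i l) * qz t (int k * l))"
      by (rule uexp_sum_eq_sum) (auto simp: usupp_iff uexp_diff)
    finally show "(\<Sum>l\<in>usupp m i \<union> usupp m' i. of_int (uexp (m - m') i l) * qz t l ^ k) = 0"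
      by (simp add: qz_power mult.commute)
  qed simp_all
  then show ?thesis by (simp add: uexp_diff)
qed (simp add: usupp_iff)

lemma l_weight_series_determines_uexp:
  assumes "l_weight_series t 1 i m = l_weight_series t 1 i m'"
  shows "uexp m i l = uexp m' i l"
proof (rule uexp_eqI)
  fix k :: nat assume k: "k \<ge> 1"
  have "Abs_fps (\<lambda>k. of_int 1 * (qz t (int k + 1) - qz t (- (int k + 1)))
          * uexp_sum (\<lambda>l. qz t (1 * (int k + 1) * l)) m i)
      = Abs_fps (\<lambda>k. of_int 1 * (qz t (int k + 1) - qz t (- (int k + 1)))
          * uexp_sum (\<lambda>l. qz t (1 * (int k + 1) * l)) m' i)"
    using log_deriv_l_weight_series[of 1 t i m] log_deriv_l_weight_series[of 1 t i m'] assms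
    by (intro log_deriv_eq) simp_all
  from arg_cong[OF this, of "\<lambda>F. fps_nth F (k - 1)"] k
  show "uexp_sum (\<lambda>l. qz t (int k * l)) m i = uexp_sum (\<lambda>l. qz t (int k * l)) m' i"
    by (simp add: of_nat_diff)
qed

end

section \<open>Eigenvalues of the currents\<close>

definition eigen :: "('g \<Rightarrow> 'b \<Rightarrow> ('b \<Rightarrow>\<^sub>0 complex)) \<Rightarrow> 'b \<Rightarrow> ('g list \<Rightarrow>\<^sub>0 complex) \<Rightarrow> complex \<Rightarrow> bool" where
  "eigen G m a c \<longleftrightarrow>
     free_act G a (Poly_Mapping.single m 1) = Poly_Mapping.single m c"

lemma eigen_0: "eigen G m 0 0"
  and eigen_1: "eigen G m 1 1"
  by (simp_all add: eigen_def)

lemma eigen_add: "eigen G m a c \<Longrightarrow> eigen G m b d \<Longrightarrow> eigen G m (a + b) (c + d)"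
  by (simp add: eigen_def free_act_add single_add)

lemma eigen_uminus: "eigen G m a c \<Longrightarrow> eigen G m (- a) (- c)"
  by (simp add: eigen_def free_act_uminus single_uminus)

lemma eigen_apply: "eigen G m a c \<Longrightarrow> free_act G a (Poly_Mapping.single m d) = Poly_Mapping.single m (c * d)"
  using free_act_vscale[of G a d "Poly_Mapping.single m 1"] by (simp add: eigen_def mult.commute)

lemma eigen_mult: "eigen G m a c \<Longrightarrow> eigen G m b d \<Longrightarrow> eigen G m (a * b) (c * d)"
  unfolding eigen_def[of G m "a * b"] free_act_mult
  by (simp add: eigen_apply)

lemma eigen_cst: "eigen G m (cst c) c"
  by (simp add: eigen_def cst_def free_act_single zero_list_def)

lemma eigen_sum: "(\<And>i. i \<in> F \<Longrightarrow> eigen G m (a i) (c i)) \<Longrightarrow> eigen G m (\<Sum>i\<in>F. a i) (\<Sum>i\<in>F. c i)"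
  by (induction F rule: infinite_finite_induct) (simp_all add: eigen_0 eigen_add)

lemma eigen_fps_power:
  assumes "\<And>k. eigen G m (fps_nth F k) (fps_nth f k)"
  shows "eigen G m (fps_nth (F ^ j) k) (fps_nth (f ^ j) k)"
proof (induction j arbitrary: k)
  case 0
  then show ?case by (simp add: eigen_0 eigen_1)
next
  case (Suc j)
  then show ?case
    by (auto simp: fps_mult_nth intro!: eigen_sum eigen_mult assms)
qed

lemma eigen_exp_series:
  assumes "\<And>k. eigen G m (fps_nth F k) (fps_nth f k)"
  shows "eigen G m (fps_nth (exp_series F) k) (fps_nth (fps_exp 1 oo f) k)"
  unfolding exp_series_def fps_compose_nth
  by (intro eigen_sum eigen_mult eigen_fps_power assms) (simp add: eigen_cst)

text \<open>The exponential of the eigenvalues of the diagonal generators agrees with the product of fractions: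
  the logarithmic derivatives are equal, and so are the constant terms because the exponents at \<open>i\<close> add up
  to the value of the weight on the coroot.\<close>

lemma eigen_phi_elt:
  assumes q: "generic_q t" and \<epsilon>: "\<epsilon> \<in> {1, - 1}"
    and k: "\<And>h. eigen G m (gk h) (qpow t (pairing (wgt m') h))"
    and h: "\<And>k. k \<noteq> 0 \<Longrightarrow>
      eigen G m (gh i k) (qint t k / of_int k * uexp_sum (\<lambda>l. qz t (k * l)) m' i)"
    and wt: "of_int (uexp_sum (\<lambda>_. 1) m' i) = pairing (wgt m') (hvec i)"
  shows "eigen G m (phi_elt t \<epsilon> i (\<epsilon> * int j)) (fps_nth (l_weight_series t \<epsilon> i m') j)"
proof -
  interpret generic_q t by (rule q)
  define F :: "falg fps" where "F = Abs_fps (\<lambda>k. if k = 0 then 0 else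
         cst (of_int \<epsilon> * (qpow t 1 - qpow t (- 1))) * gh i (\<epsilon> * int k))"
  define f :: "complex fps" where "f = Abs_fps (\<lambda>k. if k = 0 then 0 else
         of_int \<epsilon> * (qz t (int k) - qz t (- int k)) / of_nat k
           * uexp_sum (\<lambda>l. qz t (\<epsilon> * int k * l)) m' i)"
  have Ff: "eigen G m (fps_nth F k) (fps_nth f k)" for k
  proof (cases "k = 0")
    case False
    have "fps_nth f k = (of_int \<epsilon> * (qpow t 1 - qpow t (- 1))) *
        (qint t (\<epsilon> * int k) / of_int (\<epsilon> * int k) * uexp_sum (\<lambda>l. qz t (\<epsilon> * int k * l)) m' i)"
      using \<epsilon> False q_minus_inverse_nonzero
      by (auto simp: f_def qint_qz qpow_of_int divide_simps)
    moreover have "fps_nth F k = cst (of_int \<epsilon> * (qpow t 1 - qpow t (- 1))) * gh i (\<epsilon> * int k)"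
      using False by (simp add: F_def)
    moreover have "\<epsilon> * int k \<noteq> 0"
      using False \<epsilon> by auto
    ultimately show ?thesis
      by (simp only:) (intro eigen_mult eigen_cst h)
  qed (simp add: F_def f_def eigen_0)
  define K where "K = qpow t (pairing (wgt m') (if \<epsilon> = 1 then hvec i else - hvec i))"
  have K: "K = qz t (\<epsilon> * uexp_sum (\<lambda>_. 1) m' i)"
    using \<epsilon> by (auto simp: K_def qz_def pairing_uminus_right wt)
  have "fps_const K * (fps_exp 1 oo f) = l_weight_series t \<epsilon> i m'"
  proof (rule log_deriv_unique)
    show "log_deriv (fps_const K * (fps_exp 1 oo f)) (0 + fps_deriv f)"
      by (intro log_deriv_mult log_deriv_const log_deriv_exp) (simp_all add: K f_def)
    have "0 + fps_deriv f = Abs_fps (\<lambda>k. of_int \<epsilon> * (qz t (int k + 1) - qz t (- (int k + 1)))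
      * uexp_sum (\<lambda>l. qz t (\<epsilon> * (int k + 1) * l)) m' i)"
      by (rule fps_ext) (simp add: f_def add.commute del: of_nat_Suc, simp add: divide_simps)
    then show "log_deriv (l_weight_series t \<epsilon> i m') (0 + fps_deriv f)"
      using log_deriv_l_weight_series[OF \<epsilon>, of t i m'] by simp
    show "fps_nth (fps_const K * (fps_exp 1 oo f)) 0 = fps_nth (l_weight_series t \<epsilon> i m') 0"
      by (simp add: l_weight_series_nth_0[OF \<epsilon>] K)
  qed
  moreover have "phi_elt t \<epsilon> i (\<epsilon> * int j)
      = gk (if \<epsilon> = 1 then hvec i else - hvec i) * fps_nth (exp_series F) j"
    using \<epsilon> by (auto simp: phi_elt_def F_def)
  moreover have "eigen G m (gk (if \<epsilon> = 1 then hvec i else - hvec i) * fps_nth (exp_series F) j)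
      (K * fps_nth (fps_exp 1 oo f) j)"
    unfolding K_def by (intro eigen_mult k eigen_exp_series Ff)
  ultimately show ?thesis
    by (metis fps_mult_left_const_nth)
qed

section \<open>Minuscule sets of monomials\<close>

definition single_at :: "monom \<Rightarrow> nat \<Rightarrow> int \<Rightarrow> int \<Rightarrow> bool" where
  "single_at m i c l \<longleftrightarrow> (\<forall>l'. uexp m i l' = (if l' = l then c else 0))"

text \<open>For \<open>\<epsilon> = -1\<close> this divides by \<open>A\<^sub>i\<^sub>,\<^sub>l\<^sub>+\<^sub>1\<close>, and for \<open>\<epsilon> = 1\<close> it multiplies by \<open>A\<^sub>i\<^sub>,\<^sub>l\<^sub>-\<^sub>1\<close>. It is meant for
  monomials whose part at \<open>i\<close> is the variable \<open>Y\<^sub>i\<^sub>,\<^sub>l\<close> with exponent \<open>-\<epsilon>\<close>; writing the index as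
  \<open>l - \<epsilon>\<close> lets raising and lowering operators share their proofs.\<close>

definition move :: "nat \<Rightarrow> int \<Rightarrow> nat \<Rightarrow> int \<Rightarrow> monom \<Rightarrow> monom" where
  "move n \<epsilon> i l m = (if \<epsilon> = 1 then m + Amon n i (l - \<epsilon>) else m - Amon n i (l - \<epsilon>))"

lemma uexp_move:
  assumes "\<epsilon> \<in> {1, - 1}"
  shows "uexp (move n \<epsilon> j l m) i l' = uexp m i l' + \<epsilon> * uexp (Amon n j (l - \<epsilon>)) i l'"
  using assms by (auto simp: move_def uexp_add uexp_diff)

lemma uexp_sum_move:
  assumes "\<epsilon> \<in> {1, - 1}"
  shows "uexp_sum f (move n \<epsilon> j l m) i
    = uexp_sum f m i + of_int \<epsilon> * uexp_sum f (Amon n j (l - \<epsilon>)) i"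
  using assms by (auto simp: move_def uexp_sum_add uexp_sum_diff)

lemma pairing_wgt_move:
  assumes "\<epsilon> \<in> {1, - 1}"
  shows "pairing (wgt (move n \<epsilon> j l m)) h = pairing (wgt m) h + of_int \<epsilon> * pairing (alpha n j) h"
  using assms by (auto simp: move_def wgt_simps pairing_add_left pairing_diff_left)

lemma move_move:
  assumes "\<epsilon> \<in> {1, - 1}"
  shows "move n (- \<epsilon>) i (l - 2 * \<epsilon>) (move n \<epsilon> i l m) = m"
  using assms by (auto simp: move_def algebra_simps)

lemma move_commute:
  assumes "\<epsilon> \<in> {1, - 1}" "\<epsilon>' \<in> {1, - 1}"
  shows "move n \<epsilon> i l (move n \<epsilon>' j l' m) = move n \<epsilon>' j l' (move n \<epsilon> i l m)"
  using assms by (auto simp: move_def algebra_simps)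

lemma single_at_unique: "single_at m i c l \<Longrightarrow> c \<noteq> 0 \<Longrightarrow> single_at m i c' l' \<Longrightarrow> c' = c \<and> l' = l"
  unfolding single_at_def by metis

text \<open>In the first case the coefficient is \<open>q\<^sup>r\<^sup>a\<close>, where \<open>a = l - \<epsilon>\<close> is the index of the monomial \<open>A\<^sub>i\<^sub>,\<^sub>a\<close>
  used in the move.\<close>

fun minuscule_act :: "nat \<Rightarrow> complex \<Rightarrow> gen \<Rightarrow> monom \<Rightarrow> (monom \<Rightarrow>\<^sub>0 complex)" where
  "minuscule_act n t (XG \<epsilon> i r) m = (if \<exists>l. single_at m i (- \<epsilon>) l then
     (let l = (THE l. single_at m i (- \<epsilon>) l) in
        Poly_Mapping.single (move n \<epsilon> i l m) (qz t (r * (l - \<epsilon>)))) else 0)"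
| "minuscule_act n t (KG h) m = Poly_Mapping.single m (qpow t (pairing (wgt m) h))"
| "minuscule_act n t (HG i k) m = Poly_Mapping.single m
     (qint t k / of_int k * uexp_sum (\<lambda>l. qz t (k * l)) m i)"

text \<open>The assumption \<open>n \<ge> 2\<close> makes the two neighbours of a node distinct, so that neighbours are joined by a
  single edge.\<close>

locale minuscule_set = generic_q t for t :: complex +
  fixes n :: nat and M :: "monom set"
  assumes n_ge_2: "n \<ge> 2"
    and M_monomials: "M \<subseteq> monomials n"
    and M_cases: "m \<in> M \<Longrightarrow> i \<le> n \<Longrightarrow>
      (\<forall>l. uexp m i l = 0) \<or> (\<exists>\<epsilon>\<in>{1, - 1}. \<exists>l. single_at m i \<epsilon> l)"
    and M_move: "m \<in> M \<Longrightarrow> i \<le> n \<Longrightarrow> \<epsilon> \<in> {1, - 1} \<Longrightarrow> single_at m i (- \<epsilon>) l \<Longrightarrow> move n \<epsilon> i l m \<in> M"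
begin

abbreviation "act \<equiv> free_act (minuscule_act n t)"
abbreviation "vec \<equiv> Poly_Mapping.single"

lemma act_gx:
  assumes "\<epsilon> \<in> {1, - 1}" "single_at m i (- \<epsilon>) l"
  shows "act (gx \<epsilon> i r) (vec m c) = vec (move n \<epsilon> i l m) (c * qz t (r * (l - \<epsilon>)))"
proof -
  have "(THE l. single_at m i (- \<epsilon>) l) = l"
    using assms(2)
  proof (rule the_equality)
    show "l' = l" if "single_at m i (- \<epsilon>) l'" for l'
      using single_at_unique[OF assms(2) _ that] assms(1) by auto
  qed
  moreover have "\<exists>l. single_at m i (- \<epsilon>) l"
    using assms by blast
  ultimately show ?thesis
    by (simp add: gx_def free_act_single)
qed

lemma act_gx_zero:
  "\<nexists>l. single_at m i (- \<epsilon>) l \<Longrightarrow> act (gx \<epsilon> i r) (vec m c) = 0"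
  unfolding gx_def free_act_single by (simp del: ex_simps flip: not_ex)

lemma act_gx_cases:
  assumes "\<epsilon> \<in> {1, - 1}"
  obtains (zero) "\<nexists>l. single_at m i (- \<epsilon>) l" "\<And>r c. act (gx \<epsilon> i r) (vec m c) = 0"
  | (move) l where "single_at m i (- \<epsilon>) l"
      "\<And>r c. act (gx \<epsilon> i r) (vec m c) = vec (move n \<epsilon> i l m) (c * qz t (r * (l - \<epsilon>)))"
  using act_gx[OF assms] act_gx_zero by metis

lemma act_gk: "act (gk h) (vec m c) = vec m (c * qpow t (pairing (wgt m) h))"
  by (simp add: gk_def free_act_single)

lemma act_gh: "act (gh i k) (vec m c)
    = vec m (c * (qint t k / of_int k * uexp_sum (\<lambda>l. qz t (k * l)) m i))"
  by (simp add: gh_def free_act_single)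

lemma act_cst: "act (cst c) v = vscale c v"
  by (simp add: cst_def free_act_single zero_list_def)

lemma eigen_gk: "eigen (minuscule_act n t) m (gk h) (qpow t (pairing (wgt m) h))"
  by (simp add: eigen_def act_gk)

lemma eigen_gh: "eigen (minuscule_act n t) m (gh i k)
    (qint t k / of_int k * uexp_sum (\<lambda>l. qz t (k * l)) m i)"
  by (simp add: eigen_def act_gh)

lemma eigen_phi:
  assumes "m \<in> M" "i \<le> n" "\<epsilon> \<in> {1, - 1}"
  shows "eigen (minuscule_act n t) m (phi_elt t \<epsilon> i (\<epsilon> * int j))
    (fps_nth (l_weight_series t \<epsilon> i m) j)"
proof (rule eigen_phi_elt[OF generic_q_axioms assms(3) eigen_gk eigen_gh])
  show "of_int (uexp_sum (\<lambda>_. 1) m i) = pairing (wgt m) (hvec i)"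
    using assms M_monomials by (intro monomials_uexp_sum_one) auto
qed

section \<open>The effect of a move on neighbouring nodes\<close>

lemma single_at_move_same:
  assumes "i \<le> n" "\<epsilon> \<in> {1, - 1}" "single_at m i (- \<epsilon>) l"
  shows "single_at (move n \<epsilon> i l m) i \<epsilon> (l - 2 * \<epsilon>)"
  using assms
  by (auto simp: single_at_def uexp_move uexp_Amon_same[OF n_ge_2])

lemma uexp_move_far:
  assumes "i \<le> n" "j \<le> n" "\<epsilon> \<in> {1, - 1}" "i \<noteq> j" "\<not> adjacent n i j"
  shows "uexp (move n \<epsilon> j l m) i l' = uexp m i l'"
  using assms by (simp add: uexp_move uexp_Amon_far[OF n_ge_2])

text \<open>A move at \<open>j\<close> multiplies the part at \<open>i\<close> by the variable with second index \<open>l - \<epsilon>\<close>, raised to the power \<open>-\<epsilon>\<close>.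
  A part that already contained another variable, or the same one with the same sign, would leave the
  permitted shapes.\<close>

lemma adjacent_cases:
  assumes m: "m \<in> M" and ij: "i \<le> n" "j \<le> n" "adjacent n i j"
    and \<epsilon>: "\<epsilon> \<in> {1, - 1}" and l: "single_at m j (- \<epsilon>) l"
  shows "(\<forall>l'. uexp m i l' = 0) \<and> single_at (move n \<epsilon> j l m) i (- \<epsilon>) (l - \<epsilon>) \<or>
     single_at m i \<epsilon> (l - \<epsilon>) \<and> (\<forall>l'. uexp (move n \<epsilon> j l m) i l' = 0)"
proof -
  let ?m = "move n \<epsilon> j l m"
  have u: "uexp ?m i l' = uexp m i l' - (if l' = l - \<epsilon> then \<epsilon> else 0)" for l'
    using \<epsilon> by (simp add: uexp_move uexp_Amon_adjacent[OF n_ge_2 ij])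
  have m': "?m \<in> M"
    using M_move[OF m ij(2) \<epsilon> l] .
  from M_cases[OF m ij(1)] show ?thesis
  proof
    assume "\<forall>l'. uexp m i l' = 0"
    then show ?thesis
      by (simp add: single_at_def u)
  next
    assume "\<exists>c\<in>{1, - 1}. \<exists>a. single_at m i c a"
    then obtain c a where c: "c \<in> {1, - 1}" and a: "single_at m i c a"
      by blast
    have u': "uexp ?m i l' = (if l' = a then c else 0) - (if l' = l - \<epsilon> then \<epsilon> else 0)" for l'
      using a by (simp add: u single_at_def)
    have "a = l - \<epsilon> \<and> c = \<epsilon>"
    proof (rule ccontr)
      assume ne: "\<not> (a = l - \<epsilon> \<and> c = \<epsilon>)"
      from M_cases[OF m' ij(1)] show False
      proof
        assume "\<forall>l'. uexp ?m i l' = 0"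
        then have "uexp ?m i a = 0" "uexp ?m i (l - \<epsilon>) = 0"
          by simp_all
        then show False
          using c ne by (auto simp: u' split: if_splits)
      next
        assume "\<exists>d\<in>{1, - 1}. \<exists>b. single_at ?m i d b"
        then obtain d b where d: "d \<in> {1, - 1}" and b: "\<And>l'. uexp ?m i l' = (if l' = b then d else 0)"
          by (auto simp: single_at_def)
        show False
          using b[of a] b[of "l - \<epsilon>"] c d \<epsilon> ne unfolding u' by (auto split: if_splits)
      qed
    qed
    with a show ?thesis
      by (simp add: u')
  qed
qed

lemma not_single_at_zero:
  "\<forall>l. uexp m i l = 0 \<Longrightarrow> \<epsilon> \<in> {1, - 1} \<Longrightarrow> \<nexists>l. single_at m i \<epsilon> l"
  "\<forall>l. uexp m i l = 0 \<Longrightarrow> \<epsilon> \<in> {1, - 1} \<Longrightarrow> \<nexists>l. single_at m i (- \<epsilon>) l"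
  by (auto simp: single_at_def)

lemma not_single_at_opposite: "single_at m i c l \<Longrightarrow> c \<noteq> 0 \<Longrightarrow> \<not> single_at m i (- c) l'"
  using single_at_unique[of m i c l "- c" l'] by auto

section \<open>Products of raising and lowering operators\<close>

text \<open>A move leaves a variable with the opposite exponent behind, so it cannot be repeated.\<close>

lemma gx_gx_same:
  assumes "i \<le> n" "\<epsilon> \<in> {1, - 1}"
  shows "act (gx \<epsilon> i r) (act (gx \<epsilon> i r') (vec m c)) = 0"
proof (rule act_gx_cases[OF assms(2), of m i])
  fix l assume l: "single_at m i (- \<epsilon>) l"
    and a: "\<And>r c. act (gx \<epsilon> i r) (vec m c) = vec (move n \<epsilon> i l m) (c * qz t (r * (l - \<epsilon>)))"
  have "\<nexists>l'. single_at (move n \<epsilon> i l m) i (- \<epsilon>) l'"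
    using not_single_at_opposite[OF single_at_move_same[OF assms l]] assms(2) by auto
  then show ?thesis
    by (simp add: a act_gx_zero)
qed simp

text \<open>Moves at two distant nodes neither enable nor obstruct each other.\<close>

lemma gx_gx_far:
  assumes ij: "i \<le> n" "j \<le> n" "i \<noteq> j" "\<not> adjacent n i j"
    and \<epsilon>: "\<epsilon> \<in> {1, - 1}" "\<epsilon>' \<in> {1, - 1}"
  shows "act (gx \<epsilon> i r) (act (gx \<epsilon>' j r') (vec m c)) = act (gx \<epsilon>' j r') (act (gx \<epsilon> i r) (vec m c))"
proof -
  have ji: "\<not> adjacent n j i"
    using adjacent_sym[OF ij(2)] ij(4) by blast
  have i: "single_at (move n \<epsilon>' j l m) i d l' = single_at m i d l'" for l d l'
    using uexp_move_far[OF ij(1,2) \<epsilon>(2) ij(3,4)] by (simp add: single_at_def)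
  have j: "single_at (move n \<epsilon> i l m) j d l' = single_at m j d l'" for l d l'
    using uexp_move_far[OF ij(2,1) \<epsilon>(1) ij(3)[symmetric] ji] by (simp add: single_at_def)
  show ?thesis
  proof (rule act_gx_cases[OF \<epsilon>(1), of m i]; rule act_gx_cases[OF \<epsilon>(2), of m j])
    fix a b
    assume "single_at m i (- \<epsilon>) a" "single_at m j (- \<epsilon>') b"
    then show ?thesis
      using \<epsilon> by (simp add: act_gx i j move_commute[OF \<epsilon>] mult_ac)
  qed (simp_all add: act_gx_zero act_gx i j)
qed

text \<open>After a move at \<open>j\<close> the part at \<open>i\<close> is trivial or ready for a move of the same sign, never of the
  opposite one.\<close>

lemma gx_gx_adjacent_opposite:
  assumes m: "m \<in> M" and ij: "i \<le> n" "j \<le> n" "adjacent n i j" and \<epsilon>: "\<epsilon> \<in> {1, - 1}"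
  shows "act (gx (- \<epsilon>) i r) (act (gx \<epsilon> j r') (vec m c)) = 0"
proof (rule act_gx_cases[OF \<epsilon>, of m j])
  fix l assume l: "single_at m j (- \<epsilon>) l"
    and a: "\<And>r c. act (gx \<epsilon> j r) (vec m c) = vec (move n \<epsilon> j l m) (c * qz t (r * (l - \<epsilon>)))"
  have "\<not> single_at (move n \<epsilon> j l m) i \<epsilon> l'" for l'
    using adjacent_cases[OF m ij \<epsilon> l]
  proof (elim disjE conjE)
    assume "single_at (move n \<epsilon> j l m) i (- \<epsilon>) (l - \<epsilon>)"
    from not_single_at_opposite[OF this, of l'] \<epsilon> show ?thesis by auto
  next
    assume "\<forall>l'. uexp (move n \<epsilon> j l m) i l' = 0"
    from not_single_at_zero(1)[OF this \<epsilon>] show ?thesis by blast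
  qed
  then show ?thesis
    by (simp add: a act_gx_zero)
qed simp

text \<open>The move at \<open>j\<close> cancels the variable that the first move at \<open>i\<close> has produced, and nothing is left to move
  at \<open>i\<close>. So the middle term of the Serre relation vanishes like the outer ones.\<close>

lemma gx_gx_gx_alternating:
  assumes m: "m \<in> M" and ij: "i \<le> n" "j \<le> n" "adjacent n i j" and \<epsilon>: "\<epsilon> \<in> {1, - 1}"
  shows "act (gx \<epsilon> i r) (act (gx \<epsilon> j r') (act (gx \<epsilon> i r'') (vec m c))) = 0"
proof (rule act_gx_cases[OF \<epsilon>, of m i])
  fix l assume l: "single_at m i (- \<epsilon>) l"
    and a: "\<And>r c. act (gx \<epsilon> i r) (vec m c) = vec (move n \<epsilon> i l m) (c * qz t (r * (l - \<epsilon>)))"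
  let ?m = "move n \<epsilon> i l m"
  have m': "?m \<in> M"
    by (rule M_move[OF m ij(1) \<epsilon> l])
  have i: "single_at ?m i \<epsilon> (l - 2 * \<epsilon>)"
    by (rule single_at_move_same[OF ij(1) \<epsilon> l])
  show ?thesis
  proof (rule act_gx_cases[OF \<epsilon>, of ?m j])
    fix l' assume l': "single_at ?m j (- \<epsilon>) l'"
      and a': "\<And>r c. act (gx \<epsilon> j r) (vec ?m c) = vec (move n \<epsilon> j l' ?m) (c * qz t (r * (l' - \<epsilon>)))"
    have "\<not> (\<forall>l''. uexp ?m i l'' = 0)"
      using not_single_at_zero(1)[OF _ \<epsilon>] i by blast
    then have "\<forall>l''. uexp (move n \<epsilon> j l' ?m) i l'' = 0"
      using adjacent_cases[OF m' ij \<epsilon> l'] by blast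
    from not_single_at_zero(2)[OF this \<epsilon>]
    have "\<nexists>l''. single_at (move n \<epsilon> j l' ?m) i (- \<epsilon>) l''" .
    then show ?thesis
      by (simp add: a a' act_gx_zero)
  qed (simp add: a)
qed simp

text \<open>The quadratic relation between neighbours splits into two such identities, one for each order of the
  factors. The power of \<open>q\<close> appears because the second move has the index \<open>l - 2 \<epsilon>\<close> and the first one \<open>l - \<epsilon>\<close>:
  transferring one unit of loop degree between them changes the coefficient by their quotient.\<close>

lemma gx_gx_adjacent:
  assumes m: "m \<in> M" and ij: "i \<le> n" "j \<le> n" "adjacent n i j" and \<epsilon>: "\<epsilon> \<in> {1, - 1}"
  shows "act (gx \<epsilon> i (r + 1)) (act (gx \<epsilon> j r') (vec m c))
    = vscale (qz t (- \<epsilon>)) (act (gx \<epsilon> i r) (act (gx \<epsilon> j (r' + 1)) (vec m c)))"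
proof (rule act_gx_cases[OF \<epsilon>, of m j])
  fix l assume l: "single_at m j (- \<epsilon>) l"
    and a: "\<And>r c. act (gx \<epsilon> j r) (vec m c) = vec (move n \<epsilon> j l m) (c * qz t (r * (l - \<epsilon>)))"
  from adjacent_cases[OF m ij \<epsilon> l] show ?thesis
  proof (elim disjE conjE)
    assume i: "single_at (move n \<epsilon> j l m) i (- \<epsilon>) (l - \<epsilon>)"
    have "r' * (l - \<epsilon>) + (r + 1) * (l - \<epsilon> - \<epsilon>) = - \<epsilon> + ((r' + 1) * (l - \<epsilon>) + r * (l - \<epsilon> - \<epsilon>))"
      by (simp add: algebra_simps)
    then have "qz t (r' * (l - \<epsilon>)) * qz t ((r + 1) * (l - \<epsilon> - \<epsilon>))
      = qz t (- \<epsilon>) * (qz t ((r' + 1) * (l - \<epsilon>)) * qz t (r * (l - \<epsilon> - \<epsilon>)))"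
      unfolding qz_add[symmetric] by (rule arg_cong)
    then show ?thesis
      by (simp add: a act_gx[OF \<epsilon> i] mult_ac)
  next
    assume "\<forall>l'. uexp (move n \<epsilon> j l m) i l' = 0"
    from not_single_at_zero(2)[OF this \<epsilon>]
    have "\<nexists>l'. single_at (move n \<epsilon> j l m) i (- \<epsilon>) l'" .
    then show ?thesis
      by (simp add: a act_gx_zero)
  qed
qed simp

section \<open>The defining relations\<close>

lemma l_weight_series_single_at:
  assumes c: "c \<in> {1, - 1}" and \<epsilon>: "\<epsilon> \<in> {1, - 1}" and l: "single_at m i c l"
  shows "fps_nth (l_weight_series t \<epsilon> i m) k = (if k = 0 then qz t (c * \<epsilon>)
    else of_int (c * \<epsilon>) * (qz t 1 - qz t (- 1)) * qz t (\<epsilon> * int k * (l + c)))"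
proof -
  have "usupp m i = {l}"
    using c l by (auto simp: usupp_def single_at_def)
  moreover have "uexp m i l = c"
    using l by (simp add: single_at_def)
  ultimately have "l_weight_series t \<epsilon> i m = Y_series t \<epsilon> l powi c"
    by (simp add: l_weight_series_def)
  also have "\<dots> = fps_const (qz t (c * \<epsilon>)) * (1 - fps_const (qz t (\<epsilon> * (l - c))) * fps_X)
      * inverse (1 - fps_const (qz t (\<epsilon> * (l + c))) * fps_X)"
    using c
    by (auto simp: Y_series_eq[OF \<epsilon>] power_int_def fps_inverse_mult fps_const_inverse
        fps_inverse_idempotent qz_minus mult_ac)
  finally have "fps_nth (l_weight_series t \<epsilon> i m) k = (if k = 0 then qz t (c * \<epsilon>)
      else qz t (c * \<epsilon>) * (qz t (\<epsilon> * (l + c)) - qz t (\<epsilon> * (l - c))) * qz t (\<epsilon> * (l + c)) ^ (k - 1))"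
    by (simp only: geometric_fraction_nth)
  moreover have "qz t (c * \<epsilon>) * (qz t (\<epsilon> * (l + c)) - qz t (\<epsilon> * (l - c))) * qz t (\<epsilon> * (l + c)) ^ (k - 1)
      = of_int (c * \<epsilon>) * (qz t 1 - qz t (- 1)) * qz t (\<epsilon> * int k * (l + c))" if "k \<noteq> 0"
  proof -
    have "qz t (c * \<epsilon>) * (qz t (\<epsilon> * (l + c)) - qz t (\<epsilon> * (l - c))) * qz t (\<epsilon> * (l + c)) ^ (k - 1)
      = qz t (c * \<epsilon> + \<epsilon> * (l + c) + \<epsilon> * (l + c) * int (k - 1))
        - qz t (c * \<epsilon> + \<epsilon> * (l - c) + \<epsilon> * (l + c) * int (k - 1))"
      unfolding qz_power left_diff_distrib right_diff_distrib qz_add[symmetric] by simp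
    also have "c * \<epsilon> + \<epsilon> * (l + c) + \<epsilon> * (l + c) * int (k - 1) = c * \<epsilon> + \<epsilon> * int k * (l + c)"
      using that by (simp add: of_nat_diff algebra_simps)
    also have "c * \<epsilon> + \<epsilon> * (l - c) + \<epsilon> * (l + c) * int (k - 1) = - (c * \<epsilon>) + \<epsilon> * int k * (l + c)"
      using that by (simp add: of_nat_diff algebra_simps)
    also have "qz t (c * \<epsilon> + \<epsilon> * int k * (l + c)) - qz t (- (c * \<epsilon>) + \<epsilon> * int k * (l + c))
      = of_int (c * \<epsilon>) * (qz t 1 - qz t (- 1)) * qz t (\<epsilon> * int k * (l + c))"
      unfolding qz_add using c \<epsilon> by (auto simp: left_diff_distrib)
    finally show ?thesis .
  qed
  ultimately show ?thesis
    by simp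
qed

text \<open>The two currents are the expansions of one rational function at \<open>0\<close> and at \<open>\<infinity>\<close>. Their difference is a
  delta function supported at its pole, which is why a single formula covers all integers \<open>s\<close>.\<close>

lemma act_phi_difference:
  assumes m: "m \<in> M" and i: "i \<le> n"
  defines "D s \<equiv> act (cst (1 / (qpow t 1 - qpow t (- 1))) * (phi_elt t 1 i s - phi_elt t (- 1) i s)) (vec m 1)"
  shows act_phi_difference_zero: "\<forall>l. uexp m i l = 0 \<Longrightarrow> D s = 0"
    and act_phi_difference_single: "c \<in> {1, - 1} \<Longrightarrow> single_at m i c l \<Longrightarrow>
      D s = vec m (of_int c * qz t (s * (l + c)))"
proof -
  \<comment> \<open>the coefficient of \<open>z\<^sup>s\<close> in the expansion with sign \<open>\<epsilon>\<close>\<close>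
  define w where "w \<epsilon> = (if \<epsilon> * s < 0 then 0 else fps_nth (l_weight_series t \<epsilon> i m) (nat (\<epsilon> * s)))"
    for \<epsilon> :: int
  have w: "eigen (minuscule_act n t) m (phi_elt t \<epsilon> i s) (w \<epsilon>)" if \<epsilon>: "\<epsilon> \<in> {1, - 1}" for \<epsilon>
  proof (cases "\<epsilon> * s < 0")
    case True
    then show ?thesis
      by (simp add: w_def phi_elt_def eigen_0)
  next
    case False
    then have "\<epsilon> * int (nat (\<epsilon> * s)) = s"
      using \<epsilon> by auto
    note e = this
    show ?thesis
      using eigen_phi[OF m i \<epsilon>, of "nat (\<epsilon> * s)", unfolded e] False by (simp add: w_def)
  qed
  have "eigen (minuscule_act n t) m
      (cst (1 / (qpow t 1 - qpow t (- 1))) * (phi_elt t 1 i s + - phi_elt t (- 1) i s))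
      (1 / (qz t 1 - qz t (- 1)) * (w 1 + - w (- 1)))"
    unfolding qpow_of_int by (intro eigen_mult eigen_add eigen_uminus eigen_cst w) simp_all
  then have D: "D s = vec m (1 / (qz t 1 - qz t (- 1)) * (w 1 - w (- 1)))"
    by (simp add: D_def eigen_def)
  show "D s = 0" if u: "\<forall>l. uexp m i l = 0"
  proof -
    have "usupp m i = {}"
      using u by (simp add: usupp_def)
    then show ?thesis
      by (auto simp: D w_def l_weight_series_def)
  qed
  show "D s = vec m (of_int c * qz t (s * (l + c)))" if c: "c \<in> {1, - 1}" and l: "single_at m i c l"
  proof -
    note L = l_weight_series_single_at[OF c _ l]
    have "w 1 - w (- 1) = of_int c * (qz t 1 - qz t (- 1)) * qz t (s * (l + c))"
      using c by (cases s "0 :: int" rule: linorder_cases) (auto simp: w_def L)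
    then show ?thesis
      using q_minus_inverse_nonzero by (simp add: D)
  qed
qed

text \<open>A move at \<open>i\<close> and its inverse use the same monomial \<open>A\<^sub>i\<^sub>,\<^sub>l\<^sub>+\<^sub>c\<close>, so that only the sum of the loop degrees
  matters.\<close>

lemma act_gx_opposite_same:
  assumes m: "m \<in> M" and i: "i \<le> n" and c: "c \<in> {1, - 1}" and l: "single_at m i c l"
  shows "act (gx c i r) (act (gx (- c) i r') (vec m 1)) = vec m (qz t ((r + r') * (l + c)))"
    and "act (gx (- c) i r) (act (gx c i r') (vec m 1)) = 0"
proof -
  have c': "- c \<in> {1, - 1}"
    using c by auto
  have l': "single_at (move n (- c) i l m) i (- c) (l + 2 * c)"
    using single_at_move_same[OF i c', of m l] l by simp
  have "act (gx c i r) (act (gx (- c) i r') (vec m 1))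
      = vec (move n c i (l + 2 * c) (move n (- c) i l m)) (qz t (r' * (l + c)) * qz t (r * (l + 2 * c - c)))"
    using act_gx[OF c', of m i l] act_gx[OF c l'] l by simp
  also have "move n c i (l + 2 * c) (move n (- c) i l m) = m"
    using move_move[OF c', of n i l m] by simp
  also have "qz t (r' * (l + c)) * qz t (r * (l + 2 * c - c)) = qz t ((r + r') * (l + c))"
    unfolding qz_add[symmetric] by (simp add: algebra_simps)
  finally show "act (gx c i r) (act (gx (- c) i r') (vec m 1)) = vec m (qz t ((r + r') * (l + c)))" .
  have "\<nexists>l. single_at m i (- c) l"
    using not_single_at_opposite[OF l] c by auto
  then show "act (gx (- c) i r) (act (gx c i r') (vec m 1)) = 0"
    by (simp add: act_gx_zero)
qed

lemma relation_xx_opposite_same: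
  assumes m: "m \<in> M" and i: "i \<le> n"
  shows "act (commutator (gx 1 i r) (gx (- 1) i r')) (vec m 1)
    = act (cst (1 / (qpow t 1 - qpow t (- 1))) * (phi_elt t 1 i (r + r') - phi_elt t (- 1) i (r + r'))) (vec m 1)"
  using M_cases[OF m i]
proof
  assume u: "\<forall>l. uexp m i l = 0"
  from not_single_at_zero[OF this, of 1]
  have "\<nexists>l. single_at m i (- 1) l" "\<nexists>l. single_at m i (- (- 1)) l"
    by auto
  then show ?thesis
    unfolding act_phi_difference_zero[OF m i u]
    by (simp add: commutator_def free_act_diff free_act_mult act_gx_zero)
next
  assume "\<exists>c\<in>{1, - 1}. \<exists>l. single_at m i c l"
  then obtain c l where c: "c \<in> {1, - 1}" and l: "single_at m i c l"
    by blast
  show ?thesis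
    unfolding act_phi_difference_single[OF m i c l]
    using c act_gx_opposite_same[OF m i c l]
    by (auto simp: commutator_def free_act_diff free_act_mult single_uminus add.commute)
qed

lemma act_relation:
  assumes a: "a \<in> toroidal_relations n t" and m: "m \<in> M"
  shows "act a (vec m 1) = 0"
proof -
  note mult = commutator_def free_act_diff free_act_add free_act_mult act_cst
  from a consider "a \<in> relations_k n" | "a \<in> relations_kh n" | "a \<in> relations_kx n t"
    | "a \<in> relations_hx n t" | "a \<in> relations_xx_opposite n t" | "a \<in> relations_xx n t"
    | "a \<in> relations_serre n t" | "a \<in> relations_commute n"
    unfolding toroidal_relations_def by blast
  then show ?thesis
  proof cases
    case 1
    then show ?thesis
      by (auto simp: relations_k_def mult act_gk pairing_add_right qpow_add mult_ac)
  next
    case 2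
    then show ?thesis
      by (auto simp: relations_kh_def mult act_gk act_gh mult_ac)
  next
    case 3
    then obtain h \<epsilon> j r where a: "a = gk h * gx \<epsilon> j r * gk (- h)
        - cst (qpow t (of_int \<epsilon> * pairing (alpha n j) h)) * gx \<epsilon> j r" and \<epsilon>: "\<epsilon> \<in> {1, - 1}"
      by (auto simp: relations_kx_def)
    show ?thesis
    proof (rule act_gx_cases[OF \<epsilon>, of m j])
      fix l assume "single_at m j (- \<epsilon>) l"
        and x: "\<And>r c. act (gx \<epsilon> j r) (vec m c) = vec (move n \<epsilon> j l m) (c * qz t (r * (l - \<epsilon>)))"
      show ?thesis
        by (simp add: a mult act_gk x pairing_wgt_move[OF \<epsilon>] pairing_uminus_right qpow_add qpow_minus field_simps)
    qed (simp add: a mult act_gk)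
  next
    case 4
    then obtain i k \<epsilon> j r where a: "a = commutator (gh i k) (gx \<epsilon> j r)
        - cst (of_int \<epsilon> * (1 / of_int k) * qint t (k * cartan_mat n i j)) * gx \<epsilon> j (k + r)"
      and ij: "i \<le> n" "j \<le> n" and k: "k \<noteq> 0" and \<epsilon>: "\<epsilon> \<in> {1, - 1}"
      unfolding relations_hx_def by fastforce
    show ?thesis
    proof (rule act_gx_cases[OF \<epsilon>, of m j])
      fix l assume "single_at m j (- \<epsilon>) l"
        and x: "\<And>r c. act (gx \<epsilon> j r) (vec m c) = vec (move n \<epsilon> j l m) (c * qz t (r * (l - \<epsilon>)))"
      define H A where "H = uexp_sum (\<lambda>l. qz t (k * l)) m i"
        and "A = uexp_sum (\<lambda>l. qz t (k * l)) (Amon n j (l - \<epsilon>)) i"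
      define q\<^sub>1 q\<^sub>2 where "q\<^sub>1 = qz t (r * (l - \<epsilon>))" and "q\<^sub>2 = qz t (k * (l - \<epsilon>))"
      have q: "qz t ((k + r) * (l - \<epsilon>)) = q\<^sub>1 * q\<^sub>2"
        unfolding q\<^sub>1_def q\<^sub>2_def qz_add[symmetric] by (simp add: algebra_simps)
      have A: "qint t (k * cartan_mat n i j) * q\<^sub>2 = qint t k * A"
        using qint_uexp_sum_Amon[OF n_ge_2 ij, of t k "l - \<epsilon>"] by (simp add: A_def q\<^sub>2_def)
      have "act a (vec m 1) = vec (move n \<epsilon> j l m) (q\<^sub>1 * (qint t k / of_int k * (H + of_int \<epsilon> * A))
          - qint t k / of_int k * H * q\<^sub>1
          - of_int \<epsilon> * (1 / of_int k) * qint t (k * cartan_mat n i j) * (q\<^sub>1 * q\<^sub>2))"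
        by (simp add: a mult act_gh x q uexp_sum_move[OF \<epsilon>] single_diff H_def A_def q\<^sub>1_def)
      also have "q\<^sub>1 * (qint t k / of_int k * (H + of_int \<epsilon> * A)) - qint t k / of_int k * H * q\<^sub>1
          - of_int \<epsilon> * (1 / of_int k) * qint t (k * cartan_mat n i j) * (q\<^sub>1 * q\<^sub>2)
        = of_int \<epsilon> * (1 / of_int k) * q\<^sub>1 * (qint t k * A - qint t (k * cartan_mat n i j) * q\<^sub>2)"
        by (simp add: distrib_left right_diff_distrib add_divide_distrib mult_ac)
      finally show ?thesis
        by (simp add: A)
    qed (simp add: a mult act_gh)
  next
    case 5
    then obtain i j r r' where a: "a = commutator (gx 1 i r) (gx (- 1) j r')
        - (if i = j then cst (1 / (qpow t 1 - qpow t (- 1))) *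
             (phi_elt t 1 i (r + r') - phi_elt t (- 1) i (r + r')) else 0)" and ij: "i \<le> n" "j \<le> n"
      by (auto simp: relations_xx_opposite_def)
    consider "i = j" | "i \<noteq> j" "adjacent n i j" | "i \<noteq> j" "\<not> adjacent n i j" by blast
    then show ?thesis
    proof cases
      case 1
      then show ?thesis
        using relation_xx_opposite_same[OF m ij(1), of r r'] by (simp add: a free_act_diff)
    next
      case 2
      then show ?thesis
        using gx_gx_adjacent_opposite[OF m ij, of "- 1"] gx_gx_adjacent_opposite[OF m ij(2,1), of 1]
          adjacent_sym[OF ij(1)]
        by (simp add: a mult)
    next
      case 3
      then show ?thesis
        using gx_gx_far[OF ij, of 1 "- 1"] by (simp add: a mult)
    qed
  next
    case 6
    then obtain \<epsilon> i j r r' c where a: "a = (gx \<epsilon> i (r + 1) * gx \<epsilon> j r' - cst c * (gx \<epsilon> j r' * gx \<epsilon> i (r + 1)))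
        - (cst c * (gx \<epsilon> i r * gx \<epsilon> j (r' + 1)) - gx \<epsilon> j (r' + 1) * gx \<epsilon> i r)"
      and \<epsilon>: "\<epsilon> \<in> {1, - 1}" and ij: "i \<le> n" "j \<le> n" and c: "c = qz t (\<epsilon> * cartan_mat n i j)"
      unfolding relations_xx_def qpow_of_int atLeastAtMost_iff by blast
    consider "i = j" | "i \<noteq> j" "adjacent n i j" | "i \<noteq> j" "\<not> adjacent n i j" by blast
    then show ?thesis
    proof cases
      case 1
      then show ?thesis
        by (simp add: a mult gx_gx_same[OF ij(2) \<epsilon>])
    next
      case 2
      then have "c = qz t (- \<epsilon>)"
        by (simp add: c cartan_mat_eq)
      then show ?thesis
        using gx_gx_adjacent[OF m ij 2(2) \<epsilon>, of r r' 1]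
          gx_gx_adjacent[OF m ij(2,1) adjacent_sym[OF ij(1) 2(2)] \<epsilon>, of r' r 1]
        by (simp add: a mult)
    next
      case 3
      then have "c = 1"
        by (simp add: c cartan_mat_eq)
      then show ?thesis
        using gx_gx_far[OF ij 3 \<epsilon> \<epsilon>] by (simp add: a mult)
    qed
  next
    case 7
    then obtain \<epsilon> i j r\<^sub>1 r\<^sub>2 r' where a: "a = serre_elt t \<epsilon> i j r\<^sub>1 r\<^sub>2 r' + serre_elt t \<epsilon> i j r\<^sub>2 r\<^sub>1 r'"
      and \<epsilon>: "\<epsilon> \<in> {1, - 1}" and i: "i \<le> n" and adj: "adjacent n i j"
      unfolding relations_serre_def adjacent_def by fastforce
    have iij: "act (gx \<epsilon> i r) (act (gx \<epsilon> i r') (act (gx \<epsilon> j r'') (vec m 1))) = 0" for r r' r''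
      by (rule act_gx_cases[OF \<epsilon>, of m j]) (simp_all add: gx_gx_same[OF i \<epsilon>])
    show ?thesis
      by (simp add: a serre_elt_def mult iij gx_gx_same[OF i \<epsilon>]
          gx_gx_gx_alternating[OF m i adjacent_le[OF adj] adj \<epsilon>])
  next
    case 8
    then obtain \<epsilon> i j r\<^sub>1 r\<^sub>2 where a: "a = commutator (gx \<epsilon> i r\<^sub>1) (gx \<epsilon> j r\<^sub>2)"
      and \<epsilon>: "\<epsilon> \<in> {1, - 1}" and ij: "i \<le> n" "j \<le> n" "i \<noteq> j" "\<not> adjacent n j i"
      unfolding relations_commute_def adjacent_def by fastforce
    then show ?thesis
      using gx_gx_far[OF ij(2,1) _ ij(4) \<epsilon> \<epsilon>] by (simp add: mult)
  qed
qed

lemma minuscule_act_preserves: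
  assumes "g \<in> gens n" "m \<in> M"
  shows "minuscule_act n t g m \<in> supported_on M"
  using assms(1) unfolding gens_def
proof (elim UnE CollectE exE conjE)
  fix \<epsilon> i r assume g: "g = XG \<epsilon> i r" and \<epsilon>: "\<epsilon> \<in> {1, - 1}" and i: "i \<in> {0..n}"
  have "minuscule_act n t g m = act (gx \<epsilon> i r) (vec m 1)"
    by (simp add: g gx_def free_act_single)
  also have "\<dots> \<in> supported_on M"
    using \<epsilon>
  proof (cases rule: act_gx_cases[of \<epsilon> m i])
    case zero
    then show ?thesis by (simp add: supported_on_def)
  next
    case (move l)
    then show ?thesis
      using M_move[OF assms(2) _ \<epsilon>, of i l] i by (auto intro: single_in_supported_on)
  qed
  finally show ?thesis .
qed (use assms(2) in \<open>auto intro: single_in_supported_on\<close>)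

sublocale generator_action n t M "minuscule_act n t"
  by unfold_locales (auto intro: minuscule_act_preserves act_relation)

end

section \<open>Weight spaces, \<open>l\<close>-weight spaces and joint eigenspaces\<close>

lemma dim_supported_on_singleton: "vs.dim (supported_on {m}) = 1"
proof -
  have "Poly_Mapping.single m (1 :: complex) \<noteq> 0"
    by (metis lookup_single_eq lookup_zero zero_neq_one)
  then have "vs.independent {Poly_Mapping.single m 1}"
    by (simp add: vs.dependent_single)
  then have "vs.dim (vs.span {Poly_Mapping.single m 1}) = 1"
    by (subst vs.dim_span_eq_card_independent) simp_all
  then show ?thesis
    using span_single_eq_supported_on[of "{m}"] by (metis image_empty image_insert)
qed

lemma dim_zero_space: "vs.dim {0} = 0"
proof -
  have "vs.dim (vs.span {}) = 0"
    by (subst vs.dim_span_eq_card_independent) (simp_all add: vs.independent_empty)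
  then show ?thesis by simp
qed

lemma supported_on_empty [simp]: "supported_on {} = {0}"
  by (auto simp: supported_on_def)

context generator_action
begin

text \<open>Weights and \<open>l\<close>-weights both decompose the space along a labelling of its basis.\<close>

lemma direct_sum_of_labels:
  assumes lab: "\<And>m. m \<in> M \<Longrightarrow> lab m \<in> J"
    and W: "\<And>j. j \<in> J \<Longrightarrow> W j = supported_on {m \<in> M. lab m = j}"
  shows "direct_sum_of J W"
  unfolding direct_sum_of_def
proof (intro conjI allI impI)
  show "\<forall>j\<in>J. vs.subspace (W j)"
    by (simp add: W subspace_supported_on)
  show "vs.span (\<Union>j\<in>J. W j) = supported_on M"
  proof
    show "vs.span (\<Union>j\<in>J. W j) \<subseteq> supported_on M"
      by (rule vs.span_minimal) (auto simp: W subspace_supported_on, auto simp: supported_on_def)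
    have "(\<lambda>m. Poly_Mapping.single m 1) ` M \<subseteq> (\<Union>j\<in>J. W j)"
      using lab by (auto simp: W intro!: bexI[of _ "lab _"] single_in_supported_on)
    then show "supported_on M \<subseteq> vs.span (\<Union>j\<in>J. W j)"
      unfolding span_single_eq_supported_on[symmetric] by (rule vs.span_mono)
  qed
  fix F w
  assume *: "finite F \<and> F \<subseteq> J \<and> (\<forall>j\<in>F. w j \<in> W j) \<and> (\<Sum>j\<in>F. w j) = 0"
  show "\<forall>j\<in>F. w j = 0"
  proof
    fix j assume j: "j \<in> F"
    show "w j = 0"
    proof (rule poly_mapping_eqI)
      fix m
      have other: "Poly_Mapping.lookup (w j') m = 0" if "j' \<in> F" "j' \<noteq> lab m" for j'
      proof -
        have "w j' \<in> supported_on {m \<in> M. lab m = j'}"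
          using * that(1) W[of j'] by blast
        then have "m \<notin> Poly_Mapping.keys (w j')"
          using that(2) by (auto simp: supported_on_def)
        then show ?thesis
          by (simp add: in_keys_iff)
      qed
      have "0 = Poly_Mapping.lookup (\<Sum>j\<in>F. w j) m"
        using * by simp
      also have "\<dots> = (\<Sum>j\<in>F. Poly_Mapping.lookup (w j) m)"
        by (rule lookup_sum)
      also have "\<dots> = (if lab m \<in> F then Poly_Mapping.lookup (w (lab m)) m else 0)"
        using * other by (subst sum.mono_neutral_right[of F "F \<inter> {lab m}"]) auto
      finally show "Poly_Mapping.lookup (w j) m = Poly_Mapping.lookup 0 m"
        using j other[of j] by (auto split: if_splits)
    qed
  qed
qed

lemma lookup_quot_act_diagonal:
  assumes a: "a \<in> toroidal_free n" and c: "\<And>m. m \<in> M \<Longrightarrow> eigen G m a (c m)" and v: "v \<in> supported_on M"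
  shows "Poly_Mapping.lookup (quot_act G (cls n t a) v) m = c m * Poly_Mapping.lookup v m"
proof -
  have "quot_act G (cls n t a) v = lin_ext (\<lambda>m. free_act G a (Poly_Mapping.single m 1)) v"
    using quot_act_cls[OF a v] free_act_eq_lin_ext by metis
  also have "\<dots> = lin_ext (\<lambda>m. Poly_Mapping.single m (c m)) v"
    by (rule lin_ext_cong) (use c v in \<open>auto simp: supported_on_def eigen_def\<close>)
  finally show ?thesis
    by (simp add: lookup_lin_ext_diagonal)
qed

lemma quot_act_eigenvector_iff:
  assumes a: "a \<in> toroidal_free n" and c: "\<And>m. m \<in> M \<Longrightarrow> eigen G m a (c m)" and v: "v \<in> supported_on M"
  shows "quot_act G (cls n t a) v = vscale d v \<longleftrightarrow> (\<forall>m\<in>Poly_Mapping.keys v. c m = d)"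
proof -
  have "Poly_Mapping.lookup (quot_act G (cls n t a) v) m = c m * Poly_Mapping.lookup v m" for m
    by (rule lookup_quot_act_diagonal[OF a c v])
  then show ?thesis
    by (auto simp: poly_mapping_eq_iff fun_eq_iff in_keys_iff)
qed

text \<open>Elements that act diagonally on the basis form a subalgebra, so it is enough to inspect the
  generators.\<close>

lemma cartan_subalgebra_diagonal:
  assumes gk: "\<And>h m. h \<in> cartan_space n \<Longrightarrow> m \<in> M \<Longrightarrow> \<exists>c. eigen G m (gk h) c"
    and gh: "\<And>i k m. i \<le> n \<Longrightarrow> k \<noteq> 0 \<Longrightarrow> m \<in> M \<Longrightarrow> \<exists>c. eigen G m (gh i k) c"
    and A: "A \<in> cartan_subalgebra n t"
  shows "\<exists>a c. a \<in> toroidal_free n \<and> A = cls n t a \<and> (\<forall>m\<in>M. eigen G m a (c m))"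
proof -
  have "\<exists>a. a \<in> toroidal_free n \<and> A = cls n t a \<and> (\<forall>m\<in>M. \<exists>c. eigen G m a c)"
    using A unfolding cartan_subalgebra_def
  proof (induction A rule: generate_ring.induct)
    case one
    show ?case
      by (intro exI[of _ 1] conjI ballI exI[of _ 1] cls_one free_algebra_one_closed eigen_1)
  next
    case (incl A)
    then consider c where "A = cls n t (cst c)"
      | h where "A = cls n t (gk h)" "h \<in> cartan_space n"
      | i k where "A = cls n t (gh i k)" "i \<le> n" "k \<noteq> 0"
      by auto
    then show ?case
    proof cases
      case 1
      then show ?thesis
        by (intro exI[of _ "cst c"] conjI ballI cst_closed exI[of _ c] eigen_cst)
    next
      case 2
      then show ?thesis
        by (intro exI[of _ "gk h"] conjI ballI gk_closed gk)
    next
      case 3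
      then show ?thesis
        by (intro exI[of _ "gh i k"] conjI ballI gh_closed gh)
    qed
  next
    case (a_inv A)
    then obtain a where a: "a \<in> toroidal_free n" "A = cls n t a" "\<forall>m\<in>M. \<exists>c. eigen G m a c"
      by blast
    then have "\<forall>m\<in>M. \<exists>c. eigen G m (- a) c"
      by (metis eigen_uminus)
    then show ?case
      unfolding a(2) cls_uminus[OF a(1)]
      by (intro exI[of _ "- a"] conjI refl free_algebra_uminus_closed a(1))
  next
    case (eng_add A B)
    then obtain a b where a: "a \<in> toroidal_free n" "A = cls n t a" "\<forall>m\<in>M. \<exists>c. eigen G m a c"
      and b: "b \<in> toroidal_free n" "B = cls n t b" "\<forall>m\<in>M. \<exists>c. eigen G m b c"
      by blast
    then have "\<forall>m\<in>M. \<exists>c. eigen G m (a + b) c"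
      by (metis eigen_add)
    then show ?case
      unfolding a(2) b(2) cls_add[OF a(1) b(1)]
      by (intro exI[of _ "a + b"] conjI refl free_algebra_add_closed a(1) b(1))
  next
    case (eng_mult A B)
    then obtain a b where a: "a \<in> toroidal_free n" "A = cls n t a" "\<forall>m\<in>M. \<exists>c. eigen G m a c"
      and b: "b \<in> toroidal_free n" "B = cls n t b" "\<forall>m\<in>M. \<exists>c. eigen G m b c"
      by blast
    then have "\<forall>m\<in>M. \<exists>c. eigen G m (a * b) c"
      by (metis eigen_mult)
    then show ?case
      unfolding a(2) b(2) cls_mult[OF a(1) b(1)]
      by (intro exI[of _ "a * b"] conjI refl free_algebra_mult_closed a(1) b(1))
  qed
  then show ?thesis
    by metis
qed

end

context minuscule_set
begin

lemma weight_space_eq: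
  assumes \<nu>: "\<nu> \<in> weight_lattice n"
  shows "weight_space \<nu> = supported_on {m \<in> M. wgt m = \<nu>}"
proof -
  have wgt: "wgt m = \<nu> \<longleftrightarrow> (\<forall>h\<in>cartan_space n. qpow t (pairing (wgt m) h) = qpow t (pairing \<nu> h))"
    if "m \<in> M" for m
    using weight_lattice_eqI[OF _ \<nu>, of "wgt m"] that M_monomials by (auto simp: monomials_def)
  have "v \<in> weight_space \<nu> \<longleftrightarrow> v \<in> supported_on {m \<in> M. wgt m = \<nu>}" for v
  proof -
    have "v \<in> weight_space \<nu> \<longleftrightarrow> v \<in> supported_on M \<and>
        (\<forall>h\<in>cartan_space n. \<forall>m\<in>Poly_Mapping.keys v. qpow t (pairing (wgt m) h) = qpow t (pairing \<nu> h))"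
      using quot_act_eigenvector_iff[OF gk_closed eigen_gk, of _ v] unfolding weight_space_def by blast
    also have "\<dots> \<longleftrightarrow> v \<in> supported_on M \<and> (\<forall>m\<in>Poly_Mapping.keys v. wgt m = \<nu>)"
      using wgt unfolding supported_on_def by blast
    finally show ?thesis
      unfolding supported_on_def by blast
  qed
  then show ?thesis by blast
qed

text \<open>Moves cannot be repeated, so the squares of the raising and lowering operators vanish.\<close>

lemma integrable: integrable
  unfolding integrable_def
proof (intro conjI ballI)
  show "direct_sum_of (weight_lattice n) weight_space"
    by (rule direct_sum_of_labels[of wgt])
       (use M_monomials weight_space_eq in \<open>auto simp: monomials_def\<close>)
  fix \<epsilon> :: int and i and v
  assume \<epsilon>: "\<epsilon> \<in> {1, - 1}" and i: "i \<in> {0..n}" and v: "v \<in> supported_on M"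
  have x: "gx \<epsilon> i 0 \<in> toroidal_free n"
    using \<epsilon> i by (intro gx_closed) auto
  have "quot_act (minuscule_act n t) (cls n t (gx \<epsilon> i 0)) (quot_act (minuscule_act n t) (cls n t (gx \<epsilon> i 0)) v)
      = act (gx \<epsilon> i 0 * gx \<epsilon> i 0) v"
    using x v act_closed[OF cls_in_carrier[OF x] v] by (simp add: quot_act_cls free_act_mult)
  also have "\<dots> = 0"
  proof -
    have "act (gx \<epsilon> i 0 * gx \<epsilon> i 0) (vec m 1) = 0" for m
      using gx_gx_same[OF _ \<epsilon>, of i] i by (simp add: free_act_mult)
    then show ?thesis
      using free_act_eq_lin_ext[of "minuscule_act n t" "gx \<epsilon> i 0 * gx \<epsilon> i 0" v] by (simp add: lin_ext_def)
  qed
  finally show "\<exists>N. (quot_act (minuscule_act n t) (cls n t (gx \<epsilon> i 0)) ^^ N) v = 0"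
    by (intro exI[of _ 2]) (simp add: numeral_2_eq_2)
qed

text \<open>The currents are diagonal, so generalised eigenvectors are eigenvectors; the weight and the
  expansions at \<open>z = 0\<close> then identify the monomial.\<close>

lemma l_weight_space_eq:
  assumes m': "m' \<in> monomials n"
  shows "l_weight_space m' = supported_on (M \<inter> {m'})"
proof -
  have wt: "wgt m' \<in> weight_lattice n"
    using m' by (simp add: monomials_def)
  define F where "F \<epsilon> i k = (\<lambda>w. quot_act (minuscule_act n t) (cls n t (phi_elt t \<epsilon> i (\<epsilon> * int k))) w
      - vscale (fps_nth (l_weight_series t \<epsilon> i m') k) w)" for \<epsilon> i k
  have l_weight_space: "v \<in> l_weight_space m' \<longleftrightarrow> v \<in> weight_space (wgt m') \<and>
      (\<forall>i\<in>{0..n}. \<forall>\<epsilon>\<in>{1, - 1}. \<forall>k. \<exists>N. (F \<epsilon> i k ^^ N) v = 0)" for v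
    unfolding l_weight_space_def F_def by blast
  have F: "Poly_Mapping.lookup ((F \<epsilon> i k ^^ N) v) m
      = (fps_nth (l_weight_series t \<epsilon> i m) k - fps_nth (l_weight_series t \<epsilon> i m') k) ^ N
        * Poly_Mapping.lookup v m"
    if i: "i \<le> n" and \<epsilon>: "\<epsilon> \<in> {1, - 1}" and v: "v \<in> supported_on M" for \<epsilon> i k N v m
  proof (induction N)
    case (Suc N)
    have phi: "phi_elt t \<epsilon> i (\<epsilon> * int k) \<in> toroidal_free n"
      using \<epsilon> i by (rule phi_elt_closed)
    have "(F \<epsilon> i k ^^ N) v \<in> supported_on M"
    proof (induction N)
      case (Suc N)
      then show ?case
        unfolding funpow.simps comp_apply F_def
        by (intro vs.subspace_diff[OF subspace_supported_on] vs.subspace_scale[OF subspace_supported_on]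
            act_closed[OF cls_in_carrier[OF phi]])
    qed (simp add: v)
    from lookup_quot_act_diagonal[OF phi eigen_phi[OF _ i \<epsilon>] this, of m] Suc.IH show ?case
      by (simp add: F_def lookup_minus algebra_simps)
  qed simp
  show ?thesis
  proof (intro equalityI subsetI)
    fix v assume v: "v \<in> l_weight_space m'"
    then have v': "v \<in> supported_on {m \<in> M. wgt m = wgt m'}"
      by (simp add: l_weight_space weight_space_eq[OF wt])
    then have vM: "v \<in> supported_on M"
      by (auto simp: supported_on_def)
    have "m = m'" if m: "m \<in> Poly_Mapping.keys v" for m
    proof (rule monomials_eqI)
      show "m \<in> monomials n" "wgt m = wgt m'"
        using m v' M_monomials by (auto simp: supported_on_def)
      fix i l assume i: "i \<le> n"
      have "fps_nth (l_weight_series t 1 i m) k = fps_nth (l_weight_series t 1 i m') k" for k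
      proof -
        obtain N where "(F 1 i k ^^ N) v = 0"
          using v i unfolding l_weight_space by fastforce
        then have "(fps_nth (l_weight_series t 1 i m) k - fps_nth (l_weight_series t 1 i m') k) ^ N
            * Poly_Mapping.lookup v m = 0"
          using F[OF i _ vM, of 1 N k m] by simp
        then show ?thesis
          using m by (auto simp: in_keys_iff)
      qed
      then have "l_weight_series t 1 i m = l_weight_series t 1 i m'"
        by (rule fps_ext)
      then show "uexp m i l = uexp m' i l"
        by (rule l_weight_series_determines_uexp)
    qed (rule m')
    then show "v \<in> supported_on (M \<inter> {m'})"
      using vM unfolding supported_on_def by blast
  next
    fix v assume v: "v \<in> supported_on (M \<inter> {m'})"
    then have "v \<in> supported_on {m \<in> M. wgt m = wgt m'}" and vM: "v \<in> supported_on M"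
      by (auto simp: supported_on_def)
    then have "v \<in> weight_space (wgt m')"
      by (simp only: weight_space_eq[OF wt])
    moreover have "(F \<epsilon> i k ^^ 1) v = 0" if "i \<le> n" "\<epsilon> \<in> {1, - 1}" for \<epsilon> i k
    proof (rule poly_mapping_eqI)
      fix m
      show "Poly_Mapping.lookup ((F \<epsilon> i k ^^ 1) v) m = Poly_Mapping.lookup 0 m"
        unfolding F[OF that vM] using v by (cases "m = m'") (auto simp: supported_on_def in_keys_iff)
    qed
    ultimately show "v \<in> l_weight_space m'"
      unfolding l_weight_space by (meson atLeastAtMost_iff)
  qed
qed

lemma has_q_character: "has_q_character (\<lambda>m. if m \<in> M then 1 else 0)"
  unfolding has_q_character_def
proof (intro conjI ballI allI)
  show "direct_sum_of (monomials n) l_weight_space"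
  proof (rule direct_sum_of_labels)
    show "id m \<in> monomials n" if "m \<in> M" for m
      using that M_monomials by auto
    show "l_weight_space m' = supported_on {m \<in> M. id m = m'}" if "m' \<in> monomials n" for m'
      unfolding l_weight_space_eq[OF that] by (rule arg_cong[where f = supported_on]) auto
  qed
  fix m
  show "\<exists>B. finite B \<and> l_weight_space m \<subseteq> vs.span B" if "m \<in> monomials n"
    by (rule exI[of _ "(\<lambda>m. vec m 1) ` (M \<inter> {m})"])
       (simp add: l_weight_space_eq[OF that] span_single_eq_supported_on)
  show "(if m \<in> M then 1 else 0) = (if m \<in> monomials n then vs.dim (l_weight_space m) else 0)"
    using M_monomials by (auto simp: l_weight_space_eq dim_supported_on_singleton dim_zero_space simp del: vs.dim_span)
qed

text \<open>The weight and the eigenvalues of the diagonal generators determine a monomial, so two basis vectors never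
  share a joint eigenvalue.\<close>

lemma thin: thin
  unfolding thin_def
proof (intro conjI allI impI)
  have diagonal: "\<exists>a c. a \<in> toroidal_free n \<and> A = cls n t a \<and>
      (\<forall>m\<in>M. eigen (minuscule_act n t) m a (c m))" if "A \<in> cartan_subalgebra n t" for A
    by (rule cartan_subalgebra_diagonal[OF _ _ that]) (use eigen_gk eigen_gh in blast)+
  show weighted
    unfolding weighted_def
  proof
    fix A assume "A \<in> cartan_subalgebra n t"
    then obtain a c where a: "a \<in> toroidal_free n" "A = cls n t a"
      and c: "\<And>m. m \<in> M \<Longrightarrow> eigen (minuscule_act n t) m a (c m)"
      using diagonal by blast
    let ?E = "{v \<in> supported_on M. \<exists>c. quot_act (minuscule_act n t) A v = vscale c v}"
    have "vec m 1 \<in> ?E" if "m \<in> M" for m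
      using quot_act_eigenvector_iff[OF a(1) c, of "vec m 1" "c m"] single_in_supported_on[OF that]
      unfolding a(2) by force
    then have "(\<lambda>m. vec m 1) ` M \<subseteq> ?E" by blast
    then show "vs.span ?E = supported_on M"
      using vs.span_mono[of "(\<lambda>m. vec m 1) ` M" ?E] span_single_eq_supported_on[of M]
        vs.span_minimal[of ?E "supported_on M"] subspace_supported_on by blast
  qed
  fix \<chi> assume ne: "joint_eigenspace \<chi> \<noteq> {0}"
  have "0 \<in> joint_eigenspace \<chi>"
    unfolding joint_eigenspace_def
  proof (intro CollectI conjI ballI)
    show zero: "0 \<in> supported_on M"
      by (simp add: supported_on_def)
    fix A assume "A \<in> cartan_subalgebra n t"
    then obtain a c where a: "a \<in> toroidal_free n" "A = cls n t a"
      using diagonal by blast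
    show "quot_act (minuscule_act n t) A 0 = vscale (\<chi> A) 0"
      using a zero by (simp add: quot_act_cls)
  qed
  with ne obtain v where v: "v \<in> joint_eigenspace \<chi>" "v \<noteq> 0"
    by blast
  then have vM: "v \<in> supported_on M" and v_eigen: "\<And>A. A \<in> cartan_subalgebra n t \<Longrightarrow>
      quot_act (minuscule_act n t) A v = vscale (\<chi> A) v"
    by (simp_all add: joint_eigenspace_def)
  obtain m where m: "m \<in> Poly_Mapping.keys v"
    using v(2) by (metis ex_in_conv keys_eq_empty)
  have mM: "m \<in> M"
    using m vM by (auto simp: supported_on_def)
  have "joint_eigenspace \<chi> = supported_on {m}"
  proof (intro equalityI subsetI)
    fix w assume "w \<in> joint_eigenspace \<chi>"
    then have wM: "w \<in> supported_on M" and w_eigen: "\<And>A. A \<in> cartan_subalgebra n t \<Longrightarrow>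
      quot_act (minuscule_act n t) A w = vscale (\<chi> A) w"
      by (simp_all add: joint_eigenspace_def)
    have "m' = m" if m': "m' \<in> Poly_Mapping.keys w" for m'
    proof (rule monomials_eqI)
      have m'M: "m' \<in> M"
        using m' wM by (auto simp: supported_on_def)
      then show mm: "m \<in> monomials n" "m' \<in> monomials n"
        using mM M_monomials by auto
      have "pairing (wgt m') h = pairing (wgt m) h" if h: "h \<in> cartan_space n" for h
      proof -
        have "cls n t (gk h) \<in> cartan_subalgebra n t"
          unfolding cartan_subalgebra_def by (rule generate_ring.incl) (use h in blast)
        note A = v_eigen[OF this] w_eigen[OF this]
        from A m m' show ?thesis
          unfolding quot_act_eigenvector_iff[OF gk_closed[OF h] eigen_gk vM]
            quot_act_eigenvector_iff[OF gk_closed[OF h] eigen_gk wM]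
          by (metis qpow_eq_iff)
      qed
      then show "wgt m' = wgt m"
        using mm by (intro weight_lattice_eqI[of _ n]) (auto simp: monomials_def)
      fix i l assume i: "i \<le> n"
      show "uexp m' i l = uexp m i l"
      proof (rule uexp_eqI)
        fix k :: nat assume k: "k \<ge> 1"
        then have k0: "int k \<noteq> 0" by simp
        have "cls n t (gh i (int k)) \<in> cartan_subalgebra n t"
          unfolding cartan_subalgebra_def by (rule generate_ring.incl) (use i k0 in force)
        note A = v_eigen[OF this] w_eigen[OF this]
        have "qint t (int k) / of_int (int k) * uexp_sum (\<lambda>l. qz t (int k * l)) m' i
          = qint t (int k) / of_int (int k) * uexp_sum (\<lambda>l. qz t (int k * l)) m i"
          using A m m'
          unfolding quot_act_eigenvector_iff[OF gh_closed[OF i k0] eigen_gh vM]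
            quot_act_eigenvector_iff[OF gh_closed[OF i k0] eigen_gh wM]
          by metis
        moreover have "qint t (int k) \<noteq> 0"
          using k by (simp add: qint_qz)
        ultimately show "uexp_sum (\<lambda>l. qz t (int k * l)) m' i = uexp_sum (\<lambda>l. qz t (int k * l)) m i"
          using k by simp
      qed
    qed
    then show "w \<in> supported_on {m}"
      by (auto simp: supported_on_def)
  next
    fix w assume w: "w \<in> supported_on {m}"
    then have wM: "w \<in> supported_on M"
      using mM by (auto simp: supported_on_def)
    have "quot_act (minuscule_act n t) A w = vscale (\<chi> A) w" if A: "A \<in> cartan_subalgebra n t" for A
    proof -
      obtain a c where a: "a \<in> toroidal_free n" "A = cls n t a"
        and c: "\<And>m. m \<in> M \<Longrightarrow> eigen (minuscule_act n t) m a (c m)"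
        using diagonal A by blast
      have "c m = \<chi> A"
        using v_eigen[OF A] m quot_act_eigenvector_iff[OF a(1) c vM, of "\<chi> A"] by (simp add: a(2))
      moreover have "\<forall>m'\<in>Poly_Mapping.keys w. m' = m"
        using w by (auto simp: supported_on_def)
      ultimately show ?thesis
        using quot_act_eigenvector_iff[OF a(1) c wM, of "\<chi> A"] by (auto simp: a(2))
    qed
    with wM show "w \<in> joint_eigenspace \<chi>"
      by (simp add: joint_eigenspace_def)
  qed
  then show "vs.dim (joint_eigenspace \<chi>) = 1"
    by (simp add: dim_supported_on_singleton)
qed

end

section \<open>Kashiwara operators as moves\<close>

lemma crystal_operators_zero:
  assumes "\<forall>l. uexp m i l = 0"
  shows "f_op n i m = None" "e_op n i m = None"
proof -
  have "usupp m i = {}"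
    using assms by (simp add: usupp_def)
  then have "phi_part m i = (\<lambda>_. 0)" "eps_part m i = (\<lambda>_. 0)"
    by (auto simp: phi_part_def eps_part_def)
  then show "f_op n i m = None" "e_op n i m = None"
    by (simp_all add: f_op_def phi_max_def e_op_def eps_max_def)
qed

lemma parts_single_at:
  assumes "single_at m i c l" "c \<noteq> 0"
  shows "phi_part m i L = (if l \<le> L then c else 0)" "eps_part m i L = (if L \<le> l then - c else 0)"
proof -
  have u: "usupp m i = {l}" "uexp m i l = c"
    using assms by (auto simp: usupp_def single_at_def)
  have "{l'. l' \<in> usupp m i \<and> l' \<le> L} = (if l \<le> L then {l} else {})"
    "{l'. l' \<in> usupp m i \<and> l' \<ge> L} = (if L \<le> l then {l} else {})"
    by (auto simp: u(1))
  then show "phi_part m i L = (if l \<le> L then c else 0)" "eps_part m i L = (if L \<le> l then - c else 0)"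
    by (simp_all add: phi_part_def eps_part_def u(2))
qed

lemma Max_range_two_values:
  fixes c :: int
  assumes "\<And>x. f x = 0 \<or> f x = c" "f a = 0" "f b = c"
  shows "Max (range f) = max 0 c"
proof -
  have "range f = {0, c}"
    using assms rangeI[of f a] rangeI[of f b] by auto
  then show ?thesis by simp
qed

lemma maxima_single_at:
  assumes "single_at m i c l" "c \<noteq> 0"
  shows "phi_max m i = max 0 c" "eps_max m i = max 0 (- c)"
proof -
  show "phi_max m i = max 0 c"
    unfolding phi_max_def
    by (rule Max_range_two_values[of _ _ "l - 1" l]) (simp_all add: parts_single_at[OF assms])
  show "eps_max m i = max 0 (- c)"
    unfolding eps_max_def
    by (rule Max_range_two_values[of _ _ "l + 1" l]) (simp_all add: parts_single_at[OF assms])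
qed

lemma crystal_operators_pos:
  assumes "single_at m i 1 l"
  shows "f_op n i m = Some (move n (- 1) i l m)" "e_op n i m = None"
proof -
  have "q_pos m i = l"
    unfolding q_pos_def
    by (rule Least_equality) (use assms in \<open>auto simp: parts_single_at[OF assms] maxima_single_at[OF assms] split: if_splits\<close>)
  then show "f_op n i m = Some (move n (- 1) i l m)" "e_op n i m = None"
    using maxima_single_at[OF assms] by (simp_all add: f_op_def e_op_def move_def)
qed

lemma crystal_operators_neg:
  assumes "single_at m i (- 1) l"
  shows "e_op n i m = Some (move n 1 i l m)" "f_op n i m = None"
proof -
  have "p_pos m i = l"
    unfolding p_pos_def
    by (rule Greatest_equality) (use assms in \<open>auto simp: parts_single_at[OF assms] maxima_single_at[OF assms] split: if_splits\<close>)
  then show "e_op n i m = Some (move n 1 i l m)" "f_op n i m = None"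
    using maxima_single_at[OF assms] by (simp_all add: f_op_def e_op_def move_def)
qed

text \<open>The part of \<open>A\<^sub>i\<^sub>,\<^sub>a\<close> at \<open>i\<close> lives at distance one from \<open>a\<close>, and the parts at the neighbours live at \<open>a\<close>
  itself. Since the parity function alternates along edges, one admissible variable at \<open>i\<close> forces the
  others to be admissible.\<close>

lemma crystal_monomials_move:
  assumes n: "n \<ge> 2" and s: "parity_function n s" and m: "m \<in> crystal_monomials n s"
    and i: "i \<le> n" and \<epsilon>: "\<epsilon> \<in> {1, - 1}" and l: "single_at m i (- \<epsilon>) l"
  shows "move n \<epsilon> i l m \<in> crystal_monomials n s"
proof -
  have "move n \<epsilon> i l m \<in> monomials n"
    unfolding move_def diff_conv_add_uminus[of m] using m Amon_in_monomials[OF n i]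
    by (auto simp: crystal_monomials_def simp del: add_uminus_conv_diff
        intro!: monomials_add monomials_uminus)
  moreover have "uexp (move n \<epsilon> i l m) j k = 0" if j: "j \<le> n" and k: "k mod 2 = (int (s j) + 1) mod 2" for j k
  proof -
    have "uexp m i l \<noteq> 0"
      using l \<epsilon> by (auto simp: single_at_def)
    then have l_parity: "l mod 2 \<noteq> (int (s i) + 1) mod 2"
      using m i by (auto simp: crystal_monomials_def)
    have s_adj: "s j + s i = 1" if "adjacent n j i"
    proof -
      have "j \<noteq> i"
        using that not_adjacent_refl[of n i] i n by auto
      then have "cartan_mat n j i = - 1"
        using that by (simp add: cartan_mat_eq)
      then show ?thesis
        using s i j by (simp add: parity_function_def)
    qed
    have "uexp (Amon n i (l - \<epsilon>)) j k = 0"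
    proof (rule ccontr)
      assume ne: "uexp (Amon n i (l - \<epsilon>)) j k \<noteq> 0"
      consider "j = i" | "j \<noteq> i" "adjacent n j i" | "j \<noteq> i" "\<not> adjacent n j i"
        by blast
      then show False
      proof cases
        case 1
        then have "k = l \<or> k = l - 2 * \<epsilon>"
          using ne \<epsilon> by (auto simp: uexp_Amon_same[OF n i] split: if_splits)
        then have "k mod 2 = l mod 2"
          by presburger
        then show False
          using l_parity k 1 by simp
      next
        case 2
        then have "k = l - \<epsilon>"
          using ne by (auto simp: uexp_Amon_adjacent[OF n j i] split: if_splits)
        moreover have "int (s j) + int (s i) = 1"
          using s_adj[OF 2(2)] by linarith
        then have "int (s j) = 1 - int (s i)"
          by simp
        moreover have "\<epsilon> mod 2 = 1"
          using \<epsilon> by auto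
        ultimately have "l mod 2 = (int (s i) + 1) mod 2"
          using k by presburger
        with l_parity show False
          by simp
      next
        case 3
        then show False
          using ne uexp_Amon_far[OF n j i] by simp
      qed
    qed
    then show ?thesis
      using m j k by (simp add: uexp_move[OF \<epsilon>] crystal_monomials_def)
  qed
  ultimately show ?thesis
    by (simp add: crystal_monomials_def)
qed

text \<open>The predicate \<open>P\<close> describes a shape of monomials. As long as it guarantees the minuscule condition, the
  Kashiwara operators are moves, so \<open>P\<close> propagates through the whole crystal.\<close>

lemma minuscule_set_crystal:
  assumes q: "generic_q t" and n: "n \<ge> 2" and s: "parity_function n s" and m0: "m0 \<in> crystal_monomials n s"
    and P0: "P m0"
    and P_cases: "\<And>m i. P m \<Longrightarrow> i \<le> n \<Longrightarrow>
      (\<forall>l. uexp m i l = 0) \<or> (\<exists>\<epsilon>\<in>{1, - 1}. \<exists>l. single_at m i \<epsilon> l)"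
    and P_move: "\<And>m i \<epsilon> l. P m \<Longrightarrow> i \<le> n \<Longrightarrow> \<epsilon> \<in> {1, - 1} \<Longrightarrow> single_at m i (- \<epsilon>) l \<Longrightarrow> P (move n \<epsilon> i l m)"
  shows "minuscule_set t n (monomial_crystal n s m0)"
proof -
  interpret generic_q t by (rule q)
  have inv: "P m \<and> m \<in> crystal_monomials n s" if "m \<in> monomial_crystal n s m0" for m
    using that unfolding monomial_crystal_def mem_Collect_eq
  proof (induction rule: rtrancl_induct)
    case base
    then show ?case using P0 m0 by blast
  next
    case (step m m')
    then have P: "P m" and m': "m' \<in> crystal_monomials n s"
      by (auto simp: crystal_edges_def)
    from step(2) obtain i where i: "i \<le> n" and edge: "e_op n i m = Some m' \<or> f_op n i m = Some m'"
      by (auto simp: crystal_edges_def)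
    from P_cases[OF P i] have "P m'"
    proof (elim disjE bexE exE)
      assume "\<forall>l. uexp m i l = 0"
      then show ?thesis
        using edge crystal_operators_zero[of m i n] by simp
    next
      fix \<epsilon> l assume \<epsilon>: "\<epsilon> \<in> {1, - 1 :: int}" and l: "single_at m i \<epsilon> l"
      then have "m' = move n (- \<epsilon>) i l m"
        using edge crystal_operators_pos[of m i l n] crystal_operators_neg[of m i l n] by auto
      then show ?thesis
        using P_move[OF P i, of "- \<epsilon>" l] \<epsilon> l by auto
    qed
    with m' show ?case by blast
  qed
  show ?thesis
  proof
    show "monomial_crystal n s m0 \<subseteq> monomials n"
      using inv by (auto simp: crystal_monomials_def)
    fix m i assume m: "m \<in> monomial_crystal n s m0" and i: "i \<le> n"
    show "(\<forall>l. uexp m i l = 0) \<or> (\<exists>\<epsilon>\<in>{1, - 1}. \<exists>l. single_at m i \<epsilon> l)"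
      using P_cases inv[OF m] i by blast
    fix \<epsilon> l assume \<epsilon>: "\<epsilon> \<in> {1, - 1 :: int}" and l: "single_at m i (- \<epsilon>) l"
    have "e_op n i m = Some (move n \<epsilon> i l m) \<or> f_op n i m = Some (move n \<epsilon> i l m)"
      using \<epsilon> l crystal_operators_pos[of m i l n] crystal_operators_neg[of m i l n] by auto
    moreover have "move n \<epsilon> i l m \<in> crystal_monomials n s"
      using crystal_monomials_move[OF n s _ i \<epsilon> l] inv[OF m] by blast
    ultimately have "(m, move n \<epsilon> i l m) \<in> crystal_edges n s"
      using inv[OF m] i unfolding crystal_edges_def by auto
    then show "move n \<epsilon> i l m \<in> monomial_crystal n s m0"
      using m unfolding monomial_crystal_def by (auto intro: rtrancl_into_rtrancl)
  qed (rule n)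
qed

section \<open>Dipoles: the first and the last fundamental weight\<close>

text \<open>The monomial is \<open>Y\<^sub>i\<^sub>,\<^sub>a / Y\<^sub>j\<^sub>,\<^sub>a\<^sub>+\<^sub>1\<close> with \<open>j = \<sigma> i\<close>, where \<open>\<sigma>\<close> is the step to the previous or to the next
  node.\<close>

definition dipole :: "nat \<Rightarrow> (nat \<Rightarrow> nat) \<Rightarrow> monom \<Rightarrow> bool" where
  "dipole n \<sigma> m \<longleftrightarrow> (\<exists>i\<le>n. \<exists>a. \<forall>j\<le>n. \<forall>l. uexp m j l =
     (if j = i \<and> l = a then 1 else if j = \<sigma> i \<and> l = a + 1 then - 1 else 0))"

context
  fixes n :: nat and \<sigma> \<tau> :: "nat \<Rightarrow> nat"
  assumes n: "n \<ge> 2" and \<sigma>\<tau>: "\<sigma> = prv n \<and> \<tau> = nxt n \<or> \<sigma> = nxt n \<and> \<tau> = prv n"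
begin

lemma sides:
  assumes "i \<le> n"
  shows "\<sigma> i \<le> n" "\<tau> i \<le> n" "\<sigma> i \<noteq> i" "\<tau> i \<noteq> i" "\<sigma> i \<noteq> \<tau> i" "\<sigma> (\<tau> i) = i" "\<tau> (\<sigma> i) = i"
proof -
  have "\<sigma> i \<le> n \<and> \<tau> i \<le> n \<and> \<sigma> i \<noteq> i \<and> \<tau> i \<noteq> i \<and> \<sigma> i \<noteq> \<tau> i \<and> \<sigma> (\<tau> i) = i \<and> \<tau> (\<sigma> i) = i"
    using \<sigma>\<tau> neighbours_distinct[OF n assms]
    by (elim disjE conjE) (simp_all add: assms nxt_le prv_le)
  then show "\<sigma> i \<le> n" "\<tau> i \<le> n" "\<sigma> i \<noteq> i" "\<tau> i \<noteq> i" "\<sigma> i \<noteq> \<tau> i" "\<sigma> (\<tau> i) = i" "\<tau> (\<sigma> i) = i"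
    by simp_all
qed

lemma uexp_Amon_sides:
  assumes "i \<le> n" "j \<le> n"
  shows "uexp (Amon n i a) j l = (if j = i then (if l = a - 1 \<or> l = a + 1 then 1 else 0)
    else if j = \<sigma> i \<or> j = \<tau> i then (if l = a then - 1 else 0) else 0)"
proof -
  have "adjacent n j i \<longleftrightarrow> j = \<sigma> i \<or> j = \<tau> i"
    using \<sigma>\<tau> adjacent_sym[OF assms(1), of j] adjacent_sym[OF assms(2), of i] by (auto simp: adjacent_def)
  then show ?thesis
    using assms by (auto simp: uexp_Amon_same[OF n] uexp_Amon_adjacent[OF n] uexp_Amon_far[OF n])
qed

lemma dipole_cases:
  assumes "dipole n \<sigma> m" "i \<le> n"
  shows "(\<forall>l. uexp m i l = 0) \<or> (\<exists>\<epsilon>\<in>{1, - 1}. \<exists>l. single_at m i \<epsilon> l)"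
proof -
  obtain k a where k: "k \<le> n" and u: "\<And>j l. j \<le> n \<Longrightarrow> uexp m j l =
     (if j = k \<and> l = a then 1 else if j = \<sigma> k \<and> l = a + 1 then - 1 else 0)"
    using assms(1) unfolding dipole_def by blast
  consider "i = k" | "i = \<sigma> k" | "i \<noteq> k" "i \<noteq> \<sigma> k" by blast
  then show ?thesis
  proof cases
    case 1
    then have "single_at m i 1 a"
      using u[OF assms(2)] sides[OF k] by (auto simp: single_at_def)
    then show ?thesis by blast
  next
    case 2
    then have "single_at m i (- 1) (a + 1)"
      using u[OF assms(2)] sides[OF k] by (auto simp: single_at_def)
    then show ?thesis by blast
  next
    case 3
    then show ?thesis using u[OF assms(2)] by auto
  qed
qed

text \<open>A move at the numerator carries the dipole one step against \<open>\<sigma>\<close> and raises \<open>a\<close>; a move at the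
  denominator does the opposite.\<close>

lemma dipole_move:
  assumes "dipole n \<sigma> m" "i \<le> n" and \<epsilon>: "\<epsilon> \<in> {1, - 1}" and l: "single_at m i (- \<epsilon>) l"
  shows "dipole n \<sigma> (move n \<epsilon> i l m)"
proof -
  obtain k a where k: "k \<le> n" and u: "\<And>j l. j \<le> n \<Longrightarrow> uexp m j l =
     (if j = k \<and> l = a then 1 else if j = \<sigma> k \<and> l = a + 1 then - 1 else 0)"
    using assms(1) unfolding dipole_def by blast
  have at: "uexp m i l = - \<epsilon>"
    using l by (simp add: single_at_def)
  show ?thesis
  proof (cases "\<epsilon> = 1")
    case False
    with \<epsilon> have e: "\<epsilon> = - 1" by simp
    then have il: "i = k" "l = a"
      using at u[OF assms(2), of l] by (auto split: if_splits)
    have "uexp (move n \<epsilon> i l m) j l' = (if j = \<tau> k \<and> l' = a + 1 then 1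
        else if j = \<sigma> (\<tau> k) \<and> l' = (a + 1) + 1 then - 1 else 0)" if "j \<le> n" for j l'
      using sides[OF k]
      unfolding uexp_move[OF \<epsilon>] uexp_Amon_sides[OF assms(2) that] u[OF that]
      unfolding e il by auto
    then show ?thesis
      unfolding dipole_def using sides(2)[OF k] by blast
  next
    case True
    then have il: "i = \<sigma> k" "l = a + 1"
      using at u[OF assms(2), of l] by (auto split: if_splits)
    have "uexp (move n \<epsilon> i l m) j l' = (if j = \<sigma> k \<and> l' = a - 1 then 1
        else if j = \<sigma> (\<sigma> k) \<and> l' = (a - 1) + 1 then - 1 else 0)" if "j \<le> n" for j l'
    proof -
      have "\<sigma> (\<sigma> k) \<noteq> k" "\<sigma> (\<sigma> k) \<noteq> \<sigma> k"
        using sides(7)[OF k] sides(3,5)[OF sides(1)[OF k]] by simp_all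
      then show ?thesis
        using sides(3,7)[OF k]
        unfolding uexp_move[OF \<epsilon>] uexp_Amon_sides[OF assms(2) that] u[OF that]
        unfolding True il
        by (cases "j = \<sigma> k"; cases "j = k"; cases "j = \<sigma> (\<sigma> k)") simp_all
    qed
    then show ?thesis
      unfolding dipole_def using sides(1)[OF k] by blast
  qed
qed

end

section \<open>Height functions: the middle fundamental weight\<close>

text \<open>A closed path \<open>g\<close> with steps \<open>\<plusminus>1\<close> around the cyclic diagram; it exists only if the number \<open>n + 1\<close> of nodes is
  even. The second difference of \<open>g\<close> is \<open>2\<close> at a local minimum, \<open>-2\<close> at a local maximum and \<open>0\<close>
  elsewhere, so the exponents are half of it. In terms of column tableaux with \<open>r + 1\<close> boxes, the entries modulo
  \<open>n + 1\<close> are the nodes into which \<open>g\<close> descends.\<close>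

definition has_height :: "nat \<Rightarrow> monom \<Rightarrow> (nat \<Rightarrow> int) \<Rightarrow> bool" where
  "has_height n m g \<longleftrightarrow> (\<forall>i\<le>n. \<bar>g (nxt n i) - g i\<bar> = 1) \<and>
     (\<forall>i\<le>n. \<forall>l. 2 * uexp m i l = (if l = g i then g (nxt n i) + g (prv n i) - 2 * g i else 0))"

lemma has_heightD:
  assumes "has_height n m g" "i \<le> n"
  shows "g (nxt n i) = g i + 1 \<or> g (nxt n i) = g i - 1" "g (prv n i) = g i + 1 \<or> g (prv n i) = g i - 1"
    and "2 * uexp m i l = (if l = g i then g (nxt n i) + g (prv n i) - 2 * g i else 0)"
proof -
  have "\<bar>g (nxt n i) - g i\<bar> = 1" "\<bar>g (nxt n (prv n i)) - g (prv n i)\<bar> = 1"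
    using assms prv_le[of n i] unfolding has_height_def by blast+
  then show "g (nxt n i) = g i + 1 \<or> g (nxt n i) = g i - 1" "g (prv n i) = g i + 1 \<or> g (prv n i) = g i - 1"
    using nxt_prv[OF assms(2)] by auto
  show "2 * uexp m i l = (if l = g i then g (nxt n i) + g (prv n i) - 2 * g i else 0)"
    using assms unfolding has_height_def by blast
qed

lemma has_height_cases:
  assumes "has_height n m g" "i \<le> n"
  shows "(\<forall>l. uexp m i l = 0) \<or> (\<exists>\<epsilon>\<in>{1, - 1}. \<exists>l. single_at m i \<epsilon> l)"
proof -
  note g = has_heightD[OF assms]
  define c where "c = uexp m i (g i)"
  have "2 * c = g (nxt n i) + g (prv n i) - 2 * g i"
    using g(3)[of "g i"] by (simp add: c_def)
  with g(1,2) have "c \<in> {1, 0, - 1}"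
    by auto
  moreover have "single_at m i c (g i)"
  proof -
    have "uexp m i l = 0" if "l \<noteq> g i" for l
      using g(3)[of l] that by simp
    then show ?thesis
      by (simp add: single_at_def c_def)
  qed
  ultimately show ?thesis
    by (auto simp: single_at_def)
qed

text \<open>A move is possible at the local extrema only and reflects one of them: the value changes by \<open>2\<close>,
  towards the common value of the two neighbours and past it.\<close>

lemma has_height_move:
  assumes n: "n \<ge> 2" and g: "has_height n m g" and i: "i \<le> n"
    and \<epsilon>: "\<epsilon> \<in> {1, - 1}" and l: "single_at m i (- \<epsilon>) l"
  shows "has_height n (move n \<epsilon> i l m) (g(i := g i - 2 * \<epsilon>))"
proof -
  note gi = has_heightD[OF g i]
  have "uexp m i l = - \<epsilon>"
    using l by (simp add: single_at_def)
  then have li: "l = g i" and "g (nxt n i) + g (prv n i) - 2 * g i = - 2 * \<epsilon>"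
    using gi(3)[of l] \<epsilon> by (auto split: if_splits)
  with gi(1,2) \<epsilon> have nb: "g (nxt n i) = g i - \<epsilon>" "g (prv n i) = g i - \<epsilon>"
    by auto
  let ?g = "g(i := g i - 2 * \<epsilon>)"
  have ne: "nxt n i \<noteq> i" "prv n i \<noteq> i" "nxt n i \<noteq> prv n i"
    using neighbours_distinct[OF n i] by blast+
  have "\<bar>?g (nxt n j) - ?g j\<bar> = 1 \<and>
      2 * uexp (move n \<epsilon> i l m) j l' = (if l' = ?g j then ?g (nxt n j) + ?g (prv n j) - 2 * ?g j else 0)"
    if j: "j \<le> n" for j l'
  proof -
    note gj = has_heightD[OF g j]
    have nj: "nxt n j = i \<longleftrightarrow> j = prv n i" "prv n j = i \<longleftrightarrow> j = nxt n i"
      using i j by auto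
    have adjacent_height: "2 * uexp (move n \<epsilon> i l m) j l'
        = (if l' = g j then g (nxt n j) + g (prv n j) - 2 * g j - 2 * \<epsilon> else 0)"
      if "j = nxt n i \<or> j = prv n i" "g j = g i - \<epsilon>"
    proof -
      have "adjacent n j i"
        using that(1) i by (auto simp: adjacent_def)
      then have "uexp (move n \<epsilon> i l m) j l' = uexp m j l' - (if l' = g j then \<epsilon> else 0)"
        by (simp add: uexp_move[OF \<epsilon>] uexp_Amon_adjacent[OF n j i] li that(2))
      then show ?thesis
        using gj(3)[of l'] by simp
    qed
    consider "j = i" | "j = nxt n i" | "j = prv n i" | "j \<noteq> i" "j \<noteq> nxt n i" "j \<noteq> prv n i"
      by blast
    then show ?thesis
    proof cases
      case 1
      then show ?thesis
        using \<epsilon> ne nb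
        by (auto simp: uexp_move[OF \<epsilon>] uexp_Amon_same[OF n i] distrib_left gi(3) li)
    next
      case 2
      have "?g (nxt n j) = g (nxt n j)" "?g (prv n j) = g (prv n j) - 2 * \<epsilon>" "?g j = g j"
        using 2 ne nj by auto
      moreover have "2 * uexp (move n \<epsilon> i l m) j l'
          = (if l' = g j then g (nxt n j) + g (prv n j) - 2 * g j - 2 * \<epsilon> else 0)"
        using 2 by (intro adjacent_height) (simp_all add: nb)
      ultimately show ?thesis
        using gj(1) by auto
    next
      case 3
      have "?g (nxt n j) = g (nxt n j) - 2 * \<epsilon>" "?g (prv n j) = g (prv n j)" "?g j = g j"
        using 3 ne nj by auto
      moreover have "2 * uexp (move n \<epsilon> i l m) j l'
          = (if l' = g j then g (nxt n j) + g (prv n j) - 2 * g j - 2 * \<epsilon> else 0)"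
        using 3 by (intro adjacent_height) (simp_all add: nb)
      moreover have "g (nxt n j) = g j + \<epsilon>"
        using 3 i nb by simp
      ultimately show ?thesis
        using \<epsilon> by auto
    next
      case 4
      then have "\<not> adjacent n j i"
        using nj by (auto simp: adjacent_def)
      then show ?thesis
        using gj 4 nj by (auto simp: uexp_move[OF \<epsilon>] uexp_Amon_far[OF n j i 4(1)])
    qed
  qed
  then show ?thesis
    unfolding has_height_def by blast
qed

section \<open>The representation\<close>

lemma uexp_extremal_monomial:
  "uexp (extremal_monomial n l) i a =
    (if i = l \<and> a = 0 then 1 else 0) - (if i = 0 \<and> a = int (d_index n l) then 1 else 0)"
  unfolding uexp_def extremal_monomial_def Yvar_def snd_conv lookup_minus lookup_single when_def
  by (intro arg_cong2[where f = "(-)"] if_cong) auto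

lemma minuscule_set_extremal_crystal:
  assumes r: "r \<ge> 1" "n = 2 * r + 1" and l: "l \<in> {1, r + 1, n}"
    and q: "generic_q t" and s: "parity_function n s" and m0: "extremal_monomial n l \<in> crystal_monomials n s"
  shows "minuscule_set t n (monomial_crystal n s (extremal_monomial n l))"
proof -
  have n: "n \<ge> 2"
    using r by simp
  note crystal = minuscule_set_crystal[OF q n s m0]
  consider "l = 1" | "l = n" | "l = r + 1"
    using l by blast
  then show ?thesis
  proof cases
    case 1
    have "d_index n l = 1" "prv n 1 = 0"
      using 1 r by (simp_all add: d_index_def prv_eq)
    then have "dipole n (prv n) (extremal_monomial n l)"
      unfolding dipole_def uexp_extremal_monomial
      using 1 n by (intro exI[of _ 1] conjI exI[of _ 0]) auto
    then show ?thesis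
      using dipole_cases[OF n, of "prv n" "nxt n"] dipole_move[OF n, of "prv n" "nxt n"]
      by (intro crystal[of "dipole n (prv n)"]) auto
  next
    case 2
    have "d_index n l = 1" "nxt n n = 0"
      using 2 r by (simp_all add: d_index_def nxt_eq)
    then have "dipole n (nxt n) (extremal_monomial n l)"
      unfolding dipole_def uexp_extremal_monomial
      using 2 n by (intro exI[of _ n] conjI exI[of _ 0]) auto
    then show ?thesis
      using dipole_cases[OF n, of "nxt n" "prv n"] dipole_move[OF n, of "nxt n" "prv n"]
      by (intro crystal[of "dipole n (nxt n)"]) auto
  next
    case 3
    have d: "d_index n l = r + 1"
      using 3 r by (simp add: d_index_def)
    \<comment> \<open>the distance to the node \<open>r + 1\<close>: its only local minimum is there, with value \<open>0\<close>, and its only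
      local maximum is at the node \<open>0\<close>, with value \<open>r + 1\<close>\<close>
    have "has_height n (extremal_monomial n l) (\<lambda>i. \<bar>int i - int (r + 1)\<bar>)"
      unfolding has_height_def uexp_extremal_monomial d using r 3
      by (auto simp: nxt_eq prv_eq of_nat_diff abs_if split: if_splits)
    then show ?thesis
      using has_height_cases has_height_move[OF n]
      by (intro crystal[of "\<lambda>m. \<exists>g. has_height n m g"]) blast+
  qed
qed

theorem theorem4p1:
  fixes n r l :: nat and t :: complex and s :: "nat \<Rightarrow> nat"
  assumes "r \<ge> 1" and "n = 2 * r + 1" and "l \<in> {1, r + 1, n}"
    and "\<forall>k::nat. k > 0 \<longrightarrow> (exp t) ^ k \<noteq> 1"
    and "parity_function n s"
    and "extremal_monomial n l \<in> crystal_monomials n s"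
  shows "\<exists>(scale :: complex \<Rightarrow> (monom \<Rightarrow>\<^sub>0 complex) \<Rightarrow> (monom \<Rightarrow>\<^sub>0 complex)) V act.
           toroidal_module scale n t V act \<and>
           toroidal_module.integrable scale n t V act \<and>
           toroidal_module.thin scale n t V act \<and>
           toroidal_module.has_q_character scale n t V act
             (\<lambda>m. if m \<in> monomial_crystal n s (extremal_monomial n l) then 1 else 0)"
proof -
  have "generic_q t"
    using assms(4) by unfold_locales
  then interpret minuscule_set t n "monomial_crystal n s (extremal_monomial n l)"
    using minuscule_set_extremal_crystal[OF assms(1-3) _ assms(5,6)] by blast
  show ?thesis
    using toroidal_module_axioms integrable thin has_q_character by blast
qed

end
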